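(* Let $(M^n,g)$ be a non-Kähler Strominger Kähler-like (SKL) manifold. If $n\leq 3$ and the Strominger connection $\nabla^s$ has vanishing first Ricci curvature, then $g$ is Strominger flat, i.e. the curvature of $\nabla^s$ vanishes identically.
   Context: Manifolds are connected; $n$ is the complex dimension. For a Hermitian manifold $(M^n,g)$ with complex structure $J$, the Strominger (Bismut) connection $\nabla^s$ is the unique connection with $\nabla^s g=0$, $\nabla^s J=0$ whose torsion $T^s$ is totally skew-symmetric (i.e. $g(T^s(x,y),z)$ is a $3$-form). $(M,g)$ is Strominger Kähler-like (SKL) if the curvature tensor $R^s$ of $\nabla^s$ has all the symmetries of the curvature of a Kähler manifold: $R^s(x,y,z,w)+R^s(y,z,x,w)+R^s(z,x,y,w)=0$ and $R^s(x,y,z,w)=R^s(Jx,Jy,z,w)=R^s(x,y,Jz,Jw)$ for all real tangent vectors $x,y,z,w$. The first Ricci curvature of $\nabla^s$ is (up to a constant factor) the $2$-form $\mathrm{tr}\,\Theta^s$, where $\Theta^s$ is the curvature matrix of $\nabla^s$ acting on $T^{1,0}M$ with respect to a local unitary frame. *)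

theory Defs
  imports "HOL-Analysis.Analysis"
begin

section \<open>Smooth and holomorphic maps on open sets\<close>

primrec Ck_on :: "nat \<Rightarrow> 'a::real_normed_vector set \<Rightarrow> ('a \<Rightarrow> 'b::real_normed_vector) \<Rightarrow> bool" where
  "Ck_on 0 S f \<longleftrightarrow> continuous_on S f"
| "Ck_on (Suc k) S f \<longleftrightarrow>
     (\<forall>x\<in>S. f differentiable (at x)) \<and> (\<forall>v. Ck_on k S (\<lambda>x. frechet_derivative f (at x) v))"

definition smooth_on :: "'a::real_normed_vector set \<Rightarrow> ('a \<Rightarrow> 'b::real_normed_vector) \<Rightarrow> bool" where
  "smooth_on S f \<longleftrightarrow> (\<forall>k. Ck_on k S f)"

text \<open>Tangent vectors in a holomorphic chart are elements of \<open>complex ^ 'n\<close>, regarded as a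
  real vector space; the complex structure \<open>J\<close> is multiplication by the imaginary unit.\<close>

definition J :: "complex ^ 'n \<Rightarrow> complex ^ 'n" where
  "J v = \<i> *s v"

text \<open>Holomorphic maps of several variables: smooth maps satisfying the
  Cauchy--Riemann equations.\<close>

definition holomorphic_map_on :: "(complex ^ 'n) set \<Rightarrow> (complex ^ 'n \<Rightarrow> complex ^ 'm) \<Rightarrow> bool" where
  "holomorphic_map_on S f \<longleftrightarrow>
     smooth_on S f \<and>
     (\<forall>z\<in>S. \<forall>v. frechet_derivative f (at z) (J v) = J (frechet_derivative f (at z) v))"

section \<open>Complex manifolds\<close>

type_synonym ('a, 'n) chart = "'a set \<times> ('a \<Rightarrow> complex ^ 'n)"

definition chart_image :: "('a, 'n) chart \<Rightarrow> (complex ^ 'n) set" where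
  "chart_image c = snd c ` fst c"

definition overlap :: "('a, 'n) chart \<Rightarrow> ('a, 'n) chart \<Rightarrow> (complex ^ 'n) set" where
  "overlap c d = snd c ` (fst c \<inter> fst d)"

text \<open>Change of coordinates from \<open>c\<close> to \<open>d\<close>, meaningful on \<open>overlap c d\<close>.\<close>

definition transition :: "('a, 'n) chart \<Rightarrow> ('a, 'n) chart \<Rightarrow> complex ^ 'n \<Rightarrow> complex ^ 'n" where
  "transition c d = snd d \<circ> inv_into (fst c) (snd c)"

definition chart_on :: "'a topology \<Rightarrow> ('a, 'n::finite) chart \<Rightarrow> bool" where
  "chart_on M c \<longleftrightarrow>
     openin M (fst c) \<and> open (chart_image c) \<and>
     homeomorphic_map (subtopology M (fst c)) (subtopology euclidean (chart_image c)) (snd c)"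

definition complex_manifold :: "'a topology \<Rightarrow> ('a, 'n::finite) chart set \<Rightarrow> bool" where
  "complex_manifold M \<A> \<longleftrightarrow>
     Hausdorff_space M \<and> second_countable M \<and> connected_space M \<and> topspace M \<noteq> {} \<and>
     (\<forall>c\<in>\<A>. chart_on M c) \<and> (\<Union>c\<in>\<A>. fst c) = topspace M \<and>
     (\<forall>c\<in>\<A>. \<forall>d\<in>\<A>. holomorphic_map_on (overlap c d) (transition c d))"

section \<open>Hermitian metrics\<close>

text \<open>A tensor field is given by its local expression in each chart of the atlas; the local
  expressions are related by the usual transformation law on overlaps.\<close>

type_synonym ('a, 'n) metric =
  "('a, 'n) chart \<Rightarrow> complex ^ 'n \<Rightarrow> complex ^ 'n \<Rightarrow> complex ^ 'n \<Rightarrow> real"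

definition hermitian_metric :: "('a, 'n::finite) chart set \<Rightarrow> ('a, 'n) metric \<Rightarrow> bool" where
  "hermitian_metric \<A> g \<longleftrightarrow>
     (\<forall>c\<in>\<A>.
        (\<forall>z\<in>chart_image c.
           bilinear (g c z) \<and>
           (\<forall>u v. g c z u v = g c z v u) \<and>
           (\<forall>u. u \<noteq> 0 \<longrightarrow> g c z u u > 0) \<and>
           (\<forall>u v. g c z (J u) (J v) = g c z u v)) \<and>
        (\<forall>u v. smooth_on (chart_image c) (\<lambda>z. g c z u v))) \<and>
     (\<forall>c\<in>\<A>. \<forall>d\<in>\<A>. \<forall>z\<in>overlap c d. \<forall>u v.
        g c z u v =
          g d (transition c d z)
            (frechet_derivative (transition c d) (at z) u)
            (frechet_derivative (transition c d) (at z) v))"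

definition kaehler_form ::
  "('a, 'n) metric \<Rightarrow> ('a, 'n) chart \<Rightarrow> complex ^ 'n \<Rightarrow> complex ^ 'n \<Rightarrow> complex ^ 'n \<Rightarrow> real" where
  "kaehler_form g c z u v = g c z (J u) v"

text \<open>Exterior derivative of a 2-form, evaluated on constant (hence commuting) vector fields.\<close>

definition ext_deriv2 ::
  "(complex ^ 'n \<Rightarrow> complex ^ 'n \<Rightarrow> complex ^ 'n \<Rightarrow> real) \<Rightarrow>
    complex ^ 'n \<Rightarrow> complex ^ 'n \<Rightarrow> complex ^ 'n \<Rightarrow> complex ^ 'n \<Rightarrow> real" where
  "ext_deriv2 \<alpha> z u v w =
     frechet_derivative (\<lambda>p. \<alpha> p v w) (at z) u
     - frechet_derivative (\<lambda>p. \<alpha> p u w) (at z) v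
     + frechet_derivative (\<lambda>p. \<alpha> p u v) (at z) w"

definition kaehler :: "('a, 'n::finite) chart set \<Rightarrow> ('a, 'n) metric \<Rightarrow> bool" where
  "kaehler \<A> g \<longleftrightarrow>
     (\<forall>c\<in>\<A>. \<forall>z\<in>chart_image c. \<forall>u v w. ext_deriv2 (kaehler_form g c) z u v w = 0)"

section \<open>Affine connections\<close>

text \<open>A connection is given by its Christoffel symbols \<open>\<Gamma> c z\<close>, a bilinear map, in each chart
  \<open>c\<close>, so that \<open>\<nabla>\<^sub>X Y = DY(X) + \<Gamma>(X, Y)\<close> in coordinates. The transformation law says that this
  operator does not depend on the chart.\<close>

type_synonym 'n christoffel = "complex ^ 'n \<Rightarrow> complex ^ 'n \<Rightarrow> complex ^ 'n \<Rightarrow> complex ^ 'n"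

type_synonym 'n vfield = "complex ^ 'n \<Rightarrow> complex ^ 'n"

definition connection ::
  "('a, 'n::finite) chart set \<Rightarrow> (('a, 'n) chart \<Rightarrow> 'n christoffel) \<Rightarrow> bool" where
  "connection \<A> \<Gamma> \<longleftrightarrow>
     (\<forall>c\<in>\<A>.
        (\<forall>z\<in>chart_image c. bilinear (\<Gamma> c z)) \<and>
        (\<forall>u v. smooth_on (chart_image c) (\<lambda>z. \<Gamma> c z u v))) \<and>
     (\<forall>c\<in>\<A>. \<forall>d\<in>\<A>. \<forall>z\<in>overlap c d. \<forall>u v.
        let \<psi> = transition c d; D = (\<lambda>p. frechet_derivative \<psi> (at p)) in
          D z (\<Gamma> c z u v) =
            frechet_derivative (\<lambda>p. D p v) (at z) u + \<Gamma> d (\<psi> z) (D z u) (D z v))"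

definition cov_deriv :: "'n christoffel \<Rightarrow> 'n::finite vfield \<Rightarrow> 'n vfield \<Rightarrow> 'n vfield" where
  "cov_deriv G X Y = (\<lambda>z. frechet_derivative Y (at z) (X z) + G z (X z) (Y z))"

definition lie_bracket :: "'n::finite vfield \<Rightarrow> 'n vfield \<Rightarrow> 'n vfield" where
  "lie_bracket X Y =
     (\<lambda>z. frechet_derivative Y (at z) (X z) - frechet_derivative X (at z) (Y z))"

definition torsion :: "'n christoffel \<Rightarrow> 'n::finite vfield \<Rightarrow> 'n vfield \<Rightarrow> 'n vfield" where
  "torsion G X Y = (\<lambda>z. cov_deriv G X Y z - cov_deriv G Y X z - lie_bracket X Y z)"

definition curvature ::
  "'n christoffel \<Rightarrow> 'n::finite vfield \<Rightarrow> 'n vfield \<Rightarrow> 'n vfield \<Rightarrow> 'n vfield" where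
  "curvature G X Y Z =
     (\<lambda>z. cov_deriv G X (cov_deriv G Y Z) z - cov_deriv G Y (cov_deriv G X Z) z
          - cov_deriv G (lie_bracket X Y) Z z)"

text \<open>Torsion and curvature are tensorial, so their values on tangent vectors at a point may be
  computed from the constant extensions of these vectors.\<close>

definition torsion_at ::
  "'n christoffel \<Rightarrow> complex ^ 'n \<Rightarrow> complex ^ 'n::finite \<Rightarrow> complex ^ 'n \<Rightarrow> complex ^ 'n" where
  "torsion_at G z x y = torsion G (\<lambda>_. x) (\<lambda>_. y) z"

definition curvature_at ::
  "'n christoffel \<Rightarrow> complex ^ 'n \<Rightarrow>
     complex ^ 'n::finite \<Rightarrow> complex ^ 'n \<Rightarrow> complex ^ 'n \<Rightarrow> complex ^ 'n" where
  "curvature_at G z x y w = curvature G (\<lambda>_. x) (\<lambda>_. y) (\<lambda>_. w) z"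

section \<open>The Strominger connection\<close>

definition metric_connection ::
  "('a, 'n::finite) chart set \<Rightarrow> ('a, 'n) metric \<Rightarrow> (('a, 'n) chart \<Rightarrow> 'n christoffel) \<Rightarrow> bool" where
  "metric_connection \<A> g \<Gamma> \<longleftrightarrow>
     (\<forall>c\<in>\<A>. \<forall>X Y Z.
        smooth_on (chart_image c) X \<and> smooth_on (chart_image c) Y \<and> smooth_on (chart_image c) Z \<longrightarrow>
        (\<forall>z\<in>chart_image c.
           frechet_derivative (\<lambda>p. g c p (Y p) (Z p)) (at z) (X z) =
             g c z (cov_deriv (\<Gamma> c) X Y z) (Z z) + g c z (Y z) (cov_deriv (\<Gamma> c) X Z z)))"

definition complex_connection ::
  "('a, 'n::finite) chart set \<Rightarrow> (('a, 'n) chart \<Rightarrow> 'n christoffel) \<Rightarrow> bool" where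
  "complex_connection \<A> \<Gamma> \<longleftrightarrow>
     (\<forall>c\<in>\<A>. \<forall>X Y. smooth_on (chart_image c) X \<and> smooth_on (chart_image c) Y \<longrightarrow>
        (\<forall>z\<in>chart_image c.
           cov_deriv (\<Gamma> c) X (\<lambda>p. J (Y p)) z = J (cov_deriv (\<Gamma> c) X Y z)))"

definition skew_torsion ::
  "('a, 'n::finite) chart set \<Rightarrow> ('a, 'n) metric \<Rightarrow> (('a, 'n) chart \<Rightarrow> 'n christoffel) \<Rightarrow> bool" where
  "skew_torsion \<A> g \<Gamma> \<longleftrightarrow>
     (\<forall>c\<in>\<A>. \<forall>z\<in>chart_image c. \<forall>x y w.
        g c z (torsion_at (\<Gamma> c) z x y) w = - g c z (torsion_at (\<Gamma> c) z y x) w \<and>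
        g c z (torsion_at (\<Gamma> c) z x y) w = - g c z (torsion_at (\<Gamma> c) z x w) y)"

definition strominger_connection ::
  "('a, 'n::finite) chart set \<Rightarrow> ('a, 'n) metric \<Rightarrow> (('a, 'n) chart \<Rightarrow> 'n christoffel) \<Rightarrow> bool" where
  "strominger_connection \<A> g \<Gamma> \<longleftrightarrow>
     connection \<A> \<Gamma> \<and> metric_connection \<A> g \<Gamma> \<and> complex_connection \<A> \<Gamma> \<and> skew_torsion \<A> g \<Gamma>"

definition curvature_tensor ::
  "('a, 'n::finite) metric \<Rightarrow> (('a, 'n) chart \<Rightarrow> 'n christoffel) \<Rightarrow> ('a, 'n) chart \<Rightarrow>
     complex ^ 'n \<Rightarrow> complex ^ 'n \<Rightarrow> complex ^ 'n \<Rightarrow> complex ^ 'n \<Rightarrow> complex ^ 'n \<Rightarrow> real" where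
  "curvature_tensor g \<Gamma> c z x y u v = g c z (curvature_at (\<Gamma> c) z x y u) v"

definition kaehler_like ::
  "('a, 'n::finite) chart set \<Rightarrow> ('a, 'n) metric \<Rightarrow> (('a, 'n) chart \<Rightarrow> 'n christoffel) \<Rightarrow> bool" where
  "kaehler_like \<A> g \<Gamma> \<longleftrightarrow>
     (\<forall>c\<in>\<A>. \<forall>z\<in>chart_image c. \<forall>x y u v.
        let R = curvature_tensor g \<Gamma> c z in
          R x y u v + R y u x v + R u x y v = 0 \<and>
          R x y u v = R (J x) (J y) u v \<and>
          R x y u v = R x y (J u) (J v))"

text \<open>The tangent space with complex structure \<open>J\<close> is identified with the holomorphic tangent space
  by sending \<open>u\<close> to \<open>(u - \<i> J u) / sqrt 2\<close>. With \<open>g\<close> extended complex bilinearly, the Hermitian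
  product \<open>g(a, cnj b)\<close> of the images \<open>a, b\<close> of \<open>u, v\<close> becomes \<open>hermitian_form g c z u v\<close>.\<close>

definition hermitian_form ::
  "('a, 'n) metric \<Rightarrow> ('a, 'n) chart \<Rightarrow> complex ^ 'n \<Rightarrow> complex ^ 'n \<Rightarrow> complex ^ 'n \<Rightarrow> complex" where
  "hermitian_form g c z u v = Complex (g c z u v) (g c z u (J v))"

definition unitary_frame ::
  "('a, 'n::finite) metric \<Rightarrow> ('a, 'n) chart \<Rightarrow> complex ^ 'n \<Rightarrow> ('n \<Rightarrow> complex ^ 'n) \<Rightarrow> bool" where
  "unitary_frame g c z e \<longleftrightarrow> (\<forall>i j. hermitian_form g c z (e i) (e j) = (if i = j then 1 else 0))"

text \<open>The entry \<open>\<Theta>\<^sub>i\<^sub>j(x, y)\<close>, the coefficient of \<open>e j\<close> in \<open>R(x, y) (e i)\<close>.\<close>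

definition curvature_matrix ::
  "('a, 'n::finite) metric \<Rightarrow> (('a, 'n) chart \<Rightarrow> 'n christoffel) \<Rightarrow> ('a, 'n) chart \<Rightarrow>
     complex ^ 'n \<Rightarrow> ('n \<Rightarrow> complex ^ 'n) \<Rightarrow> complex ^ 'n \<Rightarrow> complex ^ 'n \<Rightarrow> 'n \<Rightarrow> 'n \<Rightarrow> complex" where
  "curvature_matrix g \<Gamma> c z e x y i j =
     hermitian_form g c z (curvature_at (\<Gamma> c) z x y (e i)) (e j)"

definition first_ricci_flat ::
  "('a, 'n::finite) chart set \<Rightarrow> ('a, 'n) metric \<Rightarrow> (('a, 'n) chart \<Rightarrow> 'n christoffel) \<Rightarrow> bool" where
  "first_ricci_flat \<A> g \<Gamma> \<longleftrightarrow>
     (\<forall>c\<in>\<A>. \<forall>z\<in>chart_image c. \<forall>e. unitary_frame g c z e \<longrightarrow>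
        (\<forall>x y. (\<Sum>i\<in>UNIV. curvature_matrix g \<Gamma> c z e x y i i) = 0))"

definition flat_connection ::
  "('a, 'n::finite) chart set \<Rightarrow> (('a, 'n) chart \<Rightarrow> 'n christoffel) \<Rightarrow> bool" where
  "flat_connection \<A> \<Gamma> \<longleftrightarrow>
     (\<forall>c\<in>\<A>. \<forall>z\<in>chart_image c. \<forall>x y w. curvature_at (\<Gamma> c) z x y w = 0)"

end

(* Write T for the torsion, tau for its (2,0) part and h for the Hermitian form. Differentiating
   the metric and the first Bianchi identity show that nabla T is a 4-form, quadratic in T; its
   type (2,2) forces the Jacobi identity for tau and expresses N = nabla tau through tau and
   conj tau. The (0,2) part of the curvature vanishes, so the Ricci identity for tau has a (0,2)
   part which involves only T and N; together with the derivative of the Jacobi identity it gives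
   cubic identities in T. Where T is nonzero and n <= 3 these force N = 0: if the trace
   eta(x) = tr tau(x, .) vanished, a contraction would give T = 0, and otherwise tau is encoded, in
   a frame with e3 dual to eta, by a 2 x 2 matrix m = tau(e3, .) with nonzero trace which turns out
   to be normal.

   Once N = 0 the curvature operators are derivations of tau. They kill e3 and commute with m,
   which is not scalar, so that a trace free curvature tensor with the symmetries of a Kaehler
   curvature must vanish. Since nabla T is quadratic in T, the zero set of T is open as well as
   closed; as M is connected and g is not Kaehler, T vanishes nowhere. *)

theory Submission
  imports Defs
begin

section \<open>Hermitian forms and torsion of type (2,1) + (1,2)\<close>

text \<open>By the Jacobi identity \<open>\<tau>\<close> is the bracket of a complex Lie algebra on
  each tangent space, and eta is the trace of its adjoint representation. For n = 3 the exterior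
  square of the tangent space is again three-dimensional, so \<open>\<tau>\<close> and its
  derivative both become 3 x 3 matrices. The case eta = 0 is the unimodular one. The Jacobi identity
  alone permits it (sl(2) is unimodular), so it is excluded by the metric. If eta is nonzero, its
  kernel is abelian and contains the derived algebra; the bracket is then the action m of e3 on that
  kernel. The formula for N is used twice here: its (e1, e2) entry shows that m is not scalar, and
  once N = 0 its entries on planes containing e3 say that m commutes with its adjoint.

  The differential geometry takes place in one chart at a time. A tensor identity is differentiated
  at a point by evaluating it on vector fields whose covariant derivative vanishes at that
  point.\<close>

lemma J_add [simp]: "J (x + y) = J x + J y"
  and J_diff [simp]: "J (x - y) = J x - J y"
  and J_minus [simp]: "J (- x) = - J x"
  and J_zero [simp]: "J 0 = 0"
  and J_J [simp]: "J (J x) = - x"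
  and J_scaleR [simp]: "J (r *\<^sub>R x) = r *\<^sub>R J x"
  by (simp_all add: J_def vec_eq_iff algebra_simps)

lemma linear_J: "linear J"
  by (rule linearI) simp_all

lemma complex_smult_eq: "c *s x = Re c *\<^sub>R x + Im c *\<^sub>R J x"
  by (simp add: J_def vec_eq_iff complex_eq_iff)

locale hermitian_space =
  fixes g :: "complex ^ 'n::finite \<Rightarrow> complex ^ 'n \<Rightarrow> real"
  assumes bilinear_g: "bilinear g"
    and g_sym: "g u v = g v u"
    and g_pos: "u \<noteq> 0 \<Longrightarrow> 0 < g u u"
    and g_J: "g (J u) (J v) = g u v"
begin

lemmas g_bil = bilinear_ladd[OF bilinear_g] bilinear_radd[OF bilinear_g]
  bilinear_lsub[OF bilinear_g] bilinear_rsub[OF bilinear_g]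
  bilinear_lneg[OF bilinear_g] bilinear_rneg[OF bilinear_g]
  bilinear_lmul[OF bilinear_g] bilinear_rmul[OF bilinear_g]
  bilinear_lzero[OF bilinear_g] bilinear_rzero[OF bilinear_g]

lemma g_J_left: "g (J u) v = - g u (J v)"
  using g_J[of u "J v"] by (simp add: g_bil)

lemma g_eqI: "(\<And>w. g u w = g v w) \<Longrightarrow> u = v"
proof -
  assume "\<And>w. g u w = g v w"
  then have "g (u - v) (u - v) = 0" by (simp add: g_bil)
  then show ?thesis using g_pos[of "u - v"] by fastforce
qed

definition h :: "complex ^ 'n \<Rightarrow> complex ^ 'n \<Rightarrow> complex" where
  "h u v = Complex (g u v) (g u (J v))"

lemma h_bil: "h (x + y) v = h x v + h y v" "h u (x + y) = h u x + h u y"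
  "h (x - y) v = h x v - h y v" "h u (x - y) = h u x - h u y"
  "h (- x) v = - h x v" "h u (- x) = - h u x"
  "h 0 v = 0" "h u 0 = 0"
  "h (J x) v = \<i> * h x v" "h u (J x) = - \<i> * h u x"
  "h (r *\<^sub>R x) v = of_real r * h x v" "h u (r *\<^sub>R x) = of_real r * h u x"
  by (simp_all add: h_def g_bil complex_eq_iff g_J_left g_J)

lemma h_smult: "h (c *s x) v = c * h x v" "h u (c *s x) = cnj c * h u x"
  by (simp_all add: complex_smult_eq h_bil complex_eq_iff)

lemma h_sum: "h (sum f A) v = (\<Sum>a\<in>A. h (f a) v)" "h u (sum f A) = (\<Sum>a\<in>A. h u (f a))"
  by (induction A rule: infinite_finite_induct) (simp_all add: h_bil)

lemma cnj_h: "cnj (h u v) = h v u"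
  using g_J_left[of u v] by (simp add: h_def complex_eq_iff g_sym)

lemma h_self: "h u u = of_real (g u u)"
  using cnj_h[of u u] by (simp add: h_def complex_eq_iff)

lemma Re_h: "Re (h u v) = g u v"
  by (simp add: h_def)

lemma h_eqI: "(\<And>w. h u w = h v w) \<Longrightarrow> u = v"
  using g_eqI[of u v] by (metis Re_h)

lemma h_eqI2: "(\<And>w. h w u = h w v) \<Longrightarrow> u = v"
  using h_eqI[of u v] by (metis cnj_h)

end

text \<open>\<open>T_type\<close> says that the part of \<open>T\<close> that is conjugate linear in
  both arguments vanishes. With total skewness this gives the 3-form type (2,1) + (1,2).\<close>

locale skew_torsion_form = hermitian_space g
  for g :: "complex ^ 'n::finite \<Rightarrow> complex ^ 'n \<Rightarrow> real" +
  fixes T :: "complex ^ 'n \<Rightarrow> complex ^ 'n \<Rightarrow> complex ^ 'n"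
  assumes bilinear_T: "bilinear T"
    and T_skew: "T x y = - T y x"
    and T_alt: "g (T x y) w = - g (T x w) y"
    and T_type: "T (J x) (J y) = T x y + J (T (J x) y) + J (T x (J y))"
begin

lemmas T_bil = bilinear_ladd[OF bilinear_T] bilinear_radd[OF bilinear_T]
  bilinear_lsub[OF bilinear_T] bilinear_rsub[OF bilinear_T]
  bilinear_lneg[OF bilinear_T] bilinear_rneg[OF bilinear_T]
  bilinear_lmul[OF bilinear_T] bilinear_rmul[OF bilinear_T]
  bilinear_lzero[OF bilinear_T] bilinear_rzero[OF bilinear_T]

text \<open>The complex bilinear part of \<open>T\<close>; \<open>T_type\<close> shortens the
  projection from four terms to two.\<close>

definition \<tau> :: "complex ^ 'n \<Rightarrow> complex ^ 'n \<Rightarrow> complex ^ 'n" where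
  "\<tau> x y = (1/2) *\<^sub>R (T x y - T (J x) (J y))"

text \<open>The part of \<open>T\<close> that is complex linear in \<open>x\<close> and conjugate
  linear in \<open>y\<close>, shortened by \<open>T_type\<close> in the same way.\<close>

definition \<delta> :: "complex ^ 'n \<Rightarrow> complex ^ 'n \<Rightarrow> complex ^ 'n" where
  "\<delta> x y = (1/2) *\<^sub>R (T x y + J (T x (J y)))"

lemma \<tau>_bil: "\<tau> (x + y) v = \<tau> x v + \<tau> y v" "\<tau> u (x + y) = \<tau> u x + \<tau> u y"
  "\<tau> (x - y) v = \<tau> x v - \<tau> y v" "\<tau> u (x - y) = \<tau> u x - \<tau> u y"
  "\<tau> (- x) v = - \<tau> x v" "\<tau> u (- x) = - \<tau> u x"
  "\<tau> 0 v = 0" "\<tau> u 0 = 0"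
  "\<tau> (r *\<^sub>R x) v = r *\<^sub>R \<tau> x v" "\<tau> u (r *\<^sub>R x) = r *\<^sub>R \<tau> u x"
  by (simp_all add: \<tau>_def T_bil algebra_simps)

lemma \<delta>_bil: "\<delta> (x + y) v = \<delta> x v + \<delta> y v" "\<delta> u (x + y) = \<delta> u x + \<delta> u y"
  "\<delta> (x - y) v = \<delta> x v - \<delta> y v" "\<delta> u (x - y) = \<delta> u x - \<delta> u y"
  "\<delta> (- x) v = - \<delta> x v" "\<delta> u (- x) = - \<delta> u x"
  "\<delta> 0 v = 0" "\<delta> u 0 = 0"
  "\<delta> (r *\<^sub>R x) v = r *\<^sub>R \<delta> x v" "\<delta> u (r *\<^sub>R x) = r *\<^sub>R \<delta> u x"
  by (simp_all add: \<delta>_def T_bil algebra_simps)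

lemma \<tau>_J: "\<tau> (J x) y = J (\<tau> x y)" "\<tau> x (J y) = J (\<tau> x y)"
  using T_type[of "J x" y] T_type[of x "J y"]
  by (simp_all add: \<tau>_def T_bil algebra_simps)

lemma \<delta>_J: "\<delta> (J x) y = J (\<delta> x y)" "\<delta> x (J y) = - J (\<delta> x y)"
  using T_type[of "J x" y]
  by (simp_all add: \<delta>_def T_bil algebra_simps)

lemma \<tau>_skew: "\<tau> x y = - \<tau> y x"
  using T_skew[of x y] T_skew[of "J x" "J y"] by (simp add: \<tau>_def algebra_simps)

lemma T_eq: "T x y = \<tau> x y + \<delta> x y - \<delta> y x"
proof -
  have "2 *\<^sub>R (\<tau> x y + \<delta> x y - \<delta> y x) = 2 *\<^sub>R T x y"
    using T_type[of x y] T_skew[of y x] T_skew[of y "J x"]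
    unfolding \<tau>_def \<delta>_def by (simp add: scaleR_right_distrib scaleR_right_diff_distrib scaleR_2)
  then show ?thesis by simp
qed

text \<open>Total skewness makes \<open>g (T x y) w\<close> cyclic, so that
  \<open>\<lambda>x. \<delta> x y\<close> is the adjoint of \<open>\<tau> y\<close>. Thus
  \<open>\<delta>\<close> is the conjugate of \<open>\<tau>\<close> in disguise.\<close>

lemma g_\<delta>: "g (\<delta> x y) w = g x (\<tau> y w)"
proof -
  have "g (T x y) w = g (T y w) x" for x y w
    using T_alt[of y x w] T_skew[of x y] by (simp add: g_bil)
  from this[of x y w] this[of x "J y" "J w"] show ?thesis
    by (simp add: \<delta>_def \<tau>_def g_bil g_J_left g_sym[of x] algebra_simps)
qed

lemma h_\<delta>: "h (\<delta> x y) w = h x (\<tau> y w)"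
  using g_\<delta>[of x y w] g_\<delta>[of x y "J w"] by (simp add: h_def \<tau>_J)

lemma h_\<delta>': "h w (\<delta> x y) = h (\<tau> y w) x"
  using h_\<delta>[of x y w] cnj_h by metis

end

section \<open>Bianchi and Ricci identities at a point\<close>

text \<open>\<open>K u\<close> stands for the covariant derivative of the torsion along
  \<open>u\<close> at one point. \<open>bianchi\<close> is the first Bianchi identity of a
  connection with torsion whose curvature has zero cyclic sum.\<close>

locale torsion_jet = skew_torsion_form g T
  for g :: "complex ^ 'n::finite \<Rightarrow> complex ^ 'n \<Rightarrow> real" and T +
  fixes K :: "complex ^ 'n \<Rightarrow> complex ^ 'n \<Rightarrow> complex ^ 'n \<Rightarrow> complex ^ 'n"
  assumes K_form: "skew_torsion_form g (K u)"
    and bianchi: "K u x y + K x y u + K y u x + T (T u x) y + T (T x y) u + T (T y u) x = 0"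
begin

sublocale K: skew_torsion_form g "K u" for u
  by (rule K_form)

definition Z :: "complex ^ 'n \<Rightarrow> complex ^ 'n \<Rightarrow> complex ^ 'n \<Rightarrow> complex ^ 'n" where
  "Z u x y = T (T u x) y + T (T x y) u + T (T y u) x"

lemma g_T_T: "g (T (T u x) y) w = g (T u x) (T y w)"
  using T_alt[of y "T u x" w] T_skew[of "T u x" y] g_sym[of "T y w"] by (simp add: g_bil)

lemma g_Z: "g (Z u x y) w = g (T u x) (T y w) + g (T x y) (T u w) + g (T y u) (T x w)"
  by (simp add: Z_def g_bil g_T_T)

text \<open>\<open>Z\<close> is invariant under cyclic shifts and \<open>g (Z u x y) w\<close> is
  totally skew. Hence \<open>3 K + Z\<close> is skew in its last three slots and has zero cyclic sum
  over the first three, which forces it to vanish.\<close>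

lemma K_eq: "3 *\<^sub>R K u x y = - Z u x y"
proof (rule g_eqI)
  fix w
  define k where "k a b c d = 3 * g (K a b c) d + g (Z a b c) d" for a b c d
  have skew: "k a b c d = - k a c b d" "k a b c d = - k a b d c" for a b c d
  proof -
    have T: "g (T q p) v = - g (T p q) v" "g v (T q p) = - g v (T p q)" for p q v
      using T_skew[of q p] by (simp_all add: g_bil)
    have "g (K a c b) d = - g (K a b c) d"
      using K.T_skew[of a c b] by (simp add: g_bil)
    then show "k a b c d = - k a c b d"
      using T(1)[of b a "T c d"] T(1)[of c b "T a d"] T(1)[of a c "T b d"]
      by (simp add: k_def g_Z)
    show "k a b c d = - k a b d c"
      using K.T_alt[of a b c d] T(2)[of "T a b" d c] T(1)[of a c "T b d"] g_sym[of "T a c" "T b d"]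
        T(1)[of a d "T b c"] g_sym[of "T a d" "T b c"]
      unfolding k_def g_Z by linarith
  qed
  have cyc: "k a b c d + k b c a d + k c a b d = 0" for a b c d
  proof -
    have "K a b c + K b c a + K c a b + Z a b c = 0"
      using bianchi[of a b c] by (simp add: Z_def add.assoc)
    then have "K a b c + K b c a + K c a b = - Z a b c"
      by (simp add: eq_neg_iff_add_eq_0)
    then have "g (K a b c) d + g (K b c a) d + g (K c a b) d = - g (Z a b c) d"
      by (metis g_bil(1) g_bil(5))
    moreover have "Z b c a = Z a b c" "Z c a b = Z a b c" by (simp_all add: Z_def)
    ultimately show ?thesis by (simp add: k_def)
  qed
  \<comment> \<open>Up to sign \<open>k\<close> has four values, one for each choice of the first
    argument. Applying \<open>cyc\<close> with each argument in turn in the last slot gives a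
    nonsingular system for them.\<close>
  have "k u x y w - k x u y w + k y u x w = 0"
    using cyc[of u x y w] skew(1)[of x y u w] by linarith
  moreover have "- k u x y w + k x u y w + k w u x y = 0"
    using cyc[of u x w y] skew(2)[of u x w y] skew(1)[of x w u y] skew(2)[of x u w y] by linarith
  moreover have "k u x y w + k y u x w - k w u x y = 0"
    using cyc[of u y w x] skew(2)[of u y w x] skew(1)[of u y x w] skew(1)[of y w u x]
      skew(2)[of y u w x] skew(2)[of w u y x] by linarith
  moreover have "k x u y w - k y u x w + k w u x y = 0"
    using cyc[of x y w u] skew(2)[of x y w u] skew(1)[of x y u w] skew(1)[of y w x u]
      skew(2)[of y x w u] skew(1)[of y x u w] skew(2)[of w x y u] skew(1)[of w x u y] by linarith
  ultimately have "k u x y w = 0" by linarith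
  then show "g (3 *\<^sub>R K u x y) w = g (- Z u x y) w"
    by (simp add: k_def g_bil)
qed

abbreviation N :: "complex ^ 'n \<Rightarrow> complex ^ 'n \<Rightarrow> complex ^ 'n \<Rightarrow> complex ^ 'n" where
  "N u \<equiv> K.\<tau> u"

lemma Z_type: "Z u (J x) (J y) = Z u x y + J (Z u (J x) y) + J (Z u x (J y))"
  using K.T_type[of u x y] K_eq[of u "J x" "J y"] K_eq[of u x y] K_eq[of u "J x" y] K_eq[of u x "J y"]
  by (metis (no_types, lifting) J_minus J_scaleR minus_add_distrib minus_minus scaleR_add_right)

lemma T_T_diff: "T (T u x) y - T (T u (J x)) (J y) =
    2 *\<^sub>R (\<tau> (\<tau> u x) y - \<tau> (\<delta> x u) y + \<delta> (\<delta> u x) y - \<delta> y (\<delta> u x))"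
  by (simp add: T_eq \<tau>_bil \<delta>_bil \<tau>_J \<delta>_J scaleR_2)

lemma T_T_diff': "T (T x y) u - T (T (J x) (J y)) u =
    2 *\<^sub>R (\<tau> (\<tau> x y) u + \<delta> (\<tau> x y) u - \<delta> u (\<tau> x y))"
  by (simp add: T_eq \<tau>_bil \<delta>_bil \<tau>_J \<delta>_J scaleR_2)

text \<open>The terms are grouped by type: linear in \<open>u\<close>, \<open>x\<close>,
  \<open>y\<close>; linear in \<open>u\<close> and conjugate linear in \<open>x\<close>,
  \<open>y\<close>; linear in \<open>x\<close>, \<open>y\<close> and conjugate linear in
  \<open>u\<close>.\<close>

lemma Z_diff: "Z u x y - Z u (J x) (J y) =
    2 *\<^sub>R ((\<tau> (\<tau> x y) u + \<tau> (\<tau> u x) y - \<tau> (\<tau> u y) x)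
      + (\<delta> (\<delta> u x) y - \<delta> (\<delta> u y) x - \<delta> u (\<tau> x y))
      + (\<tau> (\<delta> y u) x - \<tau> (\<delta> x u) y + \<delta> (\<tau> x y) u + \<delta> x (\<delta> u y) - \<delta> y (\<delta> u x)))"
proof -
  have "Z u x y = T (T u x) y + T (T x y) u - T (T u y) x" for x y
    using T_skew[of y u] by (simp add: Z_def T_bil)
  then have "Z u x y - Z u (J x) (J y) = (T (T u x) y - T (T u (J x)) (J y))
      + (T (T x y) u - T (T (J x) (J y)) u) - (T (T u y) x - T (T u (J y)) (J x))"
    by simp
  then show ?thesis
    unfolding T_T_diff T_T_diff' by (simp add: scaleR_2)
qed

text \<open>Replacing \<open>x\<close> by \<open>J x\<close> and applying \<open>J\<close> changes
  the sign of the groups of \<open>Z_diff\<close> that are linear in \<open>x\<close> and fixes the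
  conjugate linear one. By \<open>Z_type\<close> the sum of both versions is zero, so that group
  vanishes.\<close>

lemma \<delta>_\<delta>: "\<delta> (\<delta> u x) y - \<delta> (\<delta> u y) x = \<delta> u (\<tau> x y)"
proof -
  have "(Z u x y - Z u (J x) (J y)) + J (Z u (J x) y - Z u (J (J x)) (J y)) = 0"
    using Z_type[of u x y] K_eq[of u "- x" "J y"] K_eq[of u x "J y"]
    by (simp add: K.T_bil)
  moreover define A B C where "A = \<tau> (\<tau> x y) u + \<tau> (\<tau> u x) y - \<tau> (\<tau> u y) x"
    and B: "B = \<delta> (\<delta> u x) y - \<delta> (\<delta> u y) x - \<delta> u (\<tau> x y)"
    and "C = \<tau> (\<delta> y u) x - \<tau> (\<delta> x u) y + \<delta> (\<tau> x y) u + \<delta> x (\<delta> u y) - \<delta> y (\<delta> u x)"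
  moreover have "J (Z u (J x) y - Z u (J (J x)) (J y)) = 2 *\<^sub>R (- A + B - C)"
    unfolding Z_diff A_def B C_def by (simp add: \<tau>_bil \<delta>_bil \<tau>_J \<delta>_J)
  ultimately have "2 *\<^sub>R (A + B + C) + 2 *\<^sub>R (- A + B - C) = 0"
    by (simp only: Z_diff)
  then have "4 *\<^sub>R B = 0" by (simp add: scaleR_right_distrib scaleR_right_diff_distrib flip: scaleR_add_left)
  then show ?thesis by (simp add: B)
qed

text \<open>By adjointness, pairing \<open>\<delta>_\<delta>\<close> with \<open>w\<close> says that
  \<open>x\<close> acting by \<open>\<tau> x\<close> is a representation of the bracket
  \<open>\<tau>\<close>.\<close>

lemma jacobi: "\<tau> (\<tau> x y) w + \<tau> (\<tau> y w) x + \<tau> (\<tau> w x) y = 0"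
proof (rule h_eqI2)
  fix u
  have "h (\<delta> (\<delta> u x) y) w - h (\<delta> (\<delta> u y) x) w = h (\<delta> u (\<tau> x y)) w"
    by (simp flip: h_bil add: \<delta>_\<delta>)
  then have "h u (\<tau> x (\<tau> y w)) - h u (\<tau> y (\<tau> x w)) - h u (\<tau> (\<tau> x y) w) = 0"
    by (simp add: h_\<delta>)
  moreover have "\<tau> x (\<tau> y w) = - \<tau> (\<tau> y w) x" "\<tau> y (\<tau> x w) = \<tau> (\<tau> w x) y"
    using \<tau>_skew[of x "\<tau> y w"] \<tau>_skew[of y "\<tau> x w"] \<tau>_skew[of x w] by (simp_all add: \<tau>_bil)
  ultimately have "- (h u (\<tau> (\<tau> x y) w) + h u (\<tau> (\<tau> y w) x) + h u (\<tau> (\<tau> w x) y)) = 0"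
    by (simp only: h_bil) (simp add: algebra_simps)
  then show "h u (\<tau> (\<tau> x y) w + \<tau> (\<tau> y w) x + \<tau> (\<tau> w x) y) = h u 0"
    by (simp only: h_bil neg_equal_0_iff_equal)
qed

text \<open>In \<open>Z_diff\<close> the first group vanishes by \<open>jacobi\<close> and the
  second by \<open>\<delta>_\<delta>\<close>; only the third remains.\<close>

lemma N_eq: "3 *\<^sub>R N u x y = - (\<tau> (\<delta> y u) x - \<tau> (\<delta> x u) y + \<delta> (\<tau> x y) u
    + \<delta> x (\<delta> u y) - \<delta> y (\<delta> u x))"
proof -
  have "6 *\<^sub>R N u x y = - (Z u x y - Z u (J x) (J y))"
    using K_eq[of u x y] K_eq[of u "J x" "J y"] by (simp add: K.\<tau>_def scaleR_diff_right)
  also have "\<dots> = - 2 *\<^sub>R (\<tau> (\<delta> y u) x - \<tau> (\<delta> x u) y + \<delta> (\<tau> x y) u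
    + \<delta> x (\<delta> u y) - \<delta> y (\<delta> u x))"
    using jacobi[of x y u] \<delta>_\<delta>[of u x y] \<tau>_skew[of u y] by (simp add: Z_diff \<tau>_bil add_ac)
  finally have "(1/2) *\<^sub>R (6 *\<^sub>R N u x y) = (1/2) *\<^sub>R (- 2 *\<^sub>R (\<tau> (\<delta> y u) x - \<tau> (\<delta> x u) y
    + \<delta> (\<tau> x y) u + \<delta> x (\<delta> u y) - \<delta> y (\<delta> u x)))" by simp
  then show ?thesis by (simp only: scaleR_scaleR) simp
qed

lemma N_add: "N (u + v) x y = N u x y + N v x y"
  and N_scaleR: "N (r *\<^sub>R u) x y = r *\<^sub>R N u x y"
  and N_J: "N (J u) x y = - J (N u x y)"
proof -
  have "3 *\<^sub>R N (u + v) x y = 3 *\<^sub>R (N u x y + N v x y)"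
    unfolding N_eq scaleR_add_right by (simp add: \<tau>_bil \<delta>_bil)
  then show "N (u + v) x y = N u x y + N v x y" by simp
  have "3 *\<^sub>R N (r *\<^sub>R u) x y = r *\<^sub>R (3 *\<^sub>R N u x y)"
    unfolding N_eq by (simp add: \<tau>_bil \<delta>_bil scaleR_right_distrib scaleR_right_diff_distrib)
  then have "3 *\<^sub>R N (r *\<^sub>R u) x y = 3 *\<^sub>R (r *\<^sub>R N u x y)" by (simp add: mult.commute)
  then show "N (r *\<^sub>R u) x y = r *\<^sub>R N u x y" by (metis scaleR_cancel_left zero_neq_numeral)
  have "3 *\<^sub>R N (J u) x y = - J (3 *\<^sub>R N u x y)"
    unfolding N_eq by (simp add: \<tau>_bil \<delta>_bil \<tau>_J \<delta>_J)
  then show "N (J u) x y = - J (N u x y)" by (simp flip: scaleR_minus_right)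
qed

lemma N_bil1: "N (u + v) x y = N u x y + N v x y" "N (u - v) x y = N u x y - N v x y"
  "N (- u) x y = - N u x y" "N 0 x y = 0" "N (r *\<^sub>R u) x y = r *\<^sub>R N u x y"
  using N_add[of u v x y] N_add[of u "- v" x y] N_scaleR[of "-1" u x y] N_scaleR[of "-1" v x y]
    N_scaleR[of 0 u x y] N_scaleR[of r u x y] by simp_all

lemma h_N: "3 * h (N u x y) w = h (\<delta> y u) (\<delta> w x) - h (\<delta> x u) (\<delta> w y) - h (\<tau> x y) (\<tau> u w)
    + h (\<delta> x w) (\<delta> u y) - h (\<delta> y w) (\<delta> u x)"
proof -
  have "3 * h (N u x y) w = h (3 *\<^sub>R N u x y) w" by (simp add: h_bil)
  also have "\<dots> = - (h (\<tau> (\<delta> y u) x) w - h (\<tau> (\<delta> x u) y) w + h (\<delta> (\<tau> x y) u) w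
     + h (\<delta> x (\<delta> u y)) w - h (\<delta> y (\<delta> u x)) w)"
    unfolding N_eq by (simp add: h_bil)
  moreover have "h (\<tau> a x) w = - h a (\<delta> w x)" "h (\<delta> x a) w = - h (\<delta> x w) a" for a x
    using h_\<delta>'[of a w x] h_\<delta>[of x w a] \<tau>_skew[of a x] \<tau>_skew[of a w] by (simp_all add: h_\<delta>' h_\<delta> h_bil)
  ultimately show ?thesis using \<tau>_skew[of w u] by (simp add: h_\<delta>[of "\<tau> x y"] h_bil)
qed

text \<open>With \<open>cnj_h_N\<close> this makes \<open>h (N u x y) w\<close> a Hermitian form on
  the exterior square: \<open>x, y\<close> are the linear pair, \<open>u, w\<close> the conjugate
  linear one.\<close>

lemma h_N_skew: "h (N u x y) w = - h (N w x y) u"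
proof -
  have "3 * h (N u x y) w = 3 * (- h (N w x y) u)"
    unfolding mult_minus_right h_N using \<tau>_skew[of u w] by (simp add: h_bil)
  then show ?thesis by simp
qed

lemma cnj_h_N: "cnj (h (N u x y) w) = h (N x u w) y"
proof -
  have "cnj (3 * h (N u x y) w) = 3 * h (N x u w) y"
    unfolding h_N by (simp add: cnj_h)
  then show ?thesis by simp
qed

text \<open>Hence \<open>N\<close> carries all of \<open>K\<close>, and the derivative of
  \<open>N_eq\<close> can be written in \<open>\<tau>\<close>, \<open>\<delta>\<close> and
  \<open>N\<close>.\<close>

lemma K_\<delta>: "K.\<delta> v x y = N y v x"
proof (rule h_eqI)
  fix w
  show "h (K.\<delta> v x y) w = h (N y v x) w"
    using cnj_h_N[of v y w x] by (simp add: K.h_\<delta> cnj_h)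
qed

end

text \<open>\<open>N2 v u\<close> stands for the second covariant derivative of
  \<open>\<tau>\<close>, taken along \<open>u\<close> and then along \<open>v\<close>.
  \<open>R_J\<close> says that the curvature has type (1,1) in \<open>v, u\<close>.\<close>

locale skl_point = torsion_jet g T K
  for g :: "complex ^ 'n::finite \<Rightarrow> complex ^ 'n \<Rightarrow> real" and T K +
  fixes N2 :: "complex ^ 'n \<Rightarrow> complex ^ 'n \<Rightarrow> complex ^ 'n \<Rightarrow> complex ^ 'n \<Rightarrow> complex ^ 'n"
    and R :: "complex ^ 'n \<Rightarrow> complex ^ 'n \<Rightarrow> complex ^ 'n \<Rightarrow> complex ^ 'n"
  assumes N2_eq: "3 *\<^sub>R N2 v u x y = - (K.\<tau> v (\<delta> y u) x + \<tau> (K.\<delta> v y u) x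
      - K.\<tau> v (\<delta> x u) y - \<tau> (K.\<delta> v x u) y
      + K.\<delta> v (\<tau> x y) u + \<delta> (K.\<tau> v x y) u
      + K.\<delta> v x (\<delta> u y) + \<delta> x (K.\<delta> v u y) - K.\<delta> v y (\<delta> u x) - \<delta> y (K.\<delta> v u x))"
    and jacobi_deriv: "K.\<tau> v (\<tau> x y) w + \<tau> (K.\<tau> v x y) w + K.\<tau> v (\<tau> y w) x + \<tau> (K.\<tau> v y w) x
      + K.\<tau> v (\<tau> w x) y + \<tau> (K.\<tau> v w x) y = 0"
    and ricci: "N2 v u x y - N2 u v x y + K.\<tau> (T v u) x y =
      R v u (\<tau> x y) - \<tau> (R v u x) y - \<tau> x (R v u y)"
    and R_J: "R (J v) (J u) = R v u"
begin

text \<open>The left side removes the terms that are linear in one of \<open>v\<close>,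
  \<open>u\<close> and conjugate linear in the other, and doubles those of equal type in
  both.\<close>

lemma N2_type: "3 *\<^sub>R (N2 v u x y - N2 (J v) (J u) x y) = - 2 *\<^sub>R (N v (\<delta> y u) x - N v (\<delta> x u) y
    + \<delta> (N v x y) u + \<delta> x (N y v u) - \<delta> y (N x v u))"
  unfolding scaleR_diff_right N2_eq K_\<delta>
  by (simp add: \<tau>_bil \<delta>_bil \<tau>_J \<delta>_J N_bil1 N_J K.\<tau>_bil K.\<tau>_J scaleR_2)

text \<open>The difference of \<open>ricci\<close> at \<open>v, u\<close> and at
  \<open>J v, J u\<close>: the curvature cancels by \<open>R_J\<close>, and the two torsion terms
  differ by \<open>2 *\<^sub>R \<tau> v u\<close>.\<close>

lemma N2_skew: "(N2 v u x y - N2 (J v) (J u) x y) - (N2 u v x y - N2 (J u) (J v) x y)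
    + 2 *\<^sub>R N (\<tau> v u) x y = 0"
proof -
  have t: "2 *\<^sub>R N (\<tau> v u) x y = N (T v u) x y - N (T (J v) (J u)) x y"
    unfolding \<tau>_def N_bil1 by simp
  have "(N2 v u x y - N2 u v x y + N (T v u) x y)
      - (N2 (J v) (J u) x y - N2 (J u) (J v) x y + N (T (J v) (J u)) x y) = 0"
    unfolding ricci R_J by simp
  then show ?thesis unfolding t by (simp add: algebra_simps)
qed

text \<open>\<open>F x y k l n\<close> and \<open>G x y k l n\<close> are the two contractions of \<open>\<nabla>\<tau>\<close> with \<open>\<tau>\<close> that are of type
  \<open>(2,0)\<close> in \<open>x, y\<close> and of type \<open>(0,3)\<close> in \<open>k, l, n\<close>.\<close>

definition F where "F x y k l n = h (N (\<tau> k l) x y) n"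
definition G where "G x y k l n = h (N k y (\<delta> x n)) l - h (N k x (\<delta> y n)) l"

lemma h_N2_type: "3 * h (N2 v u x y - N2 (J v) (J u) x y) w =
    2 * (F x y u w v - G x y v w u + G x y v u w)"
proof -
  have 1: "h (\<delta> x (N y v u)) w = - h (N v y (\<delta> x w)) u" for x y
  proof -
    have "h (\<delta> x (N y v u)) w = - h (\<delta> x w) (N y v u)"
      using \<tau>_skew[of w "N y v u"] by (simp add: h_\<delta> h_bil)
    then show ?thesis using cnj_h_N[of y v u "\<delta> x w"] by (simp add: cnj_h)
  qed
  have "3 * h (N2 v u x y - N2 (J v) (J u) x y) w = h (3 *\<^sub>R (N2 v u x y - N2 (J v) (J u) x y)) w"
    by (simp add: h_bil)
  also have "\<dots> = - 2 * (h (N v (\<delta> y u) x) w - h (N v (\<delta> x u) y) w + h (N v x y) (\<tau> u w)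
    - h (N v y (\<delta> x w)) u + h (N v x (\<delta> y w)) u)"
    unfolding N2_type by (simp add: h_bil 1 h_\<delta>[of "N v x y" u])
  finally show ?thesis
    using K.\<tau>_skew[of v "\<delta> y u" x] K.\<tau>_skew[of v "\<delta> x u" y] h_N_skew[of v x y "\<tau> u w"]
    by (simp add: F_def G_def h_bil algebra_simps)
qed

text \<open>Write cyc for the cyclic sum over \<open>k, l, n\<close>. Up to skewness,
  \<open>c\<close> says 2 F + G + cyc F + cyc G = 0, and the derivative of the Jacobi identity says
  cyc G = -2 cyc F. So 2 F + G = cyc F; summing this cyclically gives 0 = 3 cyc F.\<close>

lemma F_cyclic: "F x y k l n + F x y l n k + F x y n k l = 0"
  and F_G: "2 * F x y k l n + G x y k l n = 0"
proof -
  have c: "F x y u w v - G x y v w u + G x y v u w - (F x y v w u - G x y u w v + G x y u v w)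
      + 3 * F x y v u w = 0" for u v w
  proof -
    have "h ((N2 v u x y - N2 (J v) (J u) x y) - (N2 u v x y - N2 (J u) (J v) x y)
        + 2 *\<^sub>R N (\<tau> v u) x y) w = 0"
      unfolding N2_skew by (simp add: h_bil)
    then have "h (N2 v u x y) w - h (N2 (J v) (J u) x y) w - (h (N2 u v x y) w - h (N2 (J u) (J v) x y) w)
        + 2 * F x y v u w = 0"
      by (simp add: h_bil F_def)
    then have "3 * h (N2 v u x y - N2 (J v) (J u) x y) w - 3 * h (N2 u v x y - N2 (J u) (J v) x y) w
        + 6 * F x y v u w = 0"
      unfolding h_bil(3) by algebra
    then show ?thesis unfolding h_N2_type by algebra
  qed
  have skew: "F x y l k n = - F x y k l n" "G x y l k n = - G x y k l n" for x y k l n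
    using \<tau>_skew[of l k] h_N_skew[of l y "\<delta> x n" k] h_N_skew[of l x "\<delta> y n" k]
    by (simp_all add: F_def G_def N_bil1 h_bil)
  have j: "F x y k l n + F x y l n k + F x y n k l
      = h (N k x (\<delta> y n)) l + h (N l x (\<delta> y k)) n + h (N n x (\<delta> y l)) k" for x y
  proof -
    have 1: "h y (N x (\<tau> k l) n) = F x y k l n" for k l n
      using cnj_h_N[of x "\<tau> k l" n y] by (simp add: F_def cnj_h)
    have 2: "h y (\<tau> (N x k l) n) = - h (N k x (\<delta> y n)) l" for k l n
    proof -
      have "h y (\<tau> (N x k l) n) = - h (\<delta> y n) (N x k l)"
        using \<tau>_skew[of "N x k l" n] by (simp add: h_\<delta> h_bil)
      then show ?thesis using cnj_h_N[of x k l "\<delta> y n"] by (simp add: cnj_h)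
    qed
    have "h y (K.\<tau> x (\<tau> k l) n + \<tau> (K.\<tau> x k l) n + K.\<tau> x (\<tau> l n) k + \<tau> (K.\<tau> x l n) k
      + K.\<tau> x (\<tau> n k) l + \<tau> (K.\<tau> x n k) l) = 0"
      unfolding jacobi_deriv by (simp add: h_bil)
    then show ?thesis unfolding h_bil 1 2 by algebra
  qed
  \<comment> \<open>\<open>F\<close> is skew in \<open>x, y\<close>, and antisymmetrising the right
    side of \<open>j\<close> in \<open>x, y\<close> produces \<open>G\<close>.\<close>
  have jG: "G x y k l n + G x y l n k + G x y n k l = - 2 * (F x y k l n + F x y l n k + F x y n k l)"
  proof -
    have "F y x k l n = - F x y k l n" for k l n
      using K.\<tau>_skew[of "\<tau> k l" y x] by (simp add: F_def h_bil)
    from this[of k l n] this[of l n k] this[of n k l] show ?thesis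
      using j[of x y] j[of y x] unfolding G_def by algebra
  qed
  have "3 * (F x y k l n + F x y l n k + F x y n k l) = 0"
    using c[of n k l] c[of k l n] c[of l n k] jG skew[of x y k l n] skew[of x y l n k] skew[of x y n k l]
    by algebra
  then show *: "F x y k l n + F x y l n k + F x y n k l = 0"
    by (simp only: mult_eq_0_iff) simp
  show "2 * F x y k l n + G x y k l n = 0"
    using * jG c[where u = l and v = k and w = n] skew[of x y l k n] skew[of x y k n l]
    by algebra
qed

end

section \<open>Unitary frames\<close>

context hermitian_space
begin

lemma h_normalize:
  assumes "u \<noteq> 0"
  shows "h ((1 / sqrt (g u u)) *\<^sub>R u) ((1 / sqrt (g u u)) *\<^sub>R u) = 1"
proof -
  have "h ((1 / sqrt (g u u)) *\<^sub>R u) ((1 / sqrt (g u u)) *\<^sub>R u)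
      = of_real ((1 / sqrt (g u u)) * ((1 / sqrt (g u u)) * g u u))"
    unfolding h_bil h_self[of u] by (simp only: of_real_mult)
  also have "(1 / sqrt (g u u)) * ((1 / sqrt (g u u)) * g u u) = 1"
    using g_pos[OF assms] by (simp add: field_simps flip: power2_eq_square)
  finally show ?thesis by simp
qed

definition parseval :: "('i::finite \<Rightarrow> complex ^ 'n) \<Rightarrow> bool" where
  "parseval e \<longleftrightarrow> (\<forall>v. (\<Sum>i\<in>UNIV. h v (e i) *s e i) = v)"

lemma parseval_h: "parseval e \<Longrightarrow> h u v = (\<Sum>i\<in>UNIV. h u (e i) * h (e i) v)"
  unfolding parseval_def by (metis (no_types, lifting) h_sum(1) h_smult(1) sum.cong)

text \<open>Among the unitary sets containing \<open>f\<close>, take one of maximal cardinality. If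
  some vector were not recovered from its coefficients, its normalised remainder would enlarge the
  set.\<close>

lemma exists_unitary_set:
  assumes "h f f = 1"
  obtains S where "finite S" "f \<in> S" "card S = CARD('n)"
    "\<And>a b. a \<in> S \<Longrightarrow> b \<in> S \<Longrightarrow> h a b = (if a = b then 1 else 0)"
    "\<And>v. (\<Sum>a\<in>S. h v a *s a) = v"
proof -
  define on where "on S \<longleftrightarrow> finite S \<and> f \<in> S \<and> (\<forall>a\<in>S. \<forall>b\<in>S. h a b = (if a = b then 1 else 0))" for S
  have coeff: "h (\<Sum>a\<in>S. c a *s a) b = c b" if "on S" "b \<in> S" for S b c
  proof -
    have "h (\<Sum>a\<in>S. c a *s a) b = (\<Sum>a\<in>S. if a = b then c a else 0)"
      unfolding h_sum h_smult by (rule sum.cong) (use that in \<open>auto simp: on_def\<close>)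
    then show ?thesis using that by (simp add: on_def)
  qed
  have ind: "vec.independent S" if "on S" for S
  proof
    assume "vec.dependent S"
    moreover have "finite S" using that by (simp add: on_def)
    ultimately obtain u v where "v \<in> S" "u v \<noteq> 0" "(\<Sum>v\<in>S. u v *s v) = 0"
      using vec.dependent_finite[of S] by auto
    then show False using coeff[OF that, of v u] by (simp add: h_bil)
  qed
  have "card S < Suc CARD('n)" if "on S" for S
    using vec.independent_card_le_dim[OF subset_UNIV ind[OF that]] by (simp add: vec.dim_UNIV card_cart_basis)
  moreover have "on {f}" using assms by (simp add: on_def)
  ultimately obtain S where S: "on S" and max: "\<And>S'. on S' \<Longrightarrow> card S' \<le> card S"
    using ex_has_greatest_nat[of on "{f}" card "Suc CARD('n)"] by blast
  have span: "(\<Sum>a\<in>S. h v a *s a) = v" for v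
  proof (rule ccontr)
    define r where "r = v - (\<Sum>a\<in>S. h v a *s a)"
    assume "(\<Sum>a\<in>S. h v a *s a) \<noteq> v"
    then have "r \<noteq> 0" by (auto simp: r_def)
    define q where "q = (1 / sqrt (g r r)) *\<^sub>R r"
    have "h r b = 0" if "b \<in> S" for b
      using coeff[OF S that] by (simp add: r_def h_bil)
    then have 1: "h q b = 0" "h b q = 0" if "b \<in> S" for b
      using that cnj_h[of q b] by (auto simp: q_def h_bil simp flip: cnj_h[of r b])
    have qq: "h q q = 1" unfolding q_def by (rule h_normalize) fact
    have "q \<notin> S" using 1 qq by force
    moreover have "on (insert q S)" using S 1 qq by (auto simp: on_def)
    ultimately show False using max[of "insert q S"] S by (simp add: on_def)
  qed
  have "vec.span S = UNIV"
  proof -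
    have "v \<in> vec.span S" for v
      by (subst span[symmetric]) (intro vec.span_sum vec.span_scale vec.span_base)
    then show ?thesis by auto
  qed
  then have "card S = CARD('n)"
    using vec.basis_card_eq_dim[of S UNIV] ind[OF S] by (simp add: vec.dim_UNIV card_cart_basis)
  then show thesis using that[of S] S span by (auto simp: on_def)
qed

lemma exists_unit: obtains f where "h f f = 1"
proof -
  define u :: "complex ^ 'n" where "u = (\<chi> i. 1)"
  have "u \<noteq> 0" by (simp add: u_def vec_eq_iff)
  from h_normalize[OF this] show thesis by (rule that)
qed

lemma exists_unitary_frame:
  obtains e :: "'n \<Rightarrow> complex ^ 'n" where "parseval e" "\<And>i j. h (e i) (e j) = (if i = j then 1 else 0)"
proof -
  obtain f where "h f f = 1" by (rule exists_unit)
  then obtain S where S: "finite S" "card S = CARD('n)"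
    "\<And>a b. a \<in> S \<Longrightarrow> b \<in> S \<Longrightarrow> h a b = (if a = b then 1 else 0)" "\<And>v. (\<Sum>a\<in>S. h v a *s a) = v"
    by (rule exists_unitary_set) auto
  then obtain e :: "'n \<Rightarrow> complex ^ 'n" where e: "bij_betw e UNIV S"
    using finite_same_card_bij[of "UNIV :: 'n set" S] by auto
  have "(\<Sum>i\<in>UNIV. h v (e i) *s e i) = v" for v
    using sum.reindex_bij_betw[OF e, of "\<lambda>a. h v a *s a"] S(4) by simp
  moreover have "h (e i) (e j) = (if i = j then 1 else 0)" for i j
    using S(3)[of "e i" "e j"] e by (auto simp: bij_betw_def inj_eq)
  ultimately show thesis using that[of e] by (simp add: parseval_def)
qed

text \<open>Frames indexed by \<open>3\<close> are padded by zero vectors in dimensions one and two, so that these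
  cases need no separate treatment.\<close>

lemma exists_parseval_3:
  assumes "h f f = 1" "CARD('n) \<le> 3"
  obtains e :: "3 \<Rightarrow> complex ^ 'n" where "parseval e" "e 3 = f" "\<And>i j. i \<noteq> j \<Longrightarrow> h (e i) (e j) = 0"
proof -
  obtain S where S: "finite S" "f \<in> S" "card S = CARD('n)"
    "\<And>a b. a \<in> S \<Longrightarrow> b \<in> S \<Longrightarrow> h a b = (if a = b then 1 else 0)" "\<And>v. (\<Sum>a\<in>S. h v a *s a) = v"
    using assms(1) by (rule exists_unitary_set) auto
  have "card (S - {f}) \<le> card {1, 2::3}" using S assms by simp
  then obtain j where j: "j ` (S - {f}) \<subseteq> {1, 2::3}" "inj_on j (S - {f})"
    using card_le_inj[of "S - {f}" "{1, 2::3}"] S(1) by auto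
  define i where "i = j(f := 3)"
  have inj: "inj_on i S"
  proof -
    have "3 \<notin> j ` (S - {f})" using j(1) by auto
    then show ?thesis using j(2) unfolding i_def inj_on_def by (auto simp: image_iff)
  qed
  define e where "e k = (if k \<in> i ` S then inv_into S i k else 0)" for k
  have ei: "e (i a) = a" if "a \<in> S" for a using that inj by (simp add: e_def)
  have "(\<Sum>k\<in>UNIV. h v (e k) *s e k) = v" for v
  proof -
    have "(\<Sum>k\<in>UNIV. h v (e k) *s e k) = (\<Sum>k\<in>i ` S. h v (e k) *s e k)"
      by (rule sum.mono_neutral_right) (auto simp: e_def)
    also have "\<dots> = (\<Sum>a\<in>S. h v a *s a)"
      using sum.reindex[OF inj, of "\<lambda>k. h v (e k) *s e k"] ei by (simp cong: sum.cong)
    finally show ?thesis using S by simp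
  qed
  moreover have "e 3 = f" using ei[OF S(2)] by (simp add: i_def)
  moreover have "h (e k) (e l) = 0" if "k \<noteq> l" for k l
  proof (cases "k \<in> i ` S \<and> l \<in> i ` S")
    case True
    then obtain a b where "a \<in> S" "b \<in> S" "k = i a" "l = i b" by auto
    then show ?thesis using that S(4)[of a b] ei by auto
  qed (auto simp: e_def h_bil)
  ultimately show thesis using that[of e] by (simp add: parseval_def)
qed

section \<open>Complex linear maps and their traces\<close>

definition clinear :: "(complex ^ 'n \<Rightarrow> complex ^ 'n) \<Rightarrow> bool" where
  "clinear A \<longleftrightarrow> (\<forall>x y. A (x + y) = A x + A y) \<and> (\<forall>c x. A (c *s x) = c *s A x)"

lemma clinear_sum: "clinear A \<Longrightarrow> A (sum f S) = (\<Sum>a\<in>S. A (f a))"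
proof -
  assume A: "clinear A"
  then have "A (0 *s 0) = 0 *s A 0" unfolding clinear_def by blast
  then have "A 0 = 0" by simp
  with A show ?thesis by (induction S rule: infinite_finite_induct) (auto simp: clinear_def)
qed

lemma clinearI:
  assumes "\<And>x y. A (x + y) = A x + A y" "\<And>r x. A (r *\<^sub>R x) = r *\<^sub>R A x" "\<And>x. A (J x) = J (A x)"
  shows "clinear A"
  using assms by (simp add: clinear_def complex_smult_eq)

definition tr :: "('i::finite \<Rightarrow> complex ^ 'n) \<Rightarrow> (complex ^ 'n \<Rightarrow> complex ^ 'n) \<Rightarrow> complex" where
  "tr e A = (\<Sum>i\<in>UNIV. h (A (e i)) (e i))"

lemma clinear_expand:
  assumes "parseval e" "clinear A"
  shows "h (A u) v = (\<Sum>i\<in>UNIV. h u (e i) * h (A (e i)) v)"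
proof -
  have "A u = A (\<Sum>i\<in>UNIV. h u (e i) *s e i)" using assms(1) by (simp add: parseval_def)
  also have "\<dots> = (\<Sum>i\<in>UNIV. h u (e i) *s A (e i))"
    using assms(2) by (simp add: clinear_sum) (simp add: clinear_def)
  finally show ?thesis by (simp add: h_sum h_smult)
qed

lemma tr_comm:
  assumes "parseval e" "clinear A" "clinear B"
  shows "tr e (\<lambda>x. A (B x)) = tr e (\<lambda>x. B (A x))"
  unfolding tr_def clinear_expand[OF assms(1,2), of "B _"] clinear_expand[OF assms(1,3), of "A _"]
  by (subst sum.swap) (simp add: mult.commute)

text \<open>The index types of the two families may differ, so a trace over a padded frame can be
  compared with one over a unitary frame.\<close>

lemma tr_frame:
  assumes "parseval e" "parseval e'" "clinear A"
  shows "tr e A = tr e' A"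
proof -
  have "tr e A = (\<Sum>i\<in>UNIV. \<Sum>j\<in>UNIV. h (e i) (e' j) * h (A (e' j)) (e i))"
    unfolding tr_def by (rule sum.cong[OF refl]) (rule clinear_expand[OF assms(2,3)])
  also have "\<dots> = (\<Sum>j\<in>UNIV. \<Sum>i\<in>UNIV. h (A (e' j)) (e i) * h (e i) (e' j))"
    by (subst sum.swap) (simp add: mult.commute)
  finally show ?thesis unfolding tr_def by (simp flip: parseval_h[OF assms(1)])
qed

end

section \<open>The torsion is parallel where it does not vanish\<close>

lemma complex_eq_neg_self: "x = - x \<Longrightarrow> x = (0::complex)"
  by (metis add.right_inverse mult_2 mult_eq_0_iff zero_neq_numeral)

context skl_point
begin

lemma clinear_\<tau>: "clinear (\<tau> x)"
  by (rule clinearI) (simp_all add: \<tau>_bil \<tau>_J)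

lemma clinear_\<tau>': "clinear (\<lambda>x. \<tau> x y)"
  by (rule clinearI) (simp_all add: \<tau>_bil \<tau>_J)

lemma clinear_N: "clinear (N u x)"
  by (rule clinearI) (simp_all add: K.\<tau>_bil K.\<tau>_J)

section \<open>Components of the torsion and of its derivative in a frame\<close>

context
  fixes e :: "3 \<Rightarrow> complex ^ 'n"
  assumes e: "parseval e"
begin

definition t :: "3 \<Rightarrow> 3 \<Rightarrow> 3 \<Rightarrow> complex" where
  "t i j k = h (\<tau> (e i) (e j)) (e k)"

definition P :: "3 \<Rightarrow> 3 \<Rightarrow> 3 \<Rightarrow> 3 \<Rightarrow> complex" where
  "P i j k l = h (N (e k) (e i) (e j)) (e l)"

lemma t_skew: "t j i k = - t i j k"
  using \<tau>_skew[of "e j" "e i"] by (simp add: t_def h_bil)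

lemma P_skew: "P j i k l = - P i j k l" "P i j l k = - P i j k l"
  using K.\<tau>_skew[of "e k" "e j" "e i"] h_N_skew[of "e l" "e i" "e j" "e k"] by (simp_all add: P_def h_bil)

lemma cnj_P: "cnj (P i j k l) = P k l i j"
  by (simp add: P_def cnj_h_N)

lemma t_canonical: "t 3 2 k = - t 2 3 k" "t 1 3 k = - t 3 1 k" "t 2 1 k = - t 1 2 k" "t i i k = 0"
  by (rule t_skew complex_eq_neg_self)+

lemma P_canonical: "P 3 2 k l = - P 2 3 k l" "P 1 3 k l = - P 3 1 k l" "P 2 1 k l = - P 1 2 k l" "P i i k l = 0"
  "P i j 3 2 = - P i j 2 3" "P i j 1 3 = - P i j 3 1" "P i j 2 1 = - P i j 1 2" "P i j k k = 0"
  by (rule P_skew complex_eq_neg_self)+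

lemma h_e_\<tau>: "h (e k) (\<tau> (e i) (e j)) = cnj (t i j k)"
  by (simp add: t_def cnj_h)

lemma h_\<delta>_e: "h (\<delta> (e j) (e l)) (e m) = cnj (t l m j)" "h (e m) (\<delta> (e j) (e l)) = t l m j"
  by (simp_all add: h_\<delta> h_\<delta>' h_e_\<tau> t_def)

lemma h_expand: "h (\<delta> a b) (\<delta> c d) = (\<Sum>m\<in>UNIV. h (\<delta> a b) (e m) * h (e m) (\<delta> c d))"
  "h (\<tau> a b) (\<tau> c d) = (\<Sum>m\<in>UNIV. h (\<tau> a b) (e m) * h (e m) (\<tau> c d))"
  "h (N u x y) (\<tau> c d) = (\<Sum>m\<in>UNIV. h (N u x y) (e m) * h (e m) (\<tau> c d))"
  "h (N u x (\<delta> c d)) w = (\<Sum>m\<in>UNIV. h (\<delta> c d) (e m) * h (N u x (e m)) w)"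
  by (rule parseval_h[OF e] clinear_expand[OF e clinear_N])+

lemma P_eq: "3 * P i j k l = (\<Sum>m\<in>UNIV. cnj (t k m j) * t i m l - cnj (t k m i) * t j m l
    - t i j m * cnj (t k l m) + cnj (t l m i) * t j m k - cnj (t l m j) * t i m k)"
  unfolding P_def h_N h_expand
  by (simp add: h_\<delta>_e h_e_\<tau> t_def[symmetric] sum.distrib sum_subtractf)

lemma F_e: "F (e i) (e j) (e k) (e l) (e n) = (\<Sum>m\<in>UNIV. cnj (t k l m) * P i j m n)"
proof -
  \<comment> \<open>\<open>N\<close> is conjugate linear in its direction; moving
    \<open>\<tau> (e k) (e l)\<close> from there into the second slot of \<open>h\<close> makes
    \<open>parseval_h\<close> applicable.\<close>
  have "F (e i) (e j) (e k) (e l) (e n) = - h (N (e n) (e i) (e j)) (\<tau> (e k) (e l))"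
    unfolding F_def by (rule h_N_skew)
  also have "\<dots> = (\<Sum>m\<in>UNIV. cnj (t k l m) * - P i j n m)"
    unfolding h_expand
    by (simp add: P_def h_e_\<tau> mult.commute flip: sum_negf)
  finally show ?thesis by (simp only: P_skew(2)[symmetric])
qed

lemma G_e: "G (e i) (e j) (e k) (e l) (e n) =
    (\<Sum>m\<in>UNIV. cnj (t n m i) * P j m k l - cnj (t n m j) * P i m k l)"
  unfolding G_def h_expand
  by (simp add: h_\<delta>_e P_def sum_subtractf)

lemma F_cyclic_e: "(\<Sum>m\<in>UNIV. cnj (t k l m) * P i j m n + cnj (t l n m) * P i j m k + cnj (t n k m) * P i j m l) = 0"
  using F_cyclic[of "e i" "e j" "e k" "e l" "e n"] unfolding F_e by (simp add: sum.distrib)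

lemma F_G_e: "(\<Sum>m\<in>UNIV. 2 * (cnj (t k l m) * P i j m n) + cnj (t n m i) * P j m k l - cnj (t n m j) * P i m k l) = 0"
  using F_G[of "e i" "e j" "e k" "e l" "e n"] unfolding F_e G_e
  by (simp add: sum.distrib sum_subtractf sum_distrib_left add_diff_eq)

lemma \<tau>_eq_0:
  assumes t: "\<And>i j k. t i j k = 0"
  shows "\<tau> x y = 0"
proof (rule h_eqI)
  fix w
  have "h (\<tau> (e i) (e j)) w = 0" for i j
    using parseval_h[OF e, of "\<tau> (e i) (e j)" w] t by (simp add: t_def)
  then have "h (\<tau> (e i) y) w = 0" for i
    using clinear_expand[OF e clinear_\<tau>, of "e i" y w] by simp
  then show "h (\<tau> x y) w = h 0 w"
    using clinear_expand[OF e clinear_\<tau>', of x y w] by (simp add: h_bil)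
qed

lemma clinear_N': "clinear (\<lambda>x. N u x y)"
  by (rule clinearI) (simp_all add: K.\<tau>_bil K.\<tau>_J)

lemma N_eq_0:
  assumes P: "\<And>i j k l. P i j k l = 0"
  shows "N u x y = 0"
proof (rule h_eqI)
  fix w
  have 1: "h (N (e k) x y) w = 0" for k w
  proof -
    have "h (N (e k) (e i) (e j)) w = 0" for i j
      using parseval_h[OF e, of "N (e k) (e i) (e j)" w] P by (simp add: P_def)
    then have "h (N (e k) (e i) y) w = 0" for i
      using clinear_expand[OF e clinear_N, of "e k" "e i" y w] by simp
    then show ?thesis
      using clinear_expand[OF e clinear_N', of "e k" x y w] by simp
  qed
  have "h (N u x y) (e k) = 0" for k
    using h_N_skew[of u x y "e k"] 1 by simp
  then show "h (N u x y) w = h 0 w"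
    using parseval_h[OF e, of "N u x y" w] by (simp add: h_bil)
qed

text \<open>If the Lee form vanishes, the matrix \<open>a\<close> with rows \<open>t 2 3\<close>, \<open>t 3 1\<close>, \<open>t 1 2\<close> is symmetric. With
  \<open>b\<close> the corresponding matrix of \<open>P\<close>, the trace of \<open>b\<close> is a third of \<open>|a|\<^sup>2\<close>, while a contraction
  of \<open>2 F + G = 0\<close> with \<open>a\<close> says that \<open>tr b |a|\<^sup>2 = 0\<close>.\<close>

lemma lee_form_zero:
  assumes "\<And>i. (\<Sum>m\<in>UNIV. t i m m) = 0"
  shows "t i j k = 0"
proof -
  have sym: "t 1 2 2 = t 3 1 3" "t 1 2 1 = t 2 3 3" "t 3 1 1 = t 2 3 2"
    using assms[of 1] assms[of 2] assms[of 3] by (simp_all add: sum_3 t_canonical)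
  \<comment> \<open>The contraction of \<open>F_G_e\<close> over \<open>n = j\<close>.\<close>
  have E: "(\<Sum>j\<in>UNIV. \<Sum>m\<in>UNIV. 2 * (cnj (t k l m) * P i j m j) + cnj (t j m i) * P j m k l
      - cnj (t j m j) * P i m k l) = 0" for i k l
    by (rule sum.neutral) (use F_G_e in auto)
  define s where "s = (\<Sum>k\<in>UNIV. t 2 3 k * cnj (t 2 3 k) + t 3 1 k * cnj (t 3 1 k) + t 1 2 k * cnj (t 1 2 k))"
  have "3 * (P 2 3 2 3 + P 3 1 3 1 + P 1 2 1 2) = 3 * P 2 3 2 3 + 3 * P 3 1 3 1 + 3 * P 1 2 1 2"
    by simp
  also have "\<dots> = s"
    unfolding P_eq s_def by (simp add: sum_3 t_canonical sym algebra_simps)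
  finally have tr: "3 * (P 2 3 2 3 + P 3 1 3 1 + P 1 2 1 2) = s" .
  have "0 = (\<Sum>i\<in>UNIV. t 2 3 i * (\<Sum>j\<in>UNIV. \<Sum>m\<in>UNIV. 2 * (cnj (t 2 3 m) * P i j m j) + cnj (t j m i) * P j m 2 3
      - cnj (t j m j) * P i m 2 3) + t 3 1 i * (\<Sum>j\<in>UNIV. \<Sum>m\<in>UNIV. 2 * (cnj (t 3 1 m) * P i j m j) + cnj (t j m i) * P j m 3 1
      - cnj (t j m j) * P i m 3 1) + t 1 2 i * (\<Sum>j\<in>UNIV. \<Sum>m\<in>UNIV. 2 * (cnj (t 1 2 m) * P i j m j) + cnj (t j m i) * P j m 1 2
      - cnj (t j m j) * P i m 1 2))"
    unfolding E by simp
  also have "\<dots> = 2 * (P 2 3 2 3 + P 3 1 3 1 + P 1 2 1 2) * s"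
    unfolding s_def by (simp add: sum_3 t_canonical P_canonical sym algebra_simps)
  finally have "2 * (3 * (P 2 3 2 3 + P 3 1 3 1 + P 1 2 1 2)) * s = 0" by algebra
  then have "s = 0" unfolding tr by simp
  moreover have "s = of_real (\<Sum>k\<in>UNIV. (cmod (t 2 3 k))\<^sup>2 + (cmod (t 3 1 k))\<^sup>2 + (cmod (t 1 2 k))\<^sup>2)"
    unfolding s_def of_real_sum of_real_add complex_norm_square ..
  ultimately have "(\<Sum>k\<in>UNIV. (cmod (t 2 3 k))\<^sup>2 + (cmod (t 3 1 k))\<^sup>2 + (cmod (t 1 2 k))\<^sup>2) = 0"
    by (simp only: of_real_eq_0_iff)
  then have "(cmod (t 2 3 k))\<^sup>2 + (cmod (t 3 1 k))\<^sup>2 + (cmod (t 1 2 k))\<^sup>2 = 0" for k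
    by (subst (asm) sum_nonneg_eq_0_iff) auto
  then have z: "t 2 3 k = 0" "t 3 1 k = 0" "t 1 2 k = 0" for k
    by (smt (verit) zero_le_power2 norm_eq_zero power2_eq_iff_nonneg zero_eq_power2)+
  have "\<forall>i j. t i j k = 0" unfolding forall_3 using z t_canonical by simp
  then show ?thesis by blast
qed

text \<open>A frame adapted to a nonzero Lee form: \<open>e 3\<close> is dual to it.\<close>

context
  assumes lee: "t 2 1 1 + t 2 3 3 = 0" "t 1 2 2 + t 1 3 3 = 0" "t 3 1 1 + t 3 2 2 \<noteq> 0"
    and derived: "t i j 3 = 0"
begin

text \<open>By \<open>derived\<close> the traces in \<open>lee\<close> lose their third component,
  which leaves nothing of the bracket of \<open>e 1\<close> and \<open>e 2\<close>: the kernel of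
  the Lee form is abelian.\<close>

lemma t_adapted: "t 1 2 k = 0" "t 2 3 k = - t 3 2 k" "t i j 3 = 0"
proof -
  have "t 1 2 1 = 0" "t 1 2 2 = 0" using lee derived t_skew[of 2 1] by simp_all
  then have "\<forall>k. t 1 2 k = 0" unfolding forall_3 using derived by simp
  then show "t 1 2 k = 0" by simp
  show "t 2 3 k = - t 3 2 k" by (rule t_skew)
  show "t i j 3 = 0" by (rule derived)
qed

lemmas t_adapted_all = t_adapted t_canonical(2-)

lemma P_12: "P i j 1 2 = 0" "P 1 2 i j = 0"
proof -
  have 1: "P i j 1 2 = 0" for i j
  proof -
    \<comment> \<open>For \<open>(k, l, n) = (1, 2, 3)\<close> the cyclic identity collapses to a
      single entry of \<open>P\<close> times the conjugate trace of \<open>m\<close>.\<close>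
    have "cnj (t 3 1 1 + t 3 2 2) * P i j 1 2 = 0"
      using F_cyclic_e[of 1 2 i j 3]
      by (simp add: sum_3 t_adapted_all P_canonical algebra_simps)
    then show ?thesis using lee(3) by (simp only: mult_eq_0_iff complex_cnj_zero_iff) simp
  qed
  then show "P i j 1 2 = 0" .
  show "P 1 2 i j = 0" using 1[of i j] cnj_P[of i j 1 2] by simp
qed

text \<open>This is \<open>P 1 2 1 2 = 0\<close> read through \<open>P_eq\<close>. A scalar
  \<open>m\<close> with entry s would give 2 |s|^2 = 0, against its nonzero trace.\<close>

lemma m_nonscalar: "t 3 1 2 * cnj (t 3 1 2) + t 3 2 1 * cnj (t 3 2 1) = t 3 1 1 * cnj (t 3 2 2) + t 3 2 2 * cnj (t 3 1 1)"
  using P_eq[of 1 2 1 2] P_12(1)[of 1 2] by (simp add: sum_3 t_adapted_all algebra_simps)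

lemma P_traceless: "P 2 3 2 3 = - P 3 1 3 1"
proof -
  have "3 * (P 2 3 2 3 + P 3 1 3 1) = 3 * P 2 3 2 3 + 3 * P 3 1 3 1" by simp
  also have "\<dots> = 0" unfolding P_eq by (simp add: sum_3 t_adapted_all algebra_simps)
  finally show ?thesis by (simp only: mult_eq_0_iff eq_neg_iff_add_eq_0) simp
qed

text \<open>With \<open>m i k = t 3 i k\<close> and \<open>n i l = P i 3 l 3\<close>, a traceless Hermitian matrix, \<open>2 F + G = 0\<close> reads
  \<open>2 n m\<^sup>* + m\<^sup>* n = 0\<close>. As \<open>n\<^sup>2\<close> is a multiple of the identity, multiplying by \<open>n\<close> and taking the
  trace gives \<open>n\<^sup>2 tr m\<^sup>* = 0\<close>.\<close>

lemma P_eq_0: "P i j k l = 0"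
proof -
  define n where "n = (\<lambda>i l. P i 3 l 3)"
  have tr: "n 2 2 = - n 1 1" using P_traceless by (simp add: n_def P_canonical)
  have c: "cnj (n i l) = n l i" for i l by (simp add: n_def cnj_P)
  have E: "2 * (n i 1 * cnj (t 3 l 1) + n i 2 * cnj (t 3 l 2)) + (cnj (t 3 1 i) * n 1 l + cnj (t 3 2 i) * n 2 l) = 0"
    for i l
    using F_G_e[of 3 l i 3 3] P_skew(1)[of 3 1 3 l] P_skew(1)[of 3 2 3 l] P_skew(2)[of 1 3 3 l] P_skew(2)[of 2 3 3 l]
    by (simp add: sum_3 n_def derived P_canonical(4,8) algebra_simps)
  define v where "v = n 1 1 * n 1 1 + n 1 2 * n 2 1"
  have "3 * (v * cnj (t 3 1 1 + t 3 2 2)) = (\<Sum>i\<in>{1,2}. \<Sum>l\<in>{1,2}. n l i *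
      (2 * (n i 1 * cnj (t 3 l 1) + n i 2 * cnj (t 3 l 2)) + (cnj (t 3 1 i) * n 1 l + cnj (t 3 2 i) * n 2 l)))"
    by (simp add: v_def tr algebra_simps)
  then have "3 * (v * cnj (t 3 1 1 + t 3 2 2)) = 0" unfolding E by simp
  then have "v = 0" using lee(3) by (simp only: mult_eq_0_iff complex_cnj_zero_iff) simp
  moreover have "v = of_real ((cmod (n 1 1))\<^sup>2 + (cmod (n 1 2))\<^sup>2)"
    unfolding of_real_add complex_norm_square by (simp add: v_def c)
  ultimately have "(cmod (n 1 1))\<^sup>2 + (cmod (n 1 2))\<^sup>2 = 0" by (simp only: of_real_eq_0_iff)
  then have "n 1 1 = 0" "n 1 2 = 0" by (simp_all add: add_nonneg_eq_0_iff)
  with tr c[of 1 2] have n: "n 1 1 = 0" "n 1 2 = 0" "n 2 1 = 0" "n 2 2 = 0" by simp_all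
  then have "\<forall>i j k l. P i j k l = 0"
    unfolding forall_3 by (simp add: n_def P_canonical P_12)
  then show ?thesis by simp
qed

text \<open>On planes containing \<open>e 3\<close>, \<open>P_eq\<close> computes entries of the
  commutator of \<open>m\<close> with its adjoint.\<close>

lemma m_normal: "t 3 1 2 * cnj (t 3 1 2) = t 3 2 1 * cnj (t 3 2 1)"
  "(t 3 1 1 - t 3 2 2) * cnj (t 3 1 2) = t 3 2 1 * cnj (t 3 1 1 - t 3 2 2)"
  using P_eq[of 2 3 2 3] P_eq[of 2 3 3 1] unfolding P_eq_0
  by (simp_all add: sum_3 t_adapted_all algebra_simps)

end

end

end

section \<open>The curvature vanishes where the torsion does not\<close>

locale skl_ricci_flat_point = skl_point g T K N2 R
  for g :: "complex ^ 'n::finite \<Rightarrow> complex ^ 'n \<Rightarrow> real" and T K N2 R +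
  assumes R_add: "R x y (u + v) = R x y u + R x y v"
    and R_scaleR: "R x y (r *\<^sub>R u) = r *\<^sub>R R x y u"
    and R_J_commute: "R x y (J u) = J (R x y u)"
    and R_minus: "R x (- y) u = - R x y u"
    and R_skew: "R y x u = - R x y u"
    and R_skew_adjoint: "g (R x y u) v = - g u (R x y v)"
    and R_bianchi: "R x y u + R y u x + R u x y = 0"
    and R_ricci: "\<lbrakk>parseval e; \<And>i j. h (e i) (e j) = (if i = j then 1 else 0)\<rbrakk> \<Longrightarrow> tr (e :: 'n \<Rightarrow> complex ^ 'n) (R x y) = 0"
    and dim_le_3: "CARD('n) \<le> 3"
begin

text \<open>The part of \<open>R\<close> that is complex linear in \<open>x\<close> and conjugate
  linear in \<open>y\<close>. Its components are those of a Kaehler curvature, with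
  \<open>x, u\<close> the holomorphic and \<open>y, v\<close> the antiholomorphic indices of
  \<open>h (Q x y u) v\<close>.\<close>

definition Q where "Q x y u = (1/2) *\<^sub>R (R x y u + J (R x (J y) u))"

lemma R_J_left: "R (J x) y u = - R x (J y) u"
proof -
  have "- R (J x) y u = R x (J y) u"
    using fun_cong[OF R_J[of x "J y"], of u] R_minus[of "J x" y u] by simp
  then show ?thesis by (metis minus_minus)
qed

lemma clinear_R: "clinear (R x y)"
  by (rule clinearI) (simp_all add: R_add R_scaleR R_J_commute)

lemma clinear_Q: "clinear (Q x y)"
  by (rule clinearI) (simp_all add: Q_def R_add R_scaleR R_J_commute algebra_simps)

lemma R_eq_Q: "R x y u = Q x y u - Q y x u"
proof -
  have "R y (J x) u = R x (J y) u" using R_skew[of "J x" y u] R_J_left[of x y u] by simp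
  then have "Q x y u - Q y x u = (1/2) *\<^sub>R (R x y u - R y x u)"
    by (simp add: Q_def algebra_simps)
  then show ?thesis using R_skew[of x y u] by (simp add: algebra_simps flip: scaleR_2)
qed

text \<open>The remaining Bianchi term \<open>R x u y\<close> cancels against
  \<open>J (R x u (J y))\<close>, because \<open>R x u\<close> commutes with
  \<open>J\<close>.\<close>

lemma Q_sym: "Q x y u = Q u y x"
proof -
  have b: "R a b c + R b c a = R a c b" for a b c
    using R_bianchi[of a b c] R_skew[of a c b] by (simp add: add_eq_0_iff)
  have "R x y u + J (R x (J y) u) = R u y x + J (R u (J y) x)"
  proof -
    have 1: "R x y u = R x u y - R y u x" for y using b[of x y u] by (simp add: algebra_simps)
    have 2: "R u y x = - R y u x" for y by (rule R_skew)
    show ?thesis unfolding 1[of y] 1[of "J y"] 2 by (simp add: R_J_commute)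
  qed
  then show ?thesis by (simp add: Q_def)
qed

lemma cnj_h_Q: "cnj (h (Q x y u) v) = h (Q y x v) u"
proof -
  have 1: "h (R x y u) v = - h u (R x y v)" for x y u v
    using R_skew_adjoint[of x y u v] R_skew_adjoint[of x y u "J v"] by (simp add: h_def R_J_commute complex_eq_iff)
  have 2: "R y (J x) v = R x (J y) v" using R_skew[of "J x" y v] R_J_left[of x y v] by simp
  have 3: "R y x v = - R x y v" by (rule R_skew)
  have "h v (Q x y u) = h (Q y x v) u"
    by (simp add: Q_def h_bil 2 3) (simp add: 1[of x y v u] 1[of x "J y" v u] algebra_simps)
  then show ?thesis by (simp add: cnj_h)
qed

lemma h_Q_sym: "h (Q x y u) v = h (Q x v u) y"
  using cnj_h_Q[of y x v u] cnj_h_Q[of v x y u] Q_sym[of y x v] by (simp add: cnj_h)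

lemma tr_Q: assumes "parseval (e :: 'i::finite \<Rightarrow> complex ^ 'n)" shows "tr e (Q x y) = 0"
proof -
  obtain e' :: "'n \<Rightarrow> complex ^ 'n" where e': "parseval e'" "\<And>i j. h (e' i) (e' j) = (if i = j then 1 else 0)"
    using exists_unitary_frame by blast
  have "tr e (R x y) = 0" for x y
    using tr_frame[OF assms e'(1) clinear_R] R_ricci[OF e'] by simp
  then have "(\<Sum>i\<in>UNIV. h (R x y (e i)) (e i)) = 0" for x y by (simp add: tr_def)
  moreover have "tr e (Q x y) = (1/2) * ((\<Sum>i\<in>UNIV. h (R x y (e i)) (e i)) + \<i> * (\<Sum>i\<in>UNIV. h (R x (J y) (e i)) (e i)))"
    by (simp add: tr_def Q_def h_bil sum.distrib sum_distrib_left algebra_simps)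
  ultimately show ?thesis by simp
qed

text \<open>Linear expansion is done in the third argument only; \<open>Q_sym\<close> then reaches
  the first argument and \<open>h_Q_sym\<close> the second.\<close>

lemma Q_zero:
  assumes e: "parseval (e :: 'i::finite \<Rightarrow> complex ^ 'n)" and q: "\<And>i j k l. h (Q (e i) (e j) (e k)) (e l) = 0"
  shows "Q x y u = 0"
proof -
  have A: "Q x y u = 0" if "\<And>k. Q x y (e k) = 0" for x y u
  proof (rule h_eqI)
    fix w
    show "h (Q x y u) w = h 0 w"
      using clinear_expand[OF e clinear_Q, of x y u w] that by (simp add: h_bil)
  qed
  have h0: "a = 0" if "\<And>l. h a (e l) = 0" for a
  proof (rule h_eqI)
    fix w
    show "h a w = h 0 w" using parseval_h[OF e, of a w] that by (simp add: h_bil)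
  qed
  have "Q (e i) (e j) (e k) = 0" for i j k using q by (rule h0)
  then have "Q (e i) (e j) x = 0" for i j x by (rule A)
  then have "Q x (e j) (e i) = 0" for i j x by (simp add: Q_sym[of x])
  then have "Q x (e j) u = 0" for j x u by (rule A)
  then have "h (Q x y u) (e j) = 0" for j by (simp add: h_Q_sym[of x y] h_bil)
  then show ?thesis by (rule h0)
qed

section \<open>Curvature in a frame adapted to the Lee form\<close>

context
  fixes e :: "3 \<Rightarrow> complex ^ 'n" and c :: complex
  assumes e: "parseval e"
    and orth: "\<And>i j. i \<noteq> j \<Longrightarrow> h (e i) (e j) = 0"
    and dual: "\<And>y. tr e (\<tau> y) = c * h y (e 3)"
    and nz: "c \<noteq> 0" "h (e 3) (e 3) = 1"
begin

text \<open>By the Jacobi identity \<open>\<tau> (\<tau> x y)\<close> is the commutator of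
  \<open>\<tau> x\<close> and \<open>\<tau> y\<close>.\<close>

lemma tr_\<tau>_\<tau>: "tr e (\<tau> (\<tau> x y)) = 0"
proof -
  have "\<tau> (\<tau> x y) z = \<tau> x (\<tau> y z) - \<tau> y (\<tau> x z)" for z
    using jacobi[of x y z] \<tau>_skew[of x "\<tau> y z"] \<tau>_skew[of y "\<tau> x z"] \<tau>_skew[of x z]
    by (simp add: \<tau>_bil add_eq_0_iff2 algebra_simps)
  then have "tr e (\<tau> (\<tau> x y)) = tr e (\<lambda>z. \<tau> x (\<tau> y z)) - tr e (\<lambda>z. \<tau> y (\<tau> x z))"
    by (simp add: tr_def h_bil sum_subtractf)
  then show ?thesis using tr_comm[OF e clinear_\<tau> clinear_\<tau>, of x y] by simp
qed

lemma derived: "t e i j 3 = 0"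
  using tr_\<tau>_\<tau>[of "e i" "e j"] nz by (simp add: dual t_def[OF e])

lemma lee: "t e 2 1 1 + t e 2 3 3 = 0" "t e 1 2 2 + t e 1 3 3 = 0" "t e 3 1 1 + t e 3 2 2 \<noteq> 0"
  using dual[of "e 1"] dual[of "e 2"] dual[of "e 3"] orth[of 1 3] orth[of 2 3] nz t_canonical(4)[OF e]
  by (simp_all add: tr_def sum_3 flip: t_def[OF e])

lemma N_zero: "N u x y = 0"
  using N_eq_0[OF e P_eq_0[OF e lee derived]] by simp

lemma Q_\<tau>: "Q x y (\<tau> a b) = \<tau> (Q x y a) b + \<tau> a (Q x y b)"
proof -
  have "N2 v u x y = 0" for v u x y
  proof -
    have "3 *\<^sub>R N2 v u x y = 0" unfolding N2_eq K_\<delta> N_zero by (simp add: \<tau>_bil \<delta>_bil)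
    then show ?thesis by simp
  qed
  then have "R v u (\<tau> x y) = \<tau> (R v u x) y + \<tau> x (R v u y)" for v u x y
    using ricci[of v u x y] by (simp add: N_zero algebra_simps)
  then show ?thesis by (simp add: Q_def \<tau>_bil \<tau>_J algebra_simps)
qed

text \<open>For a derivation, \<open>\<tau> (Q x y a)\<close> is the commutator of
  \<open>Q x y\<close> and \<open>\<tau> a\<close>, hence trace free; by \<open>dual\<close> that
  trace is a nonzero multiple of the component along \<open>e 3\<close>.\<close>

lemma h_Q_e3: "h (Q x y a) (e 3) = 0"
proof -
  have "tr e (\<tau> (Q x y a)) = tr e (\<lambda>b. Q x y (\<tau> a b)) - tr e (\<lambda>b. \<tau> a (Q x y b))"
    by (simp add: Q_\<tau> tr_def h_bil sum.distrib)
  also have "\<dots> = 0" using tr_comm[OF e clinear_Q clinear_\<tau>, of x y a] by simp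
  finally show ?thesis using nz by (simp add: dual)
qed

definition q where "q i j k l = h (Q (e i) (e j) (e k)) (e l)"

lemma q_sym: "q k j i l = q i j k l" "q i l k j = q i j k l"
  using Q_sym[of "e k" "e j" "e i"] h_Q_sym[of "e i" "e l" "e k" "e j"] by (simp_all add: q_def)

lemma q_3: "q i j k 3 = 0" "q i 3 k l = 0" "q i j 3 l = 0" "q 3 j k l = 0"
proof -
  have 1: "q i j k 3 = 0" for i j k by (simp add: q_def h_Q_e3)
  then have 2: "q i 3 k l = 0" for i k l using q_sym(2)[of i 3 k l] by simp
  have 3: "q i j 3 l = 0" for i j l
    using cnj_h_Q[of "e i" "e j" "e 3" "e l"] h_Q_e3 by (simp add: q_def)
  show "q i j k 3 = 0" "q i 3 k l = 0" "q i j 3 l = 0" "q 3 j k l = 0"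
    using 1 2 3 q_sym(1)[of 3 j k l] by simp_all
qed

lemma q_trace: "q i j 2 2 = - q i j 1 1"
  using tr_Q[OF e, of "e i" "e j"] q_3(1)[of i j 3]
  by (simp add: tr_def sum_3 eq_neg_iff_add_eq_0 add.commute flip: q_def)

lemma q_commute: "(\<Sum>m\<in>UNIV. t e 3 k m * q i j m l) = (\<Sum>m\<in>UNIV. q i j k m * t e 3 m l)"
proof -
  have Q3: "Q (e i) (e j) (e 3) = 0"
  proof (rule h_eqI)
    fix w
    have "h (Q (e i) (e j) (e 3)) (e l) = 0" for l using q_3(3)[of i j l] by (simp add: q_def)
    then show "h (Q (e i) (e j) (e 3)) w = h 0 w"
      using parseval_h[OF e, of "Q (e i) (e j) (e 3)" w] by (simp add: h_bil)
  qed
  have "h (Q (e i) (e j) (\<tau> (e 3) (e k))) (e l) = h (\<tau> (e 3) (Q (e i) (e j) (e k))) (e l)"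
    by (simp add: Q_\<tau> Q3 \<tau>_bil)
  then show ?thesis
    unfolding clinear_expand[OF e clinear_Q, of "e i" "e j" "\<tau> (e 3) (e k)"]
      clinear_expand[OF e clinear_\<tau>, of "e 3" "Q (e i) (e j) (e k)"]
    by (simp add: q_def t_def[OF e])
qed

text \<open>This is the discriminant of the characteristic polynomial of \<open>m\<close>. A normal
  matrix with a double eigenvalue is scalar, which \<open>m_nonscalar\<close> and the nonzero trace
  rule out.\<close>

lemma discriminant_nonzero: "(t e 3 1 1 - t e 3 2 2)\<^sup>2 + 4 * t e 3 1 2 * t e 3 2 1 \<noteq> 0"
proof
  define m11 m12 m21 m22 where m: "m11 = t e 3 1 1" "m12 = t e 3 1 2" "m21 = t e 3 2 1" "m22 = t e 3 2 2"
  define d where "d = m11 - m22"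
  assume "(t e 3 1 1 - t e 3 2 2)\<^sup>2 + 4 * t e 3 1 2 * t e 3 2 1 = 0"
  then have D: "d * d = - 4 * m12 * m21" by (simp add: m d_def power2_eq_square eq_neg_iff_add_eq_0)
  have n: "m12 * cnj m12 = m21 * cnj m21" "d * cnj m12 = m21 * cnj d"
    using m_normal[OF e lee derived] by (simp_all add: m d_def)
  \<comment> \<open>The factor \<open>m21\<close> allows normality to replace
    \<open>m21 * cnj d\<close> by \<open>d * cnj m12\<close>; then \<open>D\<close> cancels the two
    summands.\<close>
  have "m21 * (d * cnj d + 4 * (m12 * cnj m12)) = 0" using D n(2) by algebra
  moreover have "m21 = 0" if "d * cnj d + 4 * (m12 * cnj m12) = 0"
  proof -
    have "of_real ((cmod d)\<^sup>2 + 4 * (cmod m12)\<^sup>2) = (0::complex)"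
      using that by (simp only: of_real_add of_real_mult complex_norm_square of_real_numeral)
    then have "(cmod d)\<^sup>2 + 4 * (cmod m12)\<^sup>2 = 0" by (simp only: of_real_eq_0_iff)
    then have "m12 = 0" by (simp add: add_nonneg_eq_0_iff)
    then show ?thesis using n(1) by simp
  qed
  ultimately have z: "m21 = 0" by auto
  then have "m12 = 0" using n(1) by simp
  moreover have "d = 0" using D z by simp
  ultimately have "m11 * cnj m22 + m22 * cnj m11 = 0" "m11 = m22"
    using m_nonscalar[OF e lee derived] z by (simp_all add: m d_def)
  then have "m11 = 0" "m22 = 0" by auto
  then show False using lee(3) by (simp add: m)
qed

text \<open>For fixed \<open>i, j\<close> the relations \<open>X\<close> say that the trace free 2 x
  2 block of \<open>q i j\<close> is proportional to the trace free part of \<open>m\<close>. The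
  symmetries and trace conditions leave five unknowns. The discriminant annihilates
  \<open>a\<close>, \<open>b\<close>, \<open>b'\<close>; then \<open>p\<close> and \<open>p'\<close>
  are killed by both \<open>d\<close> and an off-diagonal entry of \<open>m\<close>, and these
  cannot both vanish.\<close>

lemma q_zero: "q i j k l = 0"
proof -
  define m11 m12 m21 m22 where m: "m11 = t e 3 1 1" "m12 = t e 3 1 2" "m21 = t e 3 2 1" "m22 = t e 3 2 2"
  define d where "d = m11 - m22"
  have D: "d * d + 4 * m12 * m21 \<noteq> 0"
    using discriminant_nonzero by (simp add: d_def m power2_eq_square)
  have X: "d * q i j 1 2 = 2 * m12 * q i j 1 1" "d * q i j 2 1 = 2 * m21 * q i j 1 1"
    "m12 * q i j 2 1 = m21 * q i j 1 2" for i j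
    using q_commute[of 1 i j 2] q_commute[of 2 i j 1] q_commute[of 1 i j 1] derived q_trace[of i j]
    by (simp_all add: sum_3 q_3 d_def m algebra_simps)
  define a b b' p p' where abb: "a = q 1 1 1 1" "b = q 1 1 1 2" "b' = q 1 1 2 1" "p = q 1 2 1 2" "p' = q 2 1 2 1"
  have s: "q 1 1 2 2 = - a" "q 1 2 1 1 = b" "q 1 2 2 1 = - a" "q 1 2 2 2 = - b"
    "q 2 1 1 1 = b'" "q 2 1 1 2 = - a" "q 2 1 2 2 = - b'"
    "q 2 2 1 1 = - a" "q 2 2 1 2 = - b" "q 2 2 2 1 = - b'" "q 2 2 2 2 = a"
    using q_trace[of 1 1] q_trace[of 1 2] q_trace[of 2 1] q_trace[of 2 2]
      q_sym(2)[of 1 1 1 2] q_sym(2)[of 1 1 2 2] q_sym(1)[of 1 1 2 1] q_sym(1)[of 1 1 2 2]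
      q_sym(1)[of 1 2 2 2] q_sym(1)[of 1 2 2 1] q_sym(2)[of 2 1 2 2]
    by (simp_all add: abb)
  have "(d * d + 4 * m12 * m21) * a = 0" using X[of 1 1] X[of 1 2] s unfolding abb by algebra
  then have a: "a = 0" using D by simp
  have "(d * d + 4 * m12 * m21) * b = 0" using X[of 1 1] X[of 1 2] s unfolding abb by algebra
  then have b: "b = 0" using D by simp
  have "(d * d + 4 * m12 * m21) * b' = 0" using X[of 1 1] X[of 2 1] s unfolding abb by algebra
  then have b': "b' = 0" using D by simp
  have "d * p = 0" "m21 * p = 0" using X[of 1 2] s a b by (simp_all add: abb)
  then have p: "p = 0" using D by auto
  have "d * p' = 0" "m12 * p' = 0" using X[of 2 1] s a b' by (simp_all add: abb)
  then have p': "p' = 0" using D by auto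
  have "\<forall>i j k l. q i j k l = 0"
    unfolding forall_3 using s a b b' p p' by (simp add: q_3 abb)
  then show ?thesis by simp
qed

lemma R_zero_of_frame: "R x y u = 0"
  using Q_zero[OF e q_zero[unfolded q_def]] by (simp add: R_eq_Q)

end

theorem R_eq_0:
  assumes "T x\<^sub>0 y\<^sub>0 \<noteq> 0"
  shows "R x y u = 0"
proof -
  obtain f where f: "h f f = 1" by (rule exists_unit)
  then obtain e0 :: "3 \<Rightarrow> complex ^ 'n" where e0: "parseval e0"
    using exists_parseval_3[OF f dim_le_3] by blast
  \<comment> \<open>The vector representing the Lee form through \<open>h\<close>; the conjugation
    compensates for the conjugate linear second slot.\<close>
  define \<epsilon> where "\<epsilon> = (\<Sum>i\<in>UNIV. cnj (tr e0 (\<tau> (e0 i))) *s e0 i)"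
  have \<epsilon>: "tr e0 (\<tau> y) = h y \<epsilon>" for y
  proof -
    have "tr e0 (\<tau> y) = (\<Sum>j\<in>UNIV. \<Sum>i\<in>UNIV. h y (e0 i) * h (\<tau> (e0 i) (e0 j)) (e0 j))"
      unfolding tr_def using clinear_expand[OF e0 clinear_\<tau>', of y] by (auto intro: sum.cong)
    also have "\<dots> = (\<Sum>i\<in>UNIV. h y (e0 i) * tr e0 (\<tau> (e0 i)))"
      by (subst sum.swap) (simp add: tr_def sum_distrib_left)
    finally show ?thesis by (simp add: \<epsilon>_def h_sum h_smult mult.commute)
  qed
  have "\<epsilon> \<noteq> 0"
  proof
    assume "\<epsilon> = 0"
    then have "(\<Sum>m\<in>UNIV. t e0 i m m) = 0" for i
      using \<epsilon>[of "e0 i"] by (simp add: tr_def t_def[OF e0] h_bil)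
    then have \<tau>: "\<tau> x y = 0" for x y
      using \<tau>_eq_0[OF e0 lee_form_zero[OF e0]] by blast
    have "\<delta> x y = 0" for x y
      by (rule h_eqI) (simp add: h_\<delta> \<tau> h_bil)
    with \<tau> assms show False by (simp add: T_eq)
  qed
  define r where "r = sqrt (g \<epsilon> \<epsilon>)"
  have r: "r > 0" using g_pos[OF \<open>\<epsilon> \<noteq> 0\<close>] by (simp add: r_def)
  have "h ((1 / r) *\<^sub>R \<epsilon>) ((1 / r) *\<^sub>R \<epsilon>) = 1" unfolding r_def by (rule h_normalize) fact
  then obtain e :: "3 \<Rightarrow> complex ^ 'n" where e: "parseval e" "e 3 = (1 / r) *\<^sub>R \<epsilon>"
    "\<And>i j. i \<noteq> j \<Longrightarrow> h (e i) (e j) = 0" and n3: "h (e 3) (e 3) = 1"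
    using exists_parseval_3[OF _ dim_le_3] by metis
  have "tr e (\<tau> y) = of_real r * h y (e 3)" for y
    unfolding tr_frame[OF e(1) e0 clinear_\<tau>] \<epsilon> e(2) using r by (simp add: h_bil)
  from R_zero_of_frame[OF e(1,3) this _ n3] r show ?thesis by simp
qed

end

section \<open>Derivatives of fields of linear maps and symmetry of second derivatives\<close>

text \<open>Expanding the argument in \<open>Basis\<close> reduces the product rule to derivatives
  of \<open>F p a\<close> with \<open>a\<close> fixed.\<close>

lemma has_derivative_linear_field:
  fixes F :: "'a::real_normed_vector \<Rightarrow> 'e::euclidean_space \<Rightarrow> 'b::real_normed_vector"
  assumes U: "open U" "z \<in> U" and lin: "\<And>p. p \<in> U \<Longrightarrow> linear (F p)"
    and F: "\<And>a. ((\<lambda>p. F p a) has_derivative F' a) (at z)"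
    and A: "(A has_derivative A') (at z)"
  shows "((\<lambda>p. F p (A p)) has_derivative (\<lambda>v. F' (A z) v + F z (A' v))) (at z)"
proof -
  have expand: "F p a = (\<Sum>b\<in>Basis. (a \<bullet> b) *\<^sub>R F p b)" if "p \<in> U" for p a
    using linear_sum[OF lin[OF that], of "\<lambda>b. (a \<bullet> b) *\<^sub>R b" Basis] linear_cmul[OF lin[OF that]]
    by (simp add: euclidean_representation)
  have 1: "((\<lambda>p. \<Sum>b\<in>Basis. (a \<bullet> b) *\<^sub>R F p b) has_derivative (\<lambda>v. \<Sum>b\<in>Basis. (a \<bullet> b) *\<^sub>R F' b v)) (at z)" for a
    by (intro has_derivative_sum has_derivative_scaleR_right F)
  have F': "F' a v = (\<Sum>b\<in>Basis. (a \<bullet> b) *\<^sub>R F' b v)" for a v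
  proof -
    have "((\<lambda>p. F p a) has_derivative (\<lambda>v. \<Sum>b\<in>Basis. (a \<bullet> b) *\<^sub>R F' b v)) (at z)"
      by (rule has_derivative_transform_within_open[OF 1 U]) (simp add: expand)
    from has_derivative_unique[OF F this] show ?thesis by (rule fun_cong)
  qed
  have "((\<lambda>p. \<Sum>b\<in>Basis. (A p \<bullet> b) *\<^sub>R F p b) has_derivative
      (\<lambda>v. \<Sum>b\<in>Basis. (A z \<bullet> b) *\<^sub>R F' b v + (A' v \<bullet> b) *\<^sub>R F z b)) (at z)"
    by (intro has_derivative_sum has_derivative_scaleR has_derivative_inner_left F A)
  then have "((\<lambda>p. F p (A p)) has_derivative
      (\<lambda>v. \<Sum>b\<in>Basis. (A z \<bullet> b) *\<^sub>R F' b v + (A' v \<bullet> b) *\<^sub>R F z b)) (at z)"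
    by (rule has_derivative_transform_within_open[OF _ U]) (simp add: expand)
  then show ?thesis
    unfolding sum.distrib F'[of "A z", symmetric] expand[OF U(2), symmetric] .
qed

lemma linear_field_derivative:
  assumes U: "open U" "z \<in> U" and lin: "\<And>p. p \<in> U \<Longrightarrow> linear (F p)"
    and F: "\<And>a. ((\<lambda>p. F p a) has_derivative F' a) (at z)"
  shows "linear (\<lambda>a. F' a v)"
proof (rule linearI)
  fix a b r
  have "((\<lambda>p. F p a + F p b) has_derivative (\<lambda>v. F' a v + F' b v)) (at z)"
    by (intro has_derivative_add F)
  then have "((\<lambda>p. F p (a + b)) has_derivative (\<lambda>v. F' a v + F' b v)) (at z)"
    by (rule has_derivative_transform_within_open[OF _ U]) (simp add: lin linear_add)
  from has_derivative_unique[OF F this] show "F' (a + b) v = F' a v + F' b v" by (rule fun_cong)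
  have "((\<lambda>p. r *\<^sub>R F p a) has_derivative (\<lambda>v. r *\<^sub>R F' a v)) (at z)"
    by (intro has_derivative_scaleR_right F)
  then have "((\<lambda>p. F p (r *\<^sub>R a)) has_derivative (\<lambda>v. r *\<^sub>R F' a v)) (at z)"
    by (rule has_derivative_transform_within_open[OF _ U]) (simp add: lin linear_cmul)
  from has_derivative_unique[OF F this] show "F' (r *\<^sub>R a) v = r *\<^sub>R F' a v" by (rule fun_cong)
qed

text \<open>The mean value theorem is applied to the second difference over a parallelogram, first
  along \<open>u\<close>, then along \<open>v\<close>.\<close>

lemma mixed_difference:
  fixes f :: "'a::real_normed_vector \<Rightarrow> real"
  assumes f: "\<And>p. p \<in> S \<Longrightarrow> (f has_derivative f' p) (at p)"
    and f': "\<And>p. p \<in> S \<Longrightarrow> ((\<lambda>p. f' p u) has_derivative f'' p) (at p)"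
    and \<delta>: "\<delta> > 0" and S: "\<And>s t. 0 \<le> s \<Longrightarrow> s \<le> \<delta> \<Longrightarrow> 0 \<le> t \<Longrightarrow> t \<le> \<delta> \<Longrightarrow> z + s *\<^sub>R u + t *\<^sub>R v \<in> S"
  obtains s t where "0 < s" "s < \<delta>" "0 < t" "t < \<delta>"
    "f (z + \<delta> *\<^sub>R u + \<delta> *\<^sub>R v) - f (z + \<delta> *\<^sub>R u) - f (z + \<delta> *\<^sub>R v) + f z = \<delta> * \<delta> * f'' (z + s *\<^sub>R u + t *\<^sub>R v) v"
proof -
  have along: "((\<lambda>s. k (a + s *\<^sub>R w)) has_real_derivative k' w) (at s)"
    if "(k has_derivative k') (at (a + s *\<^sub>R w))" for k k' a w s
  proof -
    have "((\<lambda>s. a + s *\<^sub>R w) has_derivative (\<lambda>s. s *\<^sub>R w)) (at s)"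
      by (auto intro!: derivative_eq_intros)
    from has_derivative_compose[OF this that]
    have "((\<lambda>s. k (a + s *\<^sub>R w)) has_derivative (\<lambda>s. k' (s *\<^sub>R w))) (at s)" .
    moreover have "k' (s *\<^sub>R w) = k' w * s" for s
      using linear_cmul[OF has_derivative_linear[OF that]] by simp
    ultimately show ?thesis by (simp add: has_field_derivative_def)
  qed
  have "DERIV (\<lambda>s. f (z + \<delta> *\<^sub>R v + s *\<^sub>R u) - f (z + s *\<^sub>R u)) s :> f' (z + \<delta> *\<^sub>R v + s *\<^sub>R u) u - f' (z + s *\<^sub>R u) u"
    if "0 \<le> s" "s \<le> \<delta>" for s
    using that \<delta> S[of s \<delta>] S[of s 0] by (intro DERIV_diff along f) (simp_all add: algebra_simps)
  from MVT2[OF \<delta> this] obtain s where s: "0 < s" "s < \<delta>"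
    "f (z + \<delta> *\<^sub>R v + \<delta> *\<^sub>R u) - f (z + \<delta> *\<^sub>R u) - (f (z + \<delta> *\<^sub>R v) - f z)
      = \<delta> * (f' (z + \<delta> *\<^sub>R v + s *\<^sub>R u) u - f' (z + s *\<^sub>R u) u)"
    by auto
  have "DERIV (\<lambda>t. f' (z + s *\<^sub>R u + t *\<^sub>R v) u) t :> f'' (z + s *\<^sub>R u + t *\<^sub>R v) v"
    if "0 \<le> t" "t \<le> \<delta>" for t
    using that s S[of s t] by (intro along[of "\<lambda>p. f' p u"] f') simp_all
  from MVT2[OF \<delta> this] obtain t where t: "0 < t" "t < \<delta>"
    "f' (z + s *\<^sub>R u + \<delta> *\<^sub>R v) u - f' (z + s *\<^sub>R u) u = \<delta> * f'' (z + s *\<^sub>R u + t *\<^sub>R v) v"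
    by auto
  show thesis
    using s t by (intro that[of s t]) (simp_all add: algebra_simps)
qed

text \<open>The second difference is symmetric in \<open>u, v\<close>, so both mixed derivatives
  take a common value at points near \<open>z\<close>; continuity transfers the equality to
  \<open>z\<close>.\<close>

lemma second_derivative_symmetric_real:
  fixes f :: "'a::real_normed_vector \<Rightarrow> real"
  assumes S: "open S" "z \<in> S"
    and f: "\<And>p. p \<in> S \<Longrightarrow> (f has_derivative f' p) (at p)"
    and f': "\<And>p v. p \<in> S \<Longrightarrow> ((\<lambda>p. f' p v) has_derivative f'' p v) (at p)"
    and cont: "\<And>u v. continuous_on S (\<lambda>p. f'' p u v)"
  shows "f'' z u v = f'' z v u"
proof (rule ccontr)
  assume ne: "f'' z u v \<noteq> f'' z v u"
  define \<epsilon> where "\<epsilon> = dist (f'' z u v) (f'' z v u) / 2"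
  have \<epsilon>: "\<epsilon> > 0" using ne by (simp add: \<epsilon>_def)
  have near: "\<exists>r>0. \<forall>p. dist p z < r \<longrightarrow> p \<in> S \<and> dist (f'' p u v) (f'' z u v) < \<epsilon>" for u v
  proof -
    have "isCont (\<lambda>p. f'' p u v) z" using cont S by (simp add: continuous_on_eq_continuous_at)
    then obtain d1 where d1: "d1 > 0" "\<And>p. dist p z < d1 \<Longrightarrow> dist (f'' p u v) (f'' z u v) < \<epsilon>"
      using \<epsilon> unfolding continuous_at_eps_delta by blast
    obtain d2 where "d2 > 0" "\<And>p. dist p z < d2 \<Longrightarrow> p \<in> S"
      using S unfolding open_dist by blast
    with d1 show ?thesis by (intro exI[of _ "min d1 d2"]) simp
  qed
  obtain r1 where r1: "r1 > 0" "\<And>p. dist p z < r1 \<Longrightarrow> p \<in> S \<and> dist (f'' p u v) (f'' z u v) < \<epsilon>"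
    using near by meson
  obtain r2 where r2: "r2 > 0" "\<And>p. dist p z < r2 \<Longrightarrow> p \<in> S \<and> dist (f'' p v u) (f'' z v u) < \<epsilon>"
    using near by meson
  \<comment> \<open>The whole parallelogram stays within \<open>min r1 r2\<close> of
    \<open>z\<close>; the summand 1 covers \<open>u = v = 0\<close>.\<close>
  define \<delta> where "\<delta> = min r1 r2 / (2 * (norm u + norm v + 1))"
  have pos: "norm u + norm v + 1 > 0" by (simp add: add_nonneg_pos)
  then have \<delta>: "\<delta> > 0" using r1 r2 by (simp add: \<delta>_def)
  have small: "dist (z + s *\<^sub>R u + t *\<^sub>R v) z < min r1 r2" if "0 \<le> s" "s \<le> \<delta>" "0 \<le> t" "t \<le> \<delta>" for s t
  proof -
    have "dist (z + s *\<^sub>R u + t *\<^sub>R v) z = norm (s *\<^sub>R u + t *\<^sub>R v)"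
      by (simp add: dist_norm add.assoc)
    also have "\<dots> \<le> norm (s *\<^sub>R u) + norm (t *\<^sub>R v)" by (rule norm_triangle_ineq)
    also have "\<dots> \<le> \<delta> * norm u + \<delta> * norm v"
      using that by (intro add_mono) (simp_all add: mult_right_mono)
    also have "\<dots> < \<delta> * (2 * (norm u + norm v + 1))"
      using \<delta> by (simp add: algebra_simps add_nonneg_pos add_pos_nonneg)
    also have "\<dots> = min r1 r2" using pos by (simp add: \<delta>_def)
    finally show ?thesis .
  qed
  have mem: "z + s *\<^sub>R u + t *\<^sub>R v \<in> S" "z + t *\<^sub>R v + s *\<^sub>R u \<in> S"
    if "0 \<le> s" "s \<le> \<delta>" "0 \<le> t" "t \<le> \<delta>" for s t
    using small[OF that] r1(2)[of "z + s *\<^sub>R u + t *\<^sub>R v"] by (simp_all add: add_ac)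
  obtain s t where st: "0 < s" "s < \<delta>" "0 < t" "t < \<delta>"
    "f (z + \<delta> *\<^sub>R u + \<delta> *\<^sub>R v) - f (z + \<delta> *\<^sub>R u) - f (z + \<delta> *\<^sub>R v) + f z
      = \<delta> * \<delta> * f'' (z + s *\<^sub>R u + t *\<^sub>R v) u v"
    by (rule mixed_difference[where f'' = "\<lambda>p. f'' p u" and u = u and v = v and z = z, OF f f' \<delta>]) (use mem in auto)
  obtain s' t' where st': "0 < s'" "s' < \<delta>" "0 < t'" "t' < \<delta>"
    "f (z + \<delta> *\<^sub>R v + \<delta> *\<^sub>R u) - f (z + \<delta> *\<^sub>R v) - f (z + \<delta> *\<^sub>R u) + f z
      = \<delta> * \<delta> * f'' (z + s' *\<^sub>R v + t' *\<^sub>R u) v u"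
    by (rule mixed_difference[where f'' = "\<lambda>p. f'' p v" and u = v and v = u and z = z, OF f f' \<delta>]) (use mem in auto)
  have "f'' (z + s *\<^sub>R u + t *\<^sub>R v) u v = f'' (z + s' *\<^sub>R v + t' *\<^sub>R u) v u"
    using st(5) st'(5) \<delta> by (simp add: algebra_simps)
  moreover have "dist (f'' (z + s *\<^sub>R u + t *\<^sub>R v) u v) (f'' z u v) < \<epsilon>"
    using r1(2) small[of s t] st by simp
  moreover have "dist (f'' (z + s' *\<^sub>R v + t' *\<^sub>R u) v u) (f'' z v u) < \<epsilon>"
    using r2(2) small[of t' s'] st' by (simp add: add_ac)
  ultimately have "dist (f'' z u v) (f'' z v u) < 2 * \<epsilon>"
    unfolding dist_real_def by linarith
  then show False by (simp add: \<epsilon>_def)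
qed

section \<open>Derivatives of smooth maps\<close>

lemma smooth_on_has_derivative:
  "smooth_on S f \<Longrightarrow> x \<in> S \<Longrightarrow> (f has_derivative frechet_derivative f (at x)) (at x)"
  unfolding smooth_on_def by (metis Ck_on.simps(2) frechet_derivative_works)

lemma smooth_on_derivative:
  "smooth_on S f \<Longrightarrow> smooth_on S (\<lambda>x. frechet_derivative f (at x) v)"
  unfolding smooth_on_def by (metis Ck_on.simps(2))

lemma smooth_on_continuous: "smooth_on S f \<Longrightarrow> continuous_on S f"
  unfolding smooth_on_def by (metis Ck_on.simps(1))

lemma smooth_on_const: "smooth_on S (\<lambda>_. c)"
proof -
  have "Ck_on k S (\<lambda>_. c)" for k
    by (induction k arbitrary: c) simp_all
  then show ?thesis by (simp add: smooth_on_def)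
qed

lemma second_derivative_symmetric:
  fixes f :: "'a::real_normed_vector \<Rightarrow> 'b::euclidean_space"
  assumes S: "open S" "z \<in> S" and f: "smooth_on S f"
  shows "frechet_derivative (\<lambda>p. frechet_derivative f (at p) u) (at z) v
       = frechet_derivative (\<lambda>p. frechet_derivative f (at p) v) (at z) u"
proof (rule euclidean_eqI)
  fix b :: 'b
  let ?D = "\<lambda>p u v. frechet_derivative (\<lambda>p. frechet_derivative f (at p) u) (at p) v"
  show "?D z u v \<bullet> b = ?D z v u \<bullet> b"
  proof (rule second_derivative_symmetric_real[OF S, of "\<lambda>p. f p \<bullet> b" "\<lambda>p u. frechet_derivative f (at p) u \<bullet> b"
        "\<lambda>p u v. ?D p u v \<bullet> b"])
    show "((\<lambda>p. f p \<bullet> b) has_derivative (\<lambda>u. frechet_derivative f (at p) u \<bullet> b)) (at p)" if "p \<in> S" for p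
      by (intro has_derivative_inner_left smooth_on_has_derivative[OF f that])
    show "((\<lambda>p. frechet_derivative f (at p) v \<bullet> b) has_derivative (\<lambda>w. ?D p v w \<bullet> b)) (at p)" if "p \<in> S" for p v
      by (intro has_derivative_inner_left smooth_on_has_derivative[OF smooth_on_derivative[OF f] that])
    show "continuous_on S (\<lambda>p. ?D p u v \<bullet> b)" for u v
      by (intro continuous_intros smooth_on_continuous[OF smooth_on_derivative[OF smooth_on_derivative[OF f]]])
  qed
qed

section \<open>Covariant derivatives in a chart\<close>

locale hermitian_chart =
  fixes U :: "(complex ^ 'n::finite) set"
    and g :: "complex ^ 'n \<Rightarrow> complex ^ 'n \<Rightarrow> complex ^ 'n \<Rightarrow> real"
    and \<Gamma> :: "'n christoffel"
  assumes open_U: "open U"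
    and herm: "z \<in> U \<Longrightarrow> hermitian_space (g z)"
    and g_smooth: "smooth_on U (\<lambda>z. g z x y)"
    and \<Gamma>_bilinear: "z \<in> U \<Longrightarrow> bilinear (\<Gamma> z)"
    and \<Gamma>_smooth: "smooth_on U (\<lambda>z. \<Gamma> z x y)"
    and g_parallel: "z \<in> U \<Longrightarrow> frechet_derivative (\<lambda>p. g p x y) (at z) v = g z (\<Gamma> z v x) y + g z x (\<Gamma> z v y)"
    and \<Gamma>_J: "z \<in> U \<Longrightarrow> \<Gamma> z x (J y) = J (\<Gamma> z x y)"
    and torsion_alt: "z \<in> U \<Longrightarrow> g z (\<Gamma> z x y - \<Gamma> z y x) w = - g z (\<Gamma> z x w - \<Gamma> z w x) y"
begin

definition D where "D z v x y = frechet_derivative (\<lambda>p. \<Gamma> p x y) (at z) v"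
definition D2 where "D2 z v u x y = frechet_derivative (\<lambda>p. D p u x y) (at z) v"

lemma D: "z \<in> U \<Longrightarrow> ((\<lambda>p. \<Gamma> p x y) has_derivative (\<lambda>v. D z v x y)) (at z)"
  unfolding D_def by (rule smooth_on_has_derivative[OF \<Gamma>_smooth])

lemma D2: "z \<in> U \<Longrightarrow> ((\<lambda>p. D p u x y) has_derivative (\<lambda>v. D2 z v u x y)) (at z)"
  unfolding D2_def D_def by (rule smooth_on_has_derivative[OF smooth_on_derivative[OF \<Gamma>_smooth]])

lemma D2_sym: "z \<in> U \<Longrightarrow> D2 z v u x y = D2 z u v x y"
  unfolding D2_def D_def by (rule second_derivative_symmetric[OF open_U _ \<Gamma>_smooth])

lemma \<Gamma>_bil:
  assumes "z \<in> U"
  shows "\<Gamma> z (x + y) v = \<Gamma> z x v + \<Gamma> z y v" "\<Gamma> z u (x + y) = \<Gamma> z u x + \<Gamma> z u y"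
    "\<Gamma> z (x - y) v = \<Gamma> z x v - \<Gamma> z y v" "\<Gamma> z u (x - y) = \<Gamma> z u x - \<Gamma> z u y"
    "\<Gamma> z (- x) v = - \<Gamma> z x v" "\<Gamma> z u (- x) = - \<Gamma> z u x"
    "\<Gamma> z 0 v = 0" "\<Gamma> z u 0 = 0"
    "\<Gamma> z (r *\<^sub>R x) v = r *\<^sub>R \<Gamma> z x v" "\<Gamma> z u (r *\<^sub>R x) = r *\<^sub>R \<Gamma> z u x"
  using \<Gamma>_bilinear[OF assms]
  by (simp_all add: bilinear_ladd bilinear_radd bilinear_lsub bilinear_rsub bilinear_lneg
      bilinear_rneg bilinear_lzero bilinear_rzero bilinear_lmul bilinear_rmul)

lemma linear_\<Gamma>: "z \<in> U \<Longrightarrow> linear (\<lambda>x. \<Gamma> z x y)" "z \<in> U \<Longrightarrow> linear (\<Gamma> z x)"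
  by (auto intro!: linearI simp: \<Gamma>_bil)

lemma linear_D:
  assumes "z \<in> U"
  shows "linear (\<lambda>v. D z v x y)" "linear (\<lambda>x. D z v x y)" "linear (\<lambda>y. D z v x y)"
proof -
  show "linear (\<lambda>v. D z v x y)" using D[OF assms] by (rule has_derivative_linear)
  show "linear (\<lambda>x. D z v x y)"
    by (rule linear_field_derivative[OF open_U assms, of "\<lambda>p x. \<Gamma> p x y" "\<lambda>x v. D z v x y"])
      (auto simp: linear_\<Gamma> D assms)
  show "linear (\<lambda>y. D z v x y)"
    by (rule linear_field_derivative[OF open_U assms, of "\<lambda>p y. \<Gamma> p x y" "\<lambda>y v. D z v x y"])
      (auto simp: linear_\<Gamma> D assms)
qed

lemma D_lin:
  assumes "z \<in> U"
  shows "D z (v + v') x y = D z v x y + D z v' x y" "D z v (x + x') y = D z v x y + D z v x' y"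
    "D z v x (y + y') = D z v x y + D z v x y'"
    "D z (v - v') x y = D z v x y - D z v' x y" "D z v (x - x') y = D z v x y - D z v x' y"
    "D z v x (y - y') = D z v x y - D z v x y'"
    "D z (- v) x y = - D z v x y" "D z v (- x) y = - D z v x y" "D z v x (- y) = - D z v x y"
    "D z (r *\<^sub>R v) x y = r *\<^sub>R D z v x y" "D z v (r *\<^sub>R x) y = r *\<^sub>R D z v x y"
    "D z v x (r *\<^sub>R y) = r *\<^sub>R D z v x y"
  using linear_add[OF linear_D(1)[OF assms]] linear_add[OF linear_D(2)[OF assms]]
    linear_add[OF linear_D(3)[OF assms]] linear_diff[OF linear_D(1)[OF assms]]
    linear_diff[OF linear_D(2)[OF assms]] linear_diff[OF linear_D(3)[OF assms]]
    linear_neg[OF linear_D(1)[OF assms]] linear_neg[OF linear_D(2)[OF assms]] linear_neg[OF linear_D(3)[OF assms]]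
    linear_cmul[OF linear_D(1)[OF assms]] linear_cmul[OF linear_D(2)[OF assms]] linear_cmul[OF linear_D(3)[OF assms]]
  by simp_all

lemma D_J:
  assumes "z \<in> U"
  shows "D z v x (J y) = J (D z v x y)"
proof -
  have "bounded_linear (J :: complex ^ 'n \<Rightarrow> _)" using linear_J by (rule linear_linear[THEN iffD2])
  from bounded_linear.has_derivative[OF this D[OF assms]]
  have "((\<lambda>p. J (\<Gamma> p x y)) has_derivative (\<lambda>v. J (D z v x y))) (at z)" .
  then have "((\<lambda>p. \<Gamma> p x (J y)) has_derivative (\<lambda>v. J (D z v x y))) (at z)"
    by (rule has_derivative_transform_within_open[OF _ open_U assms]) (simp add: \<Gamma>_J)
  from has_derivative_unique[OF D[OF assms] this] show ?thesis by (rule fun_cong)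
qed

definition T where "T z x y = \<Gamma> z x y - \<Gamma> z y x"

definition R where "R z x y w = D z x y w - D z y x w + \<Gamma> z x (\<Gamma> z y w) - \<Gamma> z y (\<Gamma> z x w)"

text \<open>The covariant derivative of \<open>\<Gamma>\<close>, treated as if it were a tensor.\<close>

definition D\<Gamma> where "D\<Gamma> z v x y = D z v x y + \<Gamma> z v (\<Gamma> z x y) - \<Gamma> z (\<Gamma> z v x) y - \<Gamma> z x (\<Gamma> z v y)"

definition K where "K z v x y = D\<Gamma> z v x y - D\<Gamma> z v y x"

text \<open>Used for \<open>\<Gamma>\<close> and for \<open>D\<Gamma>\<close>: a connection
  preserving \<open>J\<close> has no torsion component conjugate linear in both arguments, and the
  same holds for the derivative of the torsion.\<close>

lemma type_of_skew_part:
  assumes "bilinear B" "\<And>x y. B x (J y) = J (B x y)"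
  shows "B (J x) (J y) - B (J y) (J x) = (B x y - B y x) + J (B (J x) y - B y (J x)) + J (B x (J y) - B (J y) x)"
  by (simp add: assms)

lemma T_form: "z \<in> U \<Longrightarrow> skew_torsion_form (g z) (T z)"
proof (intro skew_torsion_form.intro herm skew_torsion_form_axioms.intro)
  assume z: "z \<in> U"
  show "bilinear (T z)"
    unfolding bilinear_def by (auto intro!: linearI simp: T_def \<Gamma>_bil[OF z] algebra_simps)
  show "T z x y = - T z y x" for x y by (simp add: T_def)
  show "g z (T z x y) w = - g z (T z x w) y" for x y w
    unfolding T_def by (rule torsion_alt[OF z])
  show "T z (J x) (J y) = T z x y + J (T z (J x) y) + J (T z x (J y))" for x y
    unfolding T_def using type_of_skew_part[of "\<Gamma> z", OF \<Gamma>_bilinear[OF z] \<Gamma>_J[OF z]] .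
qed

text \<open>\<open>nabla z A A'\<close>: the vector field \<open>A\<close> has covariant derivative \<open>A' v\<close> in direction \<open>v\<close> at \<open>z\<close>;
  \<open>nabla2\<close> and \<open>nabla3\<close> are the analogues for tensor fields.\<close>

definition nabla where
  "nabla z A A' \<longleftrightarrow> (A has_derivative (\<lambda>v. A' v - \<Gamma> z v (A z))) (at z)"

definition nabla2 where
  "nabla2 z B B' \<longleftrightarrow> (\<forall>x y. ((\<lambda>p. B p x y) has_derivative
     (\<lambda>v. B' v x y - \<Gamma> z v (B z x y) + B z (\<Gamma> z v x) y + B z x (\<Gamma> z v y))) (at z))"

definition nabla3 where
  "nabla3 z B B' \<longleftrightarrow> (\<forall>u x y. ((\<lambda>p. B p u x y) has_derivative
     (\<lambda>v. B' v u x y - \<Gamma> z v (B z u x y) + B z (\<Gamma> z v u) x y + B z u (\<Gamma> z v x) y + B z u x (\<Gamma> z v y))) (at z))"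

text \<open>The Leibniz rule: the Christoffel terms of \<open>nabla2\<close> cancel those
  contributed by the two fields.\<close>

lemma nabla2_app:
  assumes z: "z \<in> U" and B: "nabla2 z B B'" "\<And>p. p \<in> U \<Longrightarrow> bilinear (B p)"
    and X: "nabla z X X'" and Y: "nabla z Y Y'"
  shows "nabla z (\<lambda>p. B p (X p) (Y p)) (\<lambda>v. B' v (X z) (Y z) + B z (X' v) (Y z) + B z (X z) (Y' v))"
proof -
  have lin: "linear (\<lambda>x. B p x y)" "linear (B p x)" if "p \<in> U" for p x y
    using B(2)[OF that] by (simp_all add: bilinear_def)
  have 1: "((\<lambda>p. B p (X p) y) has_derivative (\<lambda>v. (B' v (X z) y - \<Gamma> z v (B z (X z) y)
      + B z (\<Gamma> z v (X z)) y + B z (X z) (\<Gamma> z v y)) + B z (X' v - \<Gamma> z v (X z)) y)) (at z)" for y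
    by (rule has_derivative_linear_field[OF open_U z, of "\<lambda>p x. B p x y" "\<lambda>x v. B' v x y - \<Gamma> z v (B z x y)
      + B z (\<Gamma> z v x) y + B z x (\<Gamma> z v y)"])
      (use B(1) X lin in \<open>auto simp: nabla2_def nabla_def\<close>)
  have "((\<lambda>p. B p (X p) (Y p)) has_derivative (\<lambda>v. ((B' v (X z) (Y z) - \<Gamma> z v (B z (X z) (Y z))
      + B z (\<Gamma> z v (X z)) (Y z) + B z (X z) (\<Gamma> z v (Y z))) + B z (X' v - \<Gamma> z v (X z)) (Y z))
      + B z (X z) (Y' v - \<Gamma> z v (Y z)))) (at z)"
    by (rule has_derivative_linear_field[OF open_U z, of "\<lambda>p. B p (X p)" "\<lambda>y v. (B' v (X z) y - \<Gamma> z v (B z (X z) y)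
      + B z (\<Gamma> z v (X z)) y + B z (X z) (\<Gamma> z v y)) + B z (X' v - \<Gamma> z v (X z)) y"])
      (use 1 Y lin in \<open>auto simp: nabla_def\<close>)
  then show ?thesis
    by (simp add: nabla_def bilinear_lsub[OF B(2)[OF z]] bilinear_rsub[OF B(2)[OF z]] algebra_simps)
qed

lemma nabla3_app:
  assumes z: "z \<in> U" and B: "nabla3 z B B'" "\<And>p x y. p \<in> U \<Longrightarrow> linear (\<lambda>u. B p u x y)"
      "\<And>p u. p \<in> U \<Longrightarrow> bilinear (B p u)"
    and W: "nabla z W (\<lambda>_. 0)" and X: "nabla z X (\<lambda>_. 0)" and Y: "nabla z Y (\<lambda>_. 0)"
  shows "nabla z (\<lambda>p. B p (W p) (X p) (Y p)) (\<lambda>v. B' v (W z) (X z) (Y z))"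
proof -
  have lin: "linear (\<lambda>x. B p u x y)" "linear (B p u x)" if "p \<in> U" for p u x y
    using B(3)[OF that] by (simp_all add: bilinear_def)
  have "((\<lambda>p. B p (W p) x y) has_derivative (\<lambda>v. (B' v (W z) x y - \<Gamma> z v (B z (W z) x y)
      + B z (\<Gamma> z v (W z)) x y + B z (W z) (\<Gamma> z v x) y + B z (W z) x (\<Gamma> z v y))
      + B z (0 - \<Gamma> z v (W z)) x y)) (at z)" for x y
    by (rule has_derivative_linear_field[OF open_U z, of "\<lambda>p u. B p u x y" "\<lambda>u v. B' v u x y - \<Gamma> z v (B z u x y)
      + B z (\<Gamma> z v u) x y + B z u (\<Gamma> z v x) y + B z u x (\<Gamma> z v y)"])
      (use B W in \<open>auto simp: nabla3_def nabla_def\<close>)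
  then have "nabla2 z (\<lambda>p. B p (W p)) (\<lambda>v. B' v (W z))"
    unfolding nabla2_def by (simp add: linear_neg[OF B(2)[OF z]] algebra_simps)
  from nabla2_app[OF z this _ X Y] B(3) show ?thesis
    by (simp add: linear_0[OF lin(1)[OF z]] linear_0[OF lin(2)[OF z]])
qed

lemma nabla_add: "z \<in> U \<Longrightarrow> nabla z X X' \<Longrightarrow> nabla z Y Y' \<Longrightarrow> nabla z (\<lambda>p. X p + Y p) (\<lambda>v. X' v + Y' v)"
  unfolding nabla_def by (drule has_derivative_add, assumption) (simp add: \<Gamma>_bil algebra_simps)

lemma nabla_diff: "z \<in> U \<Longrightarrow> nabla z X X' \<Longrightarrow> nabla z Y Y' \<Longrightarrow> nabla z (\<lambda>p. X p - Y p) (\<lambda>v. X' v - Y' v)"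
  unfolding nabla_def by (drule has_derivative_diff, assumption) (simp add: \<Gamma>_bil algebra_simps)

lemma nabla_scaleR: "z \<in> U \<Longrightarrow> nabla z X X' \<Longrightarrow> nabla z (\<lambda>p. r *\<^sub>R X p) (\<lambda>v. r *\<^sub>R X' v)"
  unfolding nabla_def by (drule has_derivative_scaleR_right[of _ _ _ r]) (simp add: \<Gamma>_bil algebra_simps)

lemma nabla_minus: "z \<in> U \<Longrightarrow> nabla z X X' \<Longrightarrow> nabla z (\<lambda>p. - X p) (\<lambda>v. - X' v)"
  using nabla_scaleR[of z X X' "-1"] by simp

lemma nabla_unique:
  assumes "z \<in> U" "nabla z X X'" "nabla z Y Y'" "\<And>p. p \<in> U \<Longrightarrow> X p = Y p"
  shows "X' v = Y' v"
proof -
  have "(Y has_derivative (\<lambda>v. X' v - \<Gamma> z v (X z))) (at z)"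
    using assms(2) unfolding nabla_def
    by (rule has_derivative_transform_within_open[OF _ open_U assms(1)]) (use assms(4) in auto)
  from has_derivative_unique[OF this assms(3)[unfolded nabla_def]]
  show ?thesis using assms(1,4) by (metis diff_add_cancel)
qed

text \<open>A test field with value \<open>x\<close> at \<open>z\<close> and zero covariant
  derivative at \<open>z\<close>. When tensors are evaluated on such fields, only the derivatives of
  the tensors survive at \<open>z\<close>.\<close>

definition flat where "flat z x = (\<lambda>p. x - \<Gamma> z (p - z) x)"

lemma flat: "z \<in> U \<Longrightarrow> nabla z (flat z x) (\<lambda>_. 0)" "z \<in> U \<Longrightarrow> flat z x z = x"
proof -
  assume z: "z \<in> U"
  have "bounded_linear (\<lambda>v. \<Gamma> z v x)" using linear_\<Gamma>(1)[OF z] by (rule linear_linear[THEN iffD2])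
  then have "((\<lambda>p. \<Gamma> z (p - z) x) has_derivative (\<lambda>v. \<Gamma> z (v - 0) x)) (at z)"
    by (rule bounded_linear.has_derivative) (auto intro!: derivative_eq_intros)
  from has_derivative_diff[OF has_derivative_const this]
  have "((\<lambda>p. x - \<Gamma> z (p - z) x) has_derivative (\<lambda>v. 0 - \<Gamma> z (v - 0) x)) (at z)" .
  then show "nabla z (flat z x) (\<lambda>_. 0)" by (simp add: nabla_def flat_def \<Gamma>_bil[OF z])
  show "flat z x z = x" by (simp add: flat_def \<Gamma>_bil[OF z])
qed

lemma nabla2_T: "z \<in> U \<Longrightarrow> nabla2 z T (K z)"
  unfolding nabla2_def T_def
  by (intro allI has_derivative_eq_rhs[OF has_derivative_diff[OF D D]])
    (auto simp: K_def D\<Gamma>_def \<Gamma>_bil algebra_simps)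

lemma nabla_g:
  assumes z: "z \<in> U" and "nabla z X X'" "nabla z Y Y'"
  shows "((\<lambda>p. g p (X p) (Y p)) has_derivative (\<lambda>v. g z (X' v) (Y z) + g z (X z) (Y' v))) (at z)"
proof -
  interpret hermitian_space "g z" using herm z .
  have lin: "linear (\<lambda>x. g p x y)" "linear (g p x)" if "p \<in> U" for p x y
    using hermitian_space.bilinear_g[OF herm[OF that]] by (simp_all add: bilinear_def)
  have g: "((\<lambda>p. g p x y) has_derivative (\<lambda>v. g z (\<Gamma> z v x) y + g z x (\<Gamma> z v y))) (at z)" for x y
    by (rule has_derivative_eq_rhs[OF smooth_on_has_derivative[OF g_smooth z]]) (simp add: fun_eq_iff g_parallel[OF z])
  have 1: "((\<lambda>p. g p (X p) y) has_derivative (\<lambda>v. (g z (\<Gamma> z v (X z)) y + g z (X z) (\<Gamma> z v y))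
      + g z (X' v - \<Gamma> z v (X z)) y)) (at z)" for y
    by (rule has_derivative_linear_field[OF open_U z, of "\<lambda>p x. g p x y" "\<lambda>x v. g z (\<Gamma> z v x) y + g z x (\<Gamma> z v y)"])
      (use g assms lin in \<open>auto simp: nabla_def\<close>)
  have "((\<lambda>p. g p (X p) (Y p)) has_derivative (\<lambda>v. ((g z (\<Gamma> z v (X z)) (Y z) + g z (X z) (\<Gamma> z v (Y z)))
      + g z (X' v - \<Gamma> z v (X z)) (Y z)) + g z (X z) (Y' v - \<Gamma> z v (Y z)))) (at z)"
    by (rule has_derivative_linear_field[OF open_U z, of "\<lambda>p. g p (X p)" "\<lambda>y v. (g z (\<Gamma> z v (X z)) y + g z (X z) (\<Gamma> z v y))
      + g z (X' v - \<Gamma> z v (X z)) y"])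
      (use 1 assms lin in \<open>auto simp: nabla_def\<close>)
  then show ?thesis by (simp add: g_bil algebra_simps)
qed

text \<open>The type condition comes from \<open>D\<Gamma>\<close> commuting with \<open>J\<close>;
  the alternation comes from differentiating that of the torsion on \<open>flat\<close> fields,
  \<open>g\<close> being parallel.\<close>

lemma K_form:
  assumes z: "z \<in> U"
  shows "skew_torsion_form (g z) (K z v)"
proof (intro skew_torsion_form.intro herm[OF z] skew_torsion_form_axioms.intro)
  have D\<Gamma>_bil: "bilinear (D\<Gamma> z v)"
    unfolding bilinear_def by (auto intro!: linearI simp: D\<Gamma>_def \<Gamma>_bil[OF z] D_lin[OF z] algebra_simps)
  show "bilinear (K z v)"
    using D\<Gamma>_bil unfolding bilinear_def K_def by (auto intro!: linear_compose_sub)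
  show "K z v x y = - K z v y x" for x y by (simp add: K_def)
  have D\<Gamma>_J: "D\<Gamma> z v x (J y) = J (D\<Gamma> z v x y)" for x y
    by (simp add: D\<Gamma>_def D_J[OF z] \<Gamma>_J[OF z])
  show "K z v (J x) (J y) = K z v x y + J (K z v (J x) y) + J (K z v x (J y))" for x y
    unfolding K_def by (rule type_of_skew_part[of "D\<Gamma> z v", OF D\<Gamma>_bil D\<Gamma>_J])
  fix x y w
  interpret hermitian_space "g z" using herm z .
  have bil: "bilinear (T p)" if "p \<in> U" for p
    using skew_torsion_form.bilinear_T[OF T_form[OF that]] .
  have T: "nabla z (\<lambda>p. T p (flat z x p) (flat z y p)) (\<lambda>v. K z v x y)" for x y
    using nabla2_app[OF z nabla2_T[OF z] bil flat(1)[OF z, of x] flat(1)[OF z, of y]]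
    by (simp add: flat(2)[OF z] bilinear_lzero[OF bil[OF z]] bilinear_rzero[OF bil[OF z]])
  have d: "((\<lambda>p. g p (T p (flat z x p) (flat z y p)) (flat z w p)) has_derivative (\<lambda>v. g z (K z v x y) w)) (at z)" for x y w
    using nabla_g[OF z T[of x y] flat(1)[OF z, of w]] by (simp add: flat(2)[OF z] g_bil)
  have "((\<lambda>p. - g p (T p (flat z x p) (flat z w p)) (flat z y p)) has_derivative (\<lambda>v. - g z (K z v x w) y)) (at z)"
    by (rule has_derivative_minus[OF d])
  then have "((\<lambda>p. g p (T p (flat z x p) (flat z y p)) (flat z w p)) has_derivative (\<lambda>v. - g z (K z v x w) y)) (at z)"
    by (rule has_derivative_transform_within_open[OF _ open_U z])
      (simp add: skew_torsion_form.T_alt[OF T_form, of _ _ "flat z w _"])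
  from has_derivative_unique[OF d this] show "g z (K z v x y) w = - g z (K z v x w) y" by (rule fun_cong)
qed

end

section \<open>Second covariant derivatives and the Ricci identity\<close>

context hermitian_chart
begin

lemma R_alt: "z \<in> U \<Longrightarrow> R z y x w = - R z x y w"
  by (simp add: R_def)

lemma R_lin:
  assumes "z \<in> U"
  shows "R z x y (u + v) = R z x y u + R z x y v" "R z x y (r *\<^sub>R u) = r *\<^sub>R R z x y u"
    "R z x y (J u) = J (R z x y u)" "R z x (- y) u = - R z x y u"
  by (simp_all add: R_def \<Gamma>_bil[OF assms] D_lin[OF assms] D_J[OF assms] \<Gamma>_J[OF assms] algebra_simps)

lemma first_bianchi:
  assumes "z \<in> U"
  shows "K z u x y + K z x y u + K z y u x + T z (T z u x) y + T z (T z x y) u + T z (T z y u) x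
    = R z u x y + R z x y u + R z y u x"
  by (simp add: K_def D\<Gamma>_def T_def R_def \<Gamma>_bil[OF assms])

text \<open>The coordinate derivative of \<open>D\<Gamma>\<close> along \<open>v\<close>.
  \<open>DD\<Gamma>\<close> adds the Christoffel corrections and is thus the second covariant
  derivative of \<open>\<Gamma>\<close> treated as a tensor.\<close>

definition D2\<Gamma> where "D2\<Gamma> z v u x y = D2 z v u x y + D z v u (\<Gamma> z x y) + \<Gamma> z u (D z v x y)
  - D z v (\<Gamma> z u x) y - \<Gamma> z (D z v u x) y - D z v x (\<Gamma> z u y) - \<Gamma> z x (D z v u y)"

definition DD\<Gamma> where "DD\<Gamma> z v u x y = D2\<Gamma> z v u x y + \<Gamma> z v (D\<Gamma> z u x y) - D\<Gamma> z (\<Gamma> z v u) x y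
  - D\<Gamma> z u (\<Gamma> z v x) y - D\<Gamma> z u x (\<Gamma> z v y)"

definition K2 where "K2 z v u x y = DD\<Gamma> z v u x y - DD\<Gamma> z v u y x"

lemma nabla3_K:
  assumes z: "z \<in> U"
  shows "nabla3 z K (K2 z)"
proof -
  have 1: "((\<lambda>p. \<Gamma> p u (\<Gamma> p x y)) has_derivative (\<lambda>v. D z v u (\<Gamma> z x y) + \<Gamma> z u (D z v x y))) (at z)" for u x y
    by (rule has_derivative_linear_field[OF open_U z, of "\<lambda>p a. \<Gamma> p u a" "\<lambda>a v. D z v u a"])
      (use linear_\<Gamma>(2) D z in auto)
  have 2: "((\<lambda>p. \<Gamma> p (\<Gamma> p u x) y) has_derivative (\<lambda>v. D z v (\<Gamma> z u x) y + \<Gamma> z (D z v u x) y)) (at z)" for u x y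
    by (rule has_derivative_linear_field[OF open_U z, of "\<lambda>p a. \<Gamma> p a y" "\<lambda>a v. D z v a y"])
      (use linear_\<Gamma>(1) D z in auto)
  have 3: "((\<lambda>p. D\<Gamma> p u x y) has_derivative (\<lambda>v. D2\<Gamma> z v u x y)) (at z)" for u x y
    unfolding D\<Gamma>_def D2\<Gamma>_def
    by (rule has_derivative_eq_rhs[OF has_derivative_diff[OF has_derivative_diff[OF
          has_derivative_add[OF D2[OF z, of u x y] 1[of u x y]] 2[of u x y]] 1[of x u y]]])
      (simp add: fun_eq_iff)
  show ?thesis
    unfolding nabla3_def K_def
    by (intro allI has_derivative_eq_rhs[OF has_derivative_diff[OF 3 3]])
      (simp add: fun_eq_iff K2_def DD\<Gamma>_def \<Gamma>_bil[OF z])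
qed

text \<open>The identity is formal once second derivatives are symmetric, so it can be stated for
  \<open>\<Gamma>\<close> itself; skewing it in \<open>x, y\<close> yields the one for the
  torsion.\<close>

lemma ricci_identity_\<Gamma>:
  assumes z: "z \<in> U"
  shows "DD\<Gamma> z v u x y - DD\<Gamma> z u v x y + D\<Gamma> z (T z v u) x y =
    R z v u (\<Gamma> z x y) - \<Gamma> z (R z v u x) y - \<Gamma> z x (R z v u y)"
  unfolding DD\<Gamma>_def D2\<Gamma>_def D\<Gamma>_def T_def R_def
  by (simp add: \<Gamma>_bil[OF z] D_lin[OF z] D2_sym[OF z, of v u])

lemma ricci_identity_T:
  assumes z: "z \<in> U"
  shows "K2 z v u x y - K2 z u v x y + K z (T z v u) x y =
    R z v u (T z x y) - T z (R z v u x) y - T z x (R z v u y)"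
proof -
  have "R z v u (a - b) = R z v u a - R z v u b" for a b
    using R_lin(1)[OF z, of v u "a - b" b] by (simp add: algebra_simps)
  moreover have "K2 z v u x y - K2 z u v x y + K z (T z v u) x y
      = (DD\<Gamma> z v u x y - DD\<Gamma> z u v x y + D\<Gamma> z (T z v u) x y)
      - (DD\<Gamma> z v u y x - DD\<Gamma> z u v y x + D\<Gamma> z (T z v u) y x)"
    by (simp add: K2_def K_def)
  ultimately show ?thesis
    unfolding ricci_identity_\<Gamma>[OF z] by (simp add: T_def)
qed

text \<open>\<open>g_parallel\<close> is differentiated once more; in the symmetry of the second
  derivatives of the metric the products of two first-order terms cancel and the curvature
  remains.\<close>

lemma R_skew_adjoint:
  assumes z: "z \<in> U"
  shows "g z (R z v u x) y = - g z x (R z v u y)"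
proof -
  interpret hermitian_space "g z" using herm z .
  have const: "nabla z (\<lambda>_. y) (\<lambda>v. \<Gamma> z v y)" for y
    by (simp add: nabla_def)
  have \<Gamma>: "nabla z (\<lambda>p. \<Gamma> p u x) (\<lambda>v. D z v u x + \<Gamma> z v (\<Gamma> z u x))" for u x
    using D[OF z] by (simp add: nabla_def)
  have "((\<lambda>p. frechet_derivative (\<lambda>p. g p x y) (at p) u) has_derivative
      (\<lambda>v. (g z (D z v u x + \<Gamma> z v (\<Gamma> z u x)) y + g z (\<Gamma> z u x) (\<Gamma> z v y))
         + (g z (\<Gamma> z v x) (\<Gamma> z u y) + g z x (D z v u y + \<Gamma> z v (\<Gamma> z u y))))) (at z)" for u
    by (rule has_derivative_transform_within_open[OF has_derivative_add[OF nabla_g[OF z \<Gamma> const] nabla_g[OF z const \<Gamma>]] open_U z])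
      (simp add: g_parallel)
  from frechet_derivative_at[OF this]
  have "frechet_derivative (\<lambda>p. frechet_derivative (\<lambda>p. g p x y) (at p) u) (at z) v
    = (g z (D z v u x + \<Gamma> z v (\<Gamma> z u x)) y + g z (\<Gamma> z u x) (\<Gamma> z v y))
         + (g z (\<Gamma> z v x) (\<Gamma> z u y) + g z x (D z v u y + \<Gamma> z v (\<Gamma> z u y)))" for u v
    by (rule fun_cong[OF sym])
  from this[of u v] this[of v u] show ?thesis
    using second_derivative_symmetric[OF open_U z g_smooth, of x y u v]
    by (simp add: R_def g_bil)
qed

abbreviation \<tau> where "\<tau> p \<equiv> skew_torsion_form.\<tau> (T p)"
abbreviation \<delta> where "\<delta> p \<equiv> skew_torsion_form.\<delta> (T p)"

text \<open>\<open>J\<close> is parallel, so the projections onto types commute with covariant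
  differentiation.\<close>

lemma nabla2_\<tau>:
  assumes z: "z \<in> U"
  shows "nabla2 z \<tau> (\<lambda>v. skew_torsion_form.\<tau> (K z v))" "nabla2 z \<delta> (\<lambda>v. skew_torsion_form.\<delta> (K z v))"
proof -
  note defs = skew_torsion_form.\<tau>_def[OF T_form] skew_torsion_form.\<tau>_def[OF K_form[OF z]]
     skew_torsion_form.\<delta>_def[OF T_form] skew_torsion_form.\<delta>_def[OF K_form[OF z]]
  have T: "((\<lambda>p. T p x y) has_derivative
     (\<lambda>v. K z v x y - \<Gamma> z v (T z x y) + T z (\<Gamma> z v x) y + T z x (\<Gamma> z v y))) (at z)" for x y
    using nabla2_T[OF z] by (simp add: nabla2_def)
  have J: "((\<lambda>p. J (A p)) has_derivative (\<lambda>v. J (A' v))) (at z)" if "(A has_derivative A') (at z)" for A A' :: "complex ^ 'n \<Rightarrow> complex ^ 'n"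
    using that linear_J by (intro bounded_linear.has_derivative[of J]) (auto simp: linear_linear)
  show "nabla2 z \<tau> (\<lambda>v. skew_torsion_form.\<tau> (K z v))"
    unfolding nabla2_def
  proof (intro allI)
    fix x y
    show "((\<lambda>p. \<tau> p x y) has_derivative (\<lambda>v. skew_torsion_form.\<tau> (K z v) x y - \<Gamma> z v (\<tau> z x y)
       + \<tau> z (\<Gamma> z v x) y + \<tau> z x (\<Gamma> z v y))) (at z)"
      by (rule has_derivative_transform_within_open[OF has_derivative_eq_rhs[OF
            has_derivative_scaleR_right[OF has_derivative_diff[OF T[of x y] T[of "J x" "J y"]], of "1/2"]] open_U z])
        (simp_all add: defs fun_eq_iff z \<Gamma>_bil[OF z] \<Gamma>_J[OF z] algebra_simps)
  qed
  show "nabla2 z \<delta> (\<lambda>v. skew_torsion_form.\<delta> (K z v))"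
    unfolding nabla2_def
  proof (intro allI)
    fix x y
    show "((\<lambda>p. \<delta> p x y) has_derivative (\<lambda>v. skew_torsion_form.\<delta> (K z v) x y - \<Gamma> z v (\<delta> z x y)
       + \<delta> z (\<Gamma> z v x) y + \<delta> z x (\<Gamma> z v y))) (at z)"
      by (rule has_derivative_transform_within_open[OF has_derivative_eq_rhs[OF
            has_derivative_scaleR_right[OF has_derivative_add[OF T[of x y] J[OF T[of x "J y"]]], of "1/2"]] open_U z])
        (simp_all add: defs fun_eq_iff z \<Gamma>_bil[OF z] \<Gamma>_J[OF z] algebra_simps)
  qed
qed

abbreviation N where "N p u \<equiv> skew_torsion_form.\<tau> (K p u)"

definition N2 where "N2 z v u x y = (1/2) *\<^sub>R (K2 z v u x y - K2 z v u (J x) (J y))"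

lemma nabla3_N:
  assumes z: "z \<in> U"
  shows "nabla3 z N (N2 z)"
  unfolding nabla3_def
proof (intro allI)
  fix u x y
  note defs = skew_torsion_form.\<tau>_def[OF K_form]
  have K: "((\<lambda>p. K p u x y) has_derivative (\<lambda>v. K2 z v u x y - \<Gamma> z v (K z u x y) + K z (\<Gamma> z v u) x y
     + K z u (\<Gamma> z v x) y + K z u x (\<Gamma> z v y))) (at z)" for u x y
    using nabla3_K[OF z] by (simp add: nabla3_def)
  show "((\<lambda>p. N p u x y) has_derivative (\<lambda>v. N2 z v u x y - \<Gamma> z v (N z u x y) + N z (\<Gamma> z v u) x y
     + N z u (\<Gamma> z v x) y + N z u x (\<Gamma> z v y))) (at z)"
    by (rule has_derivative_transform_within_open[OF has_derivative_eq_rhs[OF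
          has_derivative_scaleR_right[OF has_derivative_diff[OF K[of u x y] K[of u "J x" "J y"]], of "1/2"]] open_U z])
      (simp_all add: defs N2_def fun_eq_iff z \<Gamma>_bil[OF z] \<Gamma>_J[OF z] algebra_simps)
qed

end

section \<open>Verification of the pointwise hypotheses in a chart\<close>

locale skl_chart = hermitian_chart U g \<Gamma>
  for U :: "(complex ^ 'n::finite) set" and g \<Gamma> +
  assumes R_cyclic: "z \<in> U \<Longrightarrow> R z x y u + R z y u x + R z u x y = 0"
    and R_J: "z \<in> U \<Longrightarrow> R z (J x) (J y) = R z x y"
    and R_ricci: "\<lbrakk>z \<in> U; \<And>i j. hermitian_space.h (g z) (e i) (e j) = (if i = j then 1 else 0)\<rbrakk>
      \<Longrightarrow> (\<Sum>i\<in>(UNIV :: 'n set). hermitian_space.h (g z) (R z x y (e i)) (e i)) = 0"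
    and dim_le_3: "CARD('n) \<le> 3"
begin

lemma torsion_jet:
  assumes z: "z \<in> U"
  shows "torsion_jet (g z) (T z) (K z)"
proof (intro torsion_jet.intro T_form[OF z] torsion_jet_axioms.intro K_form[OF z])
  show "K z u x y + K z x y u + K z y u x + T z (T z u x) y + T z (T z x y) u + T z (T z y u) x = 0" for u x y
    unfolding first_bianchi[OF z] by (rule R_cyclic[OF z])
qed

lemma nabla_\<tau>:
  assumes z: "z \<in> U" and "nabla z X X'" "nabla z Y Y'"
  shows "nabla z (\<lambda>p. \<tau> p (X p) (Y p)) (\<lambda>v. N z v (X z) (Y z) + \<tau> z (X' v) (Y z) + \<tau> z (X z) (Y' v))"
    "nabla z (\<lambda>p. \<delta> p (X p) (Y p)) (\<lambda>v. skew_torsion_form.\<delta> (K z v) (X z) (Y z) + \<delta> z (X' v) (Y z) + \<delta> z (X z) (Y' v))"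
proof -
  have "bilinear (\<tau> p)" "bilinear (\<delta> p)" if "p \<in> U" for p
    unfolding bilinear_def
    by (auto intro!: linearI simp: skew_torsion_form.\<tau>_bil[OF T_form[OF that]] skew_torsion_form.\<delta>_bil[OF T_form[OF that]])
  then show "nabla z (\<lambda>p. \<tau> p (X p) (Y p)) (\<lambda>v. N z v (X z) (Y z) + \<tau> z (X' v) (Y z) + \<tau> z (X z) (Y' v))"
    "nabla z (\<lambda>p. \<delta> p (X p) (Y p)) (\<lambda>v. skew_torsion_form.\<delta> (K z v) (X z) (Y z) + \<delta> z (X' v) (Y z) + \<delta> z (X z) (Y' v))"
    using nabla2_app[OF z nabla2_\<tau>(1)[OF z] _ assms(2,3)] nabla2_app[OF z nabla2_\<tau>(2)[OF z] _ assms(2,3)] by auto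
qed

text \<open>Both sides of \<open>N_eq\<close> are evaluated on fields flat at \<open>z\<close> and
  differentiated; the nesting of the rules in \<open>rhs\<close> mirrors the term.\<close>

lemma N2_eq:
  assumes z: "z \<in> U"
  shows "3 *\<^sub>R N2 z v u x y = - (N z v (\<delta> z y u) x + \<tau> z (skew_torsion_form.\<delta> (K z v) y u) x
      - N z v (\<delta> z x u) y - \<tau> z (skew_torsion_form.\<delta> (K z v) x u) y
      + skew_torsion_form.\<delta> (K z v) (\<tau> z x y) u + \<delta> z (N z v x y) u
      + skew_torsion_form.\<delta> (K z v) x (\<delta> z u y) + \<delta> z x (skew_torsion_form.\<delta> (K z v) u y)
      - skew_torsion_form.\<delta> (K z v) y (\<delta> z u x) - \<delta> z y (skew_torsion_form.\<delta> (K z v) u x))"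
proof -
  interpret P: torsion_jet "g z" "T z" "K z" by (rule torsion_jet[OF z])
  note t = nabla_\<tau>(1)[OF z] and d = nabla_\<tau>(2)[OF z]
  note fu = flat(1)[OF z, of u] and fx = flat(1)[OF z, of x] and fy = flat(1)[OF z, of y]
  have lin: "linear (\<lambda>u. N p u x y)" "bilinear (N p u)" if "p \<in> U" for p u x y
    unfolding bilinear_def
    by (auto intro!: linearI simp: torsion_jet.N_bil1[OF torsion_jet[OF that]] skew_torsion_form.\<tau>_bil[OF K_form[OF that]])
  note lhs = nabla_scaleR[OF z nabla3_app[OF z nabla3_N[OF z] lin fu fx fy], of 3]
  note rhs = nabla_minus[OF z nabla_diff[OF z nabla_add[OF z nabla_add[OF z nabla_diff[OF z
      t[OF d[OF fy fu] fx] t[OF d[OF fx fu] fy]] d[OF t[OF fx fy] fu]] d[OF fx d[OF fu fy]]] d[OF fy d[OF fu fx]]]]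
  show ?thesis
    using nabla_unique[OF z lhs rhs torsion_jet.N_eq[OF torsion_jet], of v]
    by (simp add: flat(2)[OF z] P.\<tau>_bil P.\<delta>_bil algebra_simps)
qed

lemma jacobi_deriv:
  assumes z: "z \<in> U"
  shows "N z v (\<tau> z x y) w + \<tau> z (N z v x y) w + N z v (\<tau> z y w) x + \<tau> z (N z v y w) x
      + N z v (\<tau> z w x) y + \<tau> z (N z v w x) y = 0"
proof -
  interpret P: torsion_jet "g z" "T z" "K z" by (rule torsion_jet[OF z])
  note t = nabla_\<tau>(1)[OF z]
  note fw = flat(1)[OF z, of w] and fx = flat(1)[OF z, of x] and fy = flat(1)[OF z, of y]
  note lhs = nabla_add[OF z nabla_add[OF z t[OF t[OF fx fy] fw] t[OF t[OF fy fw] fx]] t[OF t[OF fw fx] fy]]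
  have "nabla z (\<lambda>_. 0) (\<lambda>_. 0)" by (simp add: nabla_def \<Gamma>_bil[OF z])
  from nabla_unique[OF z lhs this torsion_jet.jacobi[OF torsion_jet], of v] show ?thesis
    by (simp add: flat(2)[OF z] P.\<tau>_bil add.assoc)
qed

lemma ricci_identity_\<tau>:
  assumes z: "z \<in> U"
  shows "N2 z v u x y - N2 z u v x y + N z (T z v u) x y =
    R z v u (\<tau> z x y) - \<tau> z (R z v u x) y - \<tau> z x (R z v u y)"
proof -
  have R_diff: "R z v u (a - b) = R z v u a - R z v u b" for a b
    using R_lin(1)[OF z, of v u "a - b" b] by (simp add: algebra_simps)
  have eq: "N2 z v u x y - N2 z u v x y + N z (T z v u) x y =
      (1/2) *\<^sub>R ((K2 z v u x y - K2 z u v x y + K z (T z v u) x y)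
        - (K2 z v u (J x) (J y) - K2 z u v (J x) (J y) + K z (T z v u) (J x) (J y)))"
    by (simp add: N2_def skew_torsion_form.\<tau>_def[OF K_form[OF z]] algebra_simps)
  show ?thesis
    unfolding eq ricci_identity_T[OF z]
    by (simp add: skew_torsion_form.\<tau>_def[OF T_form[OF z]] R_lin[OF z] R_diff algebra_simps)
qed

lemma point:
  assumes z: "z \<in> U"
  shows "skl_ricci_flat_point (g z) (T z) (K z) (N2 z) (R z)"
proof -
  interpret hermitian_space "g z" using herm[OF z] .
  show ?thesis
    by (intro skl_ricci_flat_point.intro skl_point.intro torsion_jet[OF z] skl_point_axioms.intro
        skl_ricci_flat_point_axioms.intro N2_eq[OF z] jacobi_deriv[OF z] ricci_identity_\<tau>[OF z] R_J[OF z]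
        R_lin[OF z] R_alt[OF z] R_skew_adjoint[OF z] R_cyclic[OF z] dim_le_3)
      (simp add: tr_def R_ricci[OF z])
qed

theorem R_eq_0: "z \<in> U \<Longrightarrow> T z x\<^sub>0 y\<^sub>0 \<noteq> 0 \<Longrightarrow> R z x y u = 0"
  by (rule skl_ricci_flat_point.R_eq_0[OF point])

end

section \<open>The zero set of the torsion\<close>

lemma bilinear_norm_le_Basis:
  fixes B :: "'a::euclidean_space \<Rightarrow> 'b::euclidean_space \<Rightarrow> 'c::real_normed_vector"
  assumes "bilinear B"
  shows "norm (B x y) \<le> norm x * norm y * (\<Sum>a\<in>Basis. \<Sum>b\<in>Basis. norm (B a b))"
proof -
  have "B x y = B (\<Sum>a\<in>Basis. (x \<bullet> a) *\<^sub>R a) (\<Sum>b\<in>Basis. (y \<bullet> b) *\<^sub>R b)"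
    by (simp add: euclidean_representation)
  also have "\<dots> = (\<Sum>(a, b)\<in>Basis \<times> Basis. B ((x \<bullet> a) *\<^sub>R a) ((y \<bullet> b) *\<^sub>R b))"
    by (rule bilinear_sum[OF assms])
  also have "\<dots> = (\<Sum>a\<in>Basis. \<Sum>b\<in>Basis. ((x \<bullet> a) * (y \<bullet> b)) *\<^sub>R B a b)"
    by (simp add: sum.cartesian_product bilinear_lmul[OF assms] bilinear_rmul[OF assms] mult.commute)
  also have "norm \<dots> \<le> (\<Sum>a\<in>Basis. \<Sum>b\<in>Basis. norm (((x \<bullet> a) * (y \<bullet> b)) *\<^sub>R B a b))"
    by (intro order.trans[OF norm_sum] sum_mono order.refl)
  also have "\<dots> \<le> (\<Sum>a\<in>Basis. \<Sum>b\<in>Basis. norm x * norm y * norm (B a b))"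
    by (intro sum_mono) (auto simp: abs_mult intro!: mult_right_mono mult_mono Basis_le_norm)
  finally show ?thesis by (simp add: sum_distrib_left)
qed

context skl_chart
begin

lemma T_bilinear: "z \<in> U \<Longrightarrow> bilinear (T z)"
  using skew_torsion_form.bilinear_T[OF T_form] .

text \<open>By \<open>K_eq\<close>, \<open>3 K\<close> is a sum of three products of torsions, each
  with the same bound.\<close>

lemma K_bound:
  assumes z: "z \<in> U" and b: "\<And>x y. norm (T z x y) \<le> norm x * norm y * f"
  shows "norm (K z u x y) \<le> norm u * norm x * norm y * f * f"
proof -
  interpret P: torsion_jet "g z" "T z" "K z" by (rule torsion_jet[OF z])
  have f: "f \<ge> 0"
  proof -
    obtain a :: "complex ^ 'n" where "norm a = 1" using vector_choose_size zero_le_one by blast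
    then show ?thesis using order_trans[OF norm_ge_zero b[of a a]] by simp
  qed
  have TT: "norm (T z (T z u x) y) \<le> norm u * norm x * norm y * f * f" for u x y
  proof -
    have "norm (T z (T z u x) y) \<le> norm (T z u x) * (norm y * f)" using b[of "T z u x" y] by (simp add: mult.assoc)
    also have "\<dots> \<le> (norm u * norm x * f) * (norm y * f)" using b f by (intro mult_right_mono) auto
    finally show ?thesis by (simp add: algebra_simps)
  qed
  have "3 * norm (K z u x y) = norm (3 *\<^sub>R K z u x y)" by simp
  also have "\<dots> = norm (T z (T z u x) y + T z (T z x y) u + T z (T z y u) x)"
    unfolding P.K_eq P.Z_def by (rule norm_minus_cancel)
  also have "\<dots> \<le> norm (T z (T z u x) y) + norm (T z (T z x y) u) + norm (T z (T z y u) x)"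
    by (intro norm_triangle_mono order.refl)
  also have "\<dots> \<le> 3 * (norm u * norm x * norm y * f * f)"
    using TT[of u x y] TT[of x y u] TT[of y u x] by (simp add: algebra_simps)
  finally show ?thesis by simp
qed

text \<open>The torsion satisfies a first order linear differential inequality, so its zero set is open.\<close>

lemma T_locally_zero:
  assumes z0: "z\<^sub>0 \<in> U" and T0: "\<And>x y. T z\<^sub>0 x y = 0"
  obtains r where "r > 0" "ball z\<^sub>0 r \<subseteq> U" "\<And>z x y. z \<in> ball z\<^sub>0 r \<Longrightarrow> T z x y = 0"
proof -
  define f where "f z = (\<Sum>a\<in>Basis. \<Sum>b\<in>Basis. norm (T z a b))" for z
  define c where "c z = (\<Sum>a\<in>Basis. \<Sum>b\<in>Basis. norm (\<Gamma> z a b))" for z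
  have cont: "continuous_on U (\<lambda>z. \<Gamma> z a b)" for a b
    by (rule smooth_on_continuous[OF \<Gamma>_smooth])
  have cont_f: "continuous_on U f" and cont_c: "continuous_on U c"
    unfolding f_def c_def T_def by (intro continuous_intros cont)+
  have f_nonneg: "f z \<ge> 0" for z unfolding f_def by (intro sum_nonneg) auto
  have Tf: "norm (T z x y) \<le> norm x * norm y * f z" if "z \<in> U" for z x y
    unfolding f_def using bilinear_norm_le_Basis[OF T_bilinear[OF that]] .
  have \<Gamma>c: "norm (\<Gamma> z x y) \<le> norm x * norm y * c z" if "z \<in> U" for z x y
    unfolding c_def using bilinear_norm_le_Basis[OF \<Gamma>_bilinear[OF that]] .
  obtain r0 where r0: "r0 > 0" "cball z\<^sub>0 r0 \<subseteq> U"
    using open_U z0 open_contains_cball by blast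
  have "compact (f ` cball z\<^sub>0 r0)" "compact (c ` cball z\<^sub>0 r0)"
    using r0 cont_f cont_c by (auto intro!: compact_continuous_image intro: continuous_on_subset)
  from this[THEN compact_imp_bounded] obtain C1 C2
    where "\<And>z. z \<in> cball z\<^sub>0 r0 \<Longrightarrow> norm (f z) \<le> C1" "\<And>z. z \<in> cball z\<^sub>0 r0 \<Longrightarrow> norm (c z) \<le> C2"
    unfolding bounded_iff by blast
  then have C: "f z \<le> max 0 (max C1 C2)" "c z \<le> max 0 (max C1 C2)" if "z \<in> cball z\<^sub>0 r0" for z
    using that by fastforce+
  define C where "C = max 0 (max C1 C2)"
  define m where "m = real DIM(complex ^ 'n) * real DIM(complex ^ 'n)"
  \<comment> \<open>The choice ensures \<open>4 * C * m * r \<le> 1 / 2\<close>. Here 4 counts the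
    terms of \<open>T'\<close>, \<open>m\<close> the pairs of basis vectors summed in
    \<open>f\<close>, and \<open>C\<close> bounds \<open>f\<close> and \<open>c\<close> on the
    larger ball.\<close>
  define r where "r = min r0 (1 / (8 * C * m + 1))"
  have nn: "C \<ge> 0" "m \<ge> 0" by (simp_all add: C_def m_def)
  then have rpos: "r > 0" using r0 by (simp add: r_def add_nonneg_pos)
  have sub: "cball z\<^sub>0 r \<subseteq> cball z\<^sub>0 r0" by (auto simp: r_def)
  \<comment> \<open>At a maximum of \<open>f\<close>, the mean value inequality from the zero at
    \<open>z\<^sub>0\<close> will give \<open>f zm \<le> f zm / 2\<close>.\<close>
  have "\<exists>z\<in>cball z\<^sub>0 r. \<forall>y\<in>cball z\<^sub>0 r. f y \<le> f z"
    using rpos sub r0 cont_f by (intro continuous_attains_sup) (auto intro: continuous_on_subset)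
  then obtain zm where zm: "zm \<in> cball z\<^sub>0 r" "\<And>y. y \<in> cball z\<^sub>0 r \<Longrightarrow> f y \<le> f zm" by blast
  have bound: "norm (T zm a b) \<le> 4 * C * f zm * r" if ab: "a \<in> Basis" "b \<in> Basis" for a b
  proof -
    define T' where "T' z v = K z v a b - \<Gamma> z v (T z a b) + T z (\<Gamma> z v a) b + T z a (\<Gamma> z v b)" for z v
    have n1: "norm a = 1" "norm b = 1" using ab by auto
    have T': "((\<lambda>p. T p a b) has_derivative T' z) (at z within cball z\<^sub>0 r)" if "z \<in> cball z\<^sub>0 r" for z
    proof (rule has_derivative_at_withinI)
      have "z \<in> U" using that sub r0 by blast
      then show "((\<lambda>p. T p a b) has_derivative T' z) (at z)"
        using nabla2_T[of z] by (simp add: nabla2_def T'_def[abs_def])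
    qed
    have "onorm (T' z) \<le> 4 * C * f zm" if z: "z \<in> cball z\<^sub>0 r" for z
    proof (rule onorm_bound)
      have zU: "z \<in> U" and fz: "f z \<le> C" "c z \<le> C" "f z \<le> f zm"
        using z sub r0 C zm by (auto simp: C_def)
      show "0 \<le> 4 * C * f zm" using nn f_nonneg by simp
      fix v
      have "norm (K z v a b) \<le> norm v * (f z * f z)"
        using K_bound[OF zU Tf[OF zU], of v a b] by (simp add: n1 mult.assoc)
      \<comment> \<open>Bounding one of the two factors by \<open>C\<close> makes the quadratic
        estimate linear in the maximum of \<open>f\<close>.\<close>
      also have "\<dots> \<le> norm v * (C * f zm)"
        using fz f_nonneg nn by (intro mult_left_mono mult_mono) auto
      finally have 1: "norm (K z v a b) \<le> norm v * (C * f zm)" .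
      have "norm (\<Gamma> z v (T z a b)) \<le> norm v * norm (T z a b) * c z" by (rule \<Gamma>c[OF zU])
      also have "\<dots> \<le> norm v * norm (T z a b) * C" using fz by (intro mult_left_mono) auto
      also have "\<dots> \<le> norm v * f zm * C"
        using Tf[OF zU, of a b] fz nn by (intro mult_left_mono mult_right_mono) (auto simp: n1)
      finally have 2: "norm (\<Gamma> z v (T z a b)) \<le> norm v * (C * f zm)" by (simp add: mult_ac)
      have G: "norm (\<Gamma> z v x) * f z \<le> norm v * (C * f zm)" if "norm x = 1" for x
      proof -
        have "norm (\<Gamma> z v x) \<le> norm v * C"
          using \<Gamma>c[OF zU, of v x] mult_left_mono[OF fz(2), of "norm v"] that by simp
        then have "norm (\<Gamma> z v x) * f z \<le> (norm v * C) * f zm"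
          using fz f_nonneg nn by (intro mult_mono) auto
        then show ?thesis by (simp add: mult.assoc)
      qed
      have 3: "norm (T z (\<Gamma> z v a) b) \<le> norm v * (C * f zm)"
        using Tf[OF zU, of "\<Gamma> z v a" b] G[OF n1(1)] by (simp add: n1)
      have 4: "norm (T z a (\<Gamma> z v b)) \<le> norm v * (C * f zm)"
        using Tf[OF zU, of a "\<Gamma> z v b"] G[OF n1(2)] by (simp add: n1)
      have "norm (T' z v) \<le> norm (K z v a b) + norm (\<Gamma> z v (T z a b)) + norm (T z (\<Gamma> z v a) b) + norm (T z a (\<Gamma> z v b))"
        unfolding T'_def by (intro norm_triangle_mono norm_triangle_ineq4 order.refl)
      also have "\<dots> \<le> 4 * C * f zm * norm v" using 1 2 3 4 by (simp add: algebra_simps)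
      finally show "norm (T' z v) \<le> 4 * C * f zm * norm v" .
    qed
    from differentiable_bound[OF convex_cball T' this zm(1), of z\<^sub>0]
    have "norm (T zm a b - T z\<^sub>0 a b) \<le> 4 * C * f zm * norm (zm - z\<^sub>0)" using rpos by simp
    also have "\<dots> \<le> 4 * C * f zm * r"
      using zm(1) nn f_nonneg by (intro mult_left_mono) (auto simp: dist_norm norm_minus_commute)
    finally show ?thesis by (simp add: T0)
  qed
  have "f zm \<le> (\<Sum>a\<in>(Basis :: (complex ^ 'n) set). \<Sum>b\<in>(Basis :: (complex ^ 'n) set). 4 * C * f zm * r)"
    unfolding f_def[of zm] by (intro sum_mono) (use bound in \<open>simp add: f_def\<close>)
  also have "\<dots> = f zm * (4 * C * m * r)" by (simp add: m_def algebra_simps)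
  also have "\<dots> \<le> f zm * (1 / 2)"
  proof (intro mult_left_mono f_nonneg)
    have "4 * C * m * r \<le> 4 * C * m * (1 / (8 * C * m + 1))"
      using nn by (intro mult_left_mono) (auto simp: r_def)
    also have "\<dots> \<le> 1 / 2"
    proof -
      have "8 * C * m + 1 > 0" using nn by (simp add: add_nonneg_pos)
      then show ?thesis by (simp add: pos_divide_le_eq)
    qed
    finally show "4 * C * m * r \<le> 1 / 2" .
  qed
  finally have "f zm = 0" using f_nonneg[of zm] by simp
  then have f0: "f z = 0" if "z \<in> cball z\<^sub>0 r" for z
    using zm(2)[OF that] f_nonneg[of z] by simp
  show thesis
  proof (rule that[OF rpos])
    show "ball z\<^sub>0 r \<subseteq> U" using sub r0 ball_subset_cball by blast
    fix z x y assume z: "z \<in> ball z\<^sub>0 r"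
    then have "z \<in> U" "z \<in> cball z\<^sub>0 r" using sub r0 ball_subset_cball by blast+
    then show "T z x y = 0" using Tf[of z x y] f0 by simp
  qed
qed

end

section \<open>Change of charts and passage between manifold and charts\<close>

lemma open_overlap:
  assumes "chart_on M c" "openin M (fst d)"
  shows "open (overlap c d)"
proof -
  have hom: "homeomorphic_map (subtopology M (fst c)) (subtopology euclidean (chart_image c)) (snd c)"
    and op: "open (chart_image c)"
    using assms by (auto simp: chart_on_def)
  have "openin (subtopology M (fst c)) (fst c \<inter> fst d)"
    using assms(2) by (metis Int_commute openin_subtopology)
  then have "openin (subtopology euclidean (chart_image c)) (overlap c d)"
    using hom unfolding overlap_def homeomorphic_eq_everything_map open_map_def by blast
  then show ?thesis using op by (metis openin_open_trans)
qed

lemma transition_chart: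
  assumes "chart_on M c" "openin M (fst d)" "p \<in> fst c" "p \<in> fst d"
  shows "transition c d (snd c p) = snd d p"
proof -
  have "inj_on (snd c) (topspace (subtopology M (fst c)))" "fst c \<subseteq> topspace M"
    using assms by (auto simp: chart_on_def homeomorphic_eq_everything_map dest: openin_subset)
  then have "inj_on (snd c) (fst c)" by (simp add: Int_absorb1)
  then show ?thesis using assms by (simp add: transition_def)
qed

lemma transition_second_derivative_symmetric:
  assumes "complex_manifold M \<A>" "c \<in> \<A>" "d \<in> \<A>" "z \<in> overlap c d"
  shows "frechet_derivative (\<lambda>p. frechet_derivative (transition c d) (at p) u) (at z) v
    = frechet_derivative (\<lambda>p. frechet_derivative (transition c d) (at p) v) (at z) u"
proof (rule second_derivative_symmetric[OF _ assms(4)])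
  show "open (overlap c d)" using assms open_overlap by (metis chart_on_def complex_manifold_def)
  show "smooth_on (overlap c d) (transition c d)"
    using assms by (simp add: complex_manifold_def holomorphic_map_on_def)
qed

text \<open>The inhomogeneous term of the transformation law is a symmetric second derivative, so
  the torsion transforms as a tensor. The differential of the transition is injective because it
  preserves \<open>g\<close>.\<close>

lemma symmetric_christoffel_transition:
  assumes M: "complex_manifold M \<A>" and g: "hermitian_metric \<A> g" and \<Gamma>: "connection \<A> \<Gamma>"
    and c: "c \<in> \<A>" "p \<in> fst c" and d: "d \<in> \<A>" "p \<in> fst d"
    and sym: "\<And>x y. \<Gamma> d (snd d p) x y = \<Gamma> d (snd d p) y x"
  shows "\<Gamma> c (snd c p) x y = \<Gamma> c (snd c p) y x"
proof -
  define z where "z = snd c p"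
  define D where "D p = frechet_derivative (transition c d) (at p)" for p
  have z: "z \<in> overlap c d" using c d by (auto simp: z_def overlap_def)
  have chart: "chart_on M c" "chart_on M d" using M c d by (simp_all add: complex_manifold_def)
  then have open_d: "openin M (fst d)" by (simp add: chart_on_def)
  have tr: "transition c d z = snd d p" using transition_chart[OF chart(1) open_d] c d by (simp add: z_def)
  have ci: "z \<in> chart_image c" "snd d p \<in> chart_image d" using c d by (auto simp: z_def chart_image_def)
  have smooth: "smooth_on (overlap c d) (transition c d)"
    using M c d by (simp add: complex_manifold_def holomorphic_map_on_def)
  have lin: "linear (D z)"
    unfolding D_def by (rule has_derivative_linear[OF smooth_on_has_derivative[OF smooth z]])
  have law: "D z (\<Gamma> c z u v) = frechet_derivative (\<lambda>p. D p v) (at z) u + \<Gamma> d (snd d p) (D z u) (D z v)" for u v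
    using \<Gamma> c(1) d(1) z by (simp add: connection_def Let_def D_def tr)
  have "D z (\<Gamma> c z x y - \<Gamma> c z y x) = 0"
    unfolding linear_diff[OF lin] law sym[of "D z x"]
    using transition_second_derivative_symmetric[OF M c(1) d(1) z, of y x] by (simp add: D_def)
  moreover have "g c z u u = g d (snd d p) (D z u) (D z u)" for u
    using g c(1) d(1) z tr by (simp add: hermitian_metric_def D_def)
  moreover have "bilinear (g d (snd d p))" using g d(1) ci by (simp add: hermitian_metric_def)
  ultimately have "g c z (\<Gamma> c z x y - \<Gamma> c z y x) (\<Gamma> c z x y - \<Gamma> c z y x) = 0"
    by (simp add: bilinear_lzero)
  moreover have "u \<noteq> 0 \<Longrightarrow> g c z u u > 0" for u using g c(1) ci by (simp add: hermitian_metric_def)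
  ultimately have "\<Gamma> c z x y - \<Gamma> c z y x = 0" by (metis less_irrefl)
  then show ?thesis by (simp add: z_def)
qed

lemma curvature_at_eq:
  assumes "bilinear (G z)"
  shows "curvature_at G z x y w = frechet_derivative (\<lambda>p. G p y w) (at z) x - frechet_derivative (\<lambda>p. G p x w) (at z) y
    + G z x (G z y w) - G z y (G z x w)"
  by (simp add: curvature_at_def curvature_def cov_deriv_def lie_bracket_def bilinear_lzero[OF assms])

lemma torsion_at_eq: "torsion_at G z x y = G z x y - G z y x"
  by (simp add: torsion_at_def torsion_def cov_deriv_def lie_bracket_def)

lemma hermitian_chart_of_strominger:
  assumes M: "complex_manifold M \<A>" and g: "hermitian_metric \<A> g" and \<Gamma>: "strominger_connection \<A> g \<Gamma>"
    and c: "c \<in> \<A>"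
  shows "hermitian_chart (chart_image c) (g c) (\<Gamma> c)"
proof (rule hermitian_chart.intro)
  show "open (chart_image c)" using M c by (simp add: complex_manifold_def chart_on_def)
  show "smooth_on (chart_image c) (\<lambda>z. g c z x y)" for x y using g c by (simp add: hermitian_metric_def)
  have conn: "connection \<A> \<Gamma>" and met: "metric_connection \<A> g \<Gamma>" and com: "complex_connection \<A> \<Gamma>"
    and skew: "skew_torsion \<A> g \<Gamma>" using \<Gamma> by (simp_all add: strominger_connection_def)
  show "smooth_on (chart_image c) (\<lambda>z. \<Gamma> c z x y)" for x y using conn c by (simp add: connection_def)
  fix z assume z: "z \<in> chart_image c"
  show "hermitian_space (g c z)"
    using g c z by (simp add: hermitian_space_def hermitian_metric_def)
  show "bilinear (\<Gamma> c z)" using conn c z by (simp add: connection_def)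
  have cov: "cov_deriv (\<Gamma> c) (\<lambda>_. v) (\<lambda>_. x) z = \<Gamma> c z v x" for v x by (simp add: cov_deriv_def)
  show "frechet_derivative (\<lambda>p. g c p x y) (at z) v = g c z (\<Gamma> c z v x) y + g c z x (\<Gamma> c z v y)" for x y v
    using met[unfolded metric_connection_def, rule_format, OF c, of "\<lambda>_. v" "\<lambda>_. x" "\<lambda>_. y"] z
    by (simp add: smooth_on_const cov)
  show "\<Gamma> c z x (J y) = J (\<Gamma> c z x y)" for x y
    using com[unfolded complex_connection_def, rule_format, OF c, of "\<lambda>_. x" "\<lambda>_. y"] z
    by (simp add: smooth_on_const cov_deriv_def)
  show "g c z (\<Gamma> c z x y - \<Gamma> c z y x) w = - g c z (\<Gamma> c z x w - \<Gamma> c z w x) y" for x y w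
    using skew c z unfolding skew_torsion_def torsion_at_eq by blast
qed

lemma skl_chart_of_strominger:
  assumes M: "complex_manifold M \<A>" and g: "hermitian_metric \<A> g" and \<Gamma>: "strominger_connection \<A> g \<Gamma>"
    and kl: "kaehler_like \<A> g \<Gamma>" and n: "CARD('n) \<le> 3" and ric: "first_ricci_flat \<A> g \<Gamma>"
    and c: "(c :: ('a, 'n::finite) chart) \<in> \<A>"
  shows "skl_chart (chart_image c) (g c) (\<Gamma> c)"
proof -
  interpret hermitian_chart "chart_image c" "g c" "\<Gamma> c"
    by (rule hermitian_chart_of_strominger[OF M g \<Gamma> c])
  have R: "curvature_at (\<Gamma> c) z = R z" if "z \<in> chart_image c" for z
    by (intro ext) (simp add: curvature_at_eq \<Gamma>_bilinear that R_def D_def)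
  have kl: "g c z (R z x y u) v + g c z (R z y u x) v + g c z (R z u x y) v = 0"
    "g c z (R z x y u) v = g c z (R z (J x) (J y) u) v" if "z \<in> chart_image c" for z x y u v
    using kl[unfolded kaehler_like_def, rule_format, OF c that, of x y u v] R[OF that]
    by (simp_all add: Let_def curvature_tensor_def)
  show ?thesis
  proof
    fix z assume z: "z \<in> chart_image c"
    interpret hermitian_space "g c z" by (rule herm[OF z])
    show "R z x y u + R z y u x + R z u x y = 0" for x y u
      by (rule g_eqI) (simp add: g_bil kl(1)[OF z])
    show "R z (J x) (J y) = R z x y" for x y
      by (rule ext, rule g_eqI) (rule kl(2)[OF z, symmetric])
    fix e :: "'n \<Rightarrow> complex ^ 'n"
    assume "\<And>i j. hermitian_space.h (g c z) (e i) (e j) = (if i = j then 1 else 0)"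
    then have "unitary_frame g c z e" by (simp add: unitary_frame_def hermitian_form_def h_def)
    then show "(\<Sum>i\<in>UNIV. hermitian_space.h (g c z) (R z x y (e i)) (e i)) = 0" for x y
      using ric[unfolded first_ricci_flat_def, rule_format, OF c z, of e x y]
      by (simp add: curvature_matrix_def hermitian_form_def h_def R[OF z])
  next
    show "CARD('n) \<le> 3" by (rule n)
  qed
qed

text \<open>By \<open>g_parallel\<close> each derivative of the Kaehler form is a sum of two
  Christoffel terms; for symmetric \<open>\<Gamma>\<close> the six terms cancel in pairs.\<close>

lemma kaehler_of_symmetric_christoffel:
  assumes M: "complex_manifold M \<A>" and g: "hermitian_metric \<A> g" and \<Gamma>: "strominger_connection \<A> g \<Gamma>"
    and sym: "\<And>c z x y. c \<in> \<A> \<Longrightarrow> z \<in> chart_image c \<Longrightarrow> \<Gamma> c z x y = \<Gamma> c z y x"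
  shows "kaehler \<A> g"
  unfolding kaehler_def
proof (intro ballI allI)
  fix c z u v w assume c: "c \<in> \<A>" and z: "z \<in> chart_image c"
  interpret hermitian_chart "chart_image c" "g c" "\<Gamma> c"
    by (rule hermitian_chart_of_strominger[OF M g \<Gamma> c])
  interpret hermitian_space "g c z" by (rule herm[OF z])
  show "ext_deriv2 (kaehler_form g c) z u v w = 0"
    using sym[OF c z, of u v] sym[OF c z, of u w] sym[OF c z, of v w]
      g_sym[of v "J (\<Gamma> c z u w)"] g_J_left[of "\<Gamma> c z u w" v] g_J_left[of v "\<Gamma> c z u w"]
    by (simp add: ext_deriv2_def kaehler_form_def g_parallel[OF z] \<Gamma>_J[OF z] g_J_left)
qed

text \<open>The set where the torsion vanishes is open and closed.\<close>

lemma torsion_everywhere_or_nowhere: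
  assumes M: "complex_manifold M \<A>" and g: "hermitian_metric \<A> g" and \<Gamma>: "strominger_connection \<A> g \<Gamma>"
    and kl: "kaehler_like \<A> g \<Gamma>" and n: "CARD('n) \<le> 3" and ric: "first_ricci_flat \<A> g \<Gamma>"
    and c\<^sub>0: "(c\<^sub>0 :: ('a, 'n::finite) chart) \<in> \<A>" "z\<^sub>0 \<in> chart_image c\<^sub>0" "\<And>x y. \<Gamma> c\<^sub>0 z\<^sub>0 x y = \<Gamma> c\<^sub>0 z\<^sub>0 y x"
    and c: "c \<in> \<A>" "z \<in> chart_image c"
  shows "\<Gamma> c z x y = \<Gamma> c z y x"
proof -
  have conn: "connection \<A> \<Gamma>" using \<Gamma> by (simp add: strominger_connection_def)
  have chart: "chart_on M c" if "c \<in> \<A>" for c using M that by (simp add: complex_manifold_def)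
  have loc: "skl_chart (chart_image c) (g c) (\<Gamma> c)" if "c \<in> \<A>" for c
    by (rule skl_chart_of_strominger[OF M g \<Gamma> kl n ric that])
  have preimage: "openin M {q \<in> fst c. snd c q \<in> B}" if "c \<in> \<A>" "open B" for c B
  proof -
    have "continuous_map (subtopology M (fst c)) (subtopology euclidean (chart_image c)) (snd c)"
      and M_c: "openin M (fst c)"
      using chart[OF that(1)] by (auto simp: chart_on_def homeomorphic_eq_everything_map)
    then have "continuous_map (subtopology M (fst c)) euclidean (snd c)"
      by (simp add: continuous_map_in_subtopology)
    then have "openin (subtopology M (fst c)) {q \<in> topspace (subtopology M (fst c)). snd c q \<in> B}"
      by (rule openin_continuous_map_preimage) (simp add: that(2))
    moreover have "topspace (subtopology M (fst c)) = fst c"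
      using openin_subset[OF M_c] by auto
    ultimately have "openin (subtopology M (fst c)) {q \<in> fst c. snd c q \<in> B}"
      by (simp only:)
    then show ?thesis using M_c by (rule openin_trans_full)
  qed
  define sym where "sym c q \<longleftrightarrow> (\<forall>x y. \<Gamma> c (snd c q) x y = \<Gamma> c (snd c q) y x)" for c q
  \<comment> \<open>\<open>Z\<close> asks for one chart only. Independence of the chart is what
    shows that nonzero torsion in a single chart excludes a point from \<open>Z\<close>.\<close>
  have transfer: "sym c q" if "sym d q" "c \<in> \<A>" "d \<in> \<A>" "q \<in> fst c" "q \<in> fst d" for c d q
    using symmetric_christoffel_transition[OF M g conn that(2,4,3,5)] that(1) by (auto simp: sym_def)
  define Z where "Z = {q. \<exists>c\<in>\<A>. q \<in> fst c \<and> sym c q}"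
  have "openin M Z"
  proof (subst openin_subopen, intro ballI)
    fix q assume "q \<in> Z"
    then obtain c where c: "c \<in> \<A>" "q \<in> fst c" "sym c q" by (auto simp: Z_def)
    interpret skl_chart "chart_image c" "g c" "\<Gamma> c" by (rule loc[OF c(1)])
    have "snd c q \<in> chart_image c" using c by (simp add: chart_image_def)
    then obtain r where r: "r > 0" "\<And>z x y. z \<in> ball (snd c q) r \<Longrightarrow> T z x y = 0"
      by (rule T_locally_zero) (use c in \<open>auto simp: T_def sym_def\<close>)
    have "{p \<in> fst c. snd c p \<in> ball (snd c q) r} \<subseteq> Z"
      using r(2) c(1) by (auto simp: Z_def sym_def T_def)
    moreover have "q \<in> {p \<in> fst c. snd c p \<in> ball (snd c q) r}" using c r by simp
    ultimately show "\<exists>T. openin M T \<and> q \<in> T \<and> T \<subseteq> Z"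
      using preimage[OF c(1) open_ball] by blast
  qed
  moreover have "openin M (topspace M - Z)"
  proof (subst openin_subopen, intro ballI)
    fix q assume q: "q \<in> topspace M - Z"
    moreover have "(\<Union>c\<in>\<A>. fst c) = topspace M" using M by (simp add: complex_manifold_def)
    ultimately obtain c where c: "c \<in> \<A>" "q \<in> fst c" by blast
    interpret skl_chart "chart_image c" "g c" "\<Gamma> c" by (rule loc[OF c(1)])
    obtain x y where xy: "\<Gamma> c (snd c q) x y - \<Gamma> c (snd c q) y x \<noteq> 0"
      using q c by (auto simp: Z_def sym_def)
    have "continuous_on (chart_image c) (\<lambda>z. \<Gamma> c z x y - \<Gamma> c z y x)"
      by (intro continuous_intros smooth_on_continuous[OF \<Gamma>_smooth])
    then have "open (chart_image c \<inter> (\<lambda>z. \<Gamma> c z x y - \<Gamma> c z y x) -` (- {0}))"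
      using open_U by (rule continuous_open_preimage) (intro open_Compl closed_singleton)
    from preimage[OF c(1) this]
    have "openin M {p \<in> fst c. snd c p \<in> chart_image c \<inter> (\<lambda>z. \<Gamma> c z x y - \<Gamma> c z y x) -` (- {0})}" .
    moreover have "{p \<in> fst c. snd c p \<in> chart_image c \<inter> (\<lambda>z. \<Gamma> c z x y - \<Gamma> c z y x) -` (- {0})} \<subseteq> topspace M - Z"
    proof
      fix p assume p: "p \<in> {p \<in> fst c. snd c p \<in> chart_image c \<inter> (\<lambda>z. \<Gamma> c z x y - \<Gamma> c z y x) -` (- {0})}"
      have "p \<notin> Z"
      proof
        assume "p \<in> Z"
        then obtain d where "d \<in> \<A>" "p \<in> fst d" "sym d p" by (auto simp: Z_def)
        then have "sym c p" using transfer[of d p c] c p by auto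
        then show False using p by (auto simp: sym_def)
      qed
      moreover have "fst c \<subseteq> topspace M" using chart[OF c(1)] by (auto simp: chart_on_def dest: openin_subset)
      ultimately show "p \<in> topspace M - Z" using p by auto
    qed
    moreover have "q \<in> {p \<in> fst c. snd c p \<in> chart_image c \<inter> (\<lambda>z. \<Gamma> c z x y - \<Gamma> c z y x) -` (- {0})}"
      using c xy by (auto simp: chart_image_def)
    ultimately show "\<exists>T. openin M T \<and> q \<in> T \<and> T \<subseteq> topspace M - Z" by blast
  qed
  moreover have "Z \<subseteq> topspace M"
    using chart by (auto simp: Z_def chart_on_def dest: openin_subset)
  ultimately have "Z = {} \<or> Z = topspace M"
    using M by (auto simp: complex_manifold_def connected_space_clopen_in closedin_def)
  moreover obtain q\<^sub>0 where "q\<^sub>0 \<in> fst c\<^sub>0" "z\<^sub>0 = snd c\<^sub>0 q\<^sub>0" using c\<^sub>0(2) by (auto simp: chart_image_def)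
  then have "q\<^sub>0 \<in> Z" using c\<^sub>0 by (auto simp: Z_def sym_def)
  ultimately have Z: "Z = topspace M" by auto
  obtain q where q: "q \<in> fst c" "z = snd c q" using c(2) by (auto simp: chart_image_def)
  then have "q \<in> Z" using Z chart[OF c(1)] by (auto simp: chart_on_def dest: openin_subset)
  then obtain d where "d \<in> \<A>" "q \<in> fst d" "sym d q" by (auto simp: Z_def)
  then have "sym c q" using transfer[of d q c] c q by auto
  then show ?thesis using q by (simp add: sym_def)
qed

theorem theorem5:
  fixes M :: "'a topology"
    and \<A> :: "('a, 'n::finite) chart set"
    and g :: "('a, 'n) metric"
    and \<Gamma> :: "('a, 'n) chart \<Rightarrow> 'n christoffel"
  assumes "complex_manifold M \<A>"
    and "hermitian_metric \<A> g"
    and "strominger_connection \<A> g \<Gamma>"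
    and "\<not> kaehler \<A> g"
    and "kaehler_like \<A> g \<Gamma>"
    and "CARD('n) \<le> 3"
    and "first_ricci_flat \<A> g \<Gamma>"
  shows "flat_connection \<A> \<Gamma>"
  unfolding flat_connection_def
proof (intro ballI allI)
  fix c z x y w assume c: "c \<in> \<A>" and z: "z \<in> chart_image c"
  interpret skl_chart "chart_image c" "g c" "\<Gamma> c"
    by (rule skl_chart_of_strominger[OF assms(1-3,5-7) c])
  \<comment> \<open>A single point with symmetric \<open>\<Gamma>\<close> would make it symmetric
    everywhere, and \<open>g\<close> would be Kaehler.\<close>
  have "\<not> (\<forall>x y. \<Gamma> c z x y = \<Gamma> c z y x)"
    using kaehler_of_symmetric_christoffel[OF assms(1-3)] assms(4)
      torsion_everywhere_or_nowhere[OF assms(1-3,5-7) c z] by metis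
  then obtain x\<^sub>0 y\<^sub>0 where "T z x\<^sub>0 y\<^sub>0 \<noteq> 0" by (auto simp: T_def)
  then show "curvature_at (\<Gamma> c) z x y w = 0"
    using R_eq_0[OF z, of x\<^sub>0 y\<^sub>0 x y w] by (simp add: curvature_at_eq \<Gamma>_bilinear[OF z] R_def D_def)
qed

end
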